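(* Let $\mathcal{C}$ be a weakly lex category. Then the category $\mathcal{C}_{\mathrm{ex}}$ (the exact completion of $\mathcal{C}$, whose objects are the pseudocongruences of $\mathcal{C}$) is exact.
   Context: Conventions. $\mathsf{Pos}$ is the cartesian closed category of posets and monotone maps. "Category" means $\mathsf{Pos}$-enriched category: each hom-set $\mathcal{C}(X,Y)$ is a poset and composition is monotone in both variables. "Functor" means $\mathsf{Pos}$-enriched functor, i.e. locally monotone. Limits. For $D\colon\mathcal{D}\to\mathcal{C}$ and a weight $W\colon\mathcal{D}\to\mathsf{Pos}$, the limit $\{W,D\}$ is defined by an isomorphism of posets $\mathcal{C}(X,\{W,D\})\cong[\mathcal{D},\mathsf{Pos}](W,\mathcal{C}(X,D-))$ natural in $X$. The weight is finite if $\mathcal{D}$ has finitely many isomorphism classes of objects and all posets $\mathcal{D}(d,d')$ and $Wd$ are finite. "Finite limits" are limits with finite weights. A weak $W$-weighted limit is an object $\{W,D\}_w$ with a natural transformation $W\to\mathcal{C}(\{W,D\}_w,D-)$ such that for all $X$ the induced map $\mathcal{C}(X,\{W,D\}_w)\to[\mathcal{D},\mathsf{Pos}](W,\mathcal{C}(X,D-))$ is surjective. $\mathcal{C}$ is weakly lex if it has all weak limits with finite weights. Exactness. A morphism $m\colon X\to Y$ is an order-monomorphism if for all $u,v\colon Z\to X$, $mu\leq mv$ implies $u\leq v$. A morphism $e\colon A\to B$ is an $\mathsf{so}$-morphism if for every order-monomorphism $m\colon X\to Y$ the square formed by $-\circ e\colon\mathcal{C}(B,X)\to\mathcal{C}(A,X)$,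 $m\circ-\colon\mathcal{C}(A,X)\to\mathcal{C}(A,Y)$, $m\circ-\colon\mathcal{C}(B,X)\to\mathcal{C}(B,Y)$, $-\circ e\colon\mathcal{C}(B,Y)\to\mathcal{C}(A,Y)$ is a pullback in $\mathsf{Pos}$. A category is regular if it has all finite limits, every morphism factors as an $\mathsf{so}$-morphism followed by an order-monomorphism, and $\mathsf{so}$-morphisms are stable under pullback. A relation on $X$ is a subobject given by an order-monomorphism $E\rightarrowtail X\times X$. A congruence on $X$ is a relation $E$ on $X$ which is reflexive, transitive and an order-ideal: if $(x,y)\colon A\to X\times X$ factors through $E$, $x'\leq x$ and $y\leq y'$, then $(x',y')$ factors through $E$. The kernel congruence of $f\colon X\to Y$ is the comma object of $f$ with itself, i.e. the universal pair $c_0,c_1\colon f/f\to X$ with $fc_0\leq fc_1$ ($c_0,c_1$ jointly order-monic). A congruence is effective if it is the kernel congruence of some morphism. A category is exact if it is regular and every congruence in it is effective. The category $\mathcal{C}_{\mathrm{ex}}$. A pseudocongruence in $\mathcal{C}$ is a parallel pair $r_0,r_1\colon R\to X$ such that: (1) (order-reflexive) for every $a_0\leq a_1\colon A\to X$ there is $u\colon A\to R$ with $r_0u=a_0$, $r_1u=a_1$; (2) (transitive) for a weak pullback $d_0,d_1\colon R*R\to R$ with $r_1d_0=r_0d_1$ there is $\tau\colon R*R\to R$ with $r_0\tau=r_0d_0$, $r_1\tau=r_1d_1$. Objects of $\mathcal{C}_{\mathrm{ex}}$ are the pseudocongruences, written $(X,R)$. Given $(X,R)$ and $(Y,S)$,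 consider morphisms $f\colon X\to Y$ in $\mathcal{C}$ for which there is $\bar f\colon R\to S$ with $s_0\bar f=fr_0$, $s_1\bar f=fr_1$. For such morphisms put $f\preccurlyeq g$ iff there is $\Sigma\colon X\to S$ with $s_0\Sigma=f$, $s_1\Sigma=g$; this is a preorder. Morphisms $[f]\colon(X,R)\to(Y,S)$ are the classes of such $f$ under the induced equivalence relation, ordered by $[f]\leq[g]$ iff $f\preccurlyeq g$, with composition induced from $\mathcal{C}$. *)

theory Defs
  imports Main
begin

section \<open>Posets\<close>

definition poset_on :: "'a set \<Rightarrow> ('a \<Rightarrow> 'a \<Rightarrow> bool) \<Rightarrow> bool" where
  "poset_on A le \<longleftrightarrow> reflp_on A le \<and> transp_on A le \<and> antisymp_on A le"

definition poset_iso ::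
  "'a set \<Rightarrow> ('a \<Rightarrow> 'a \<Rightarrow> bool) \<Rightarrow> 'b set \<Rightarrow> ('b \<Rightarrow> 'b \<Rightarrow> bool) \<Rightarrow> ('a \<Rightarrow> 'b) \<Rightarrow> bool" where
  "poset_iso A leA B leB f \<longleftrightarrow>
     bij_betw f A B \<and> (\<forall>x\<in>A. \<forall>y\<in>A. leA x y \<longleftrightarrow> leB (f x) (f y))"

text \<open>The square with sides \<open>p: P \<rightarrow> A\<close>, \<open>q: P \<rightarrow> B\<close>, \<open>f: A \<rightarrow> C\<close>, \<open>g: B \<rightarrow> C\<close> is a pullback of
  posets: the comparison with the set of compatible pairs, ordered componentwise, is an isomorphism.
  Commutativity of the square is included.\<close>
definition poset_pullback ::
  "'p set \<Rightarrow> ('p \<Rightarrow> 'p \<Rightarrow> bool) \<Rightarrow> 'a set \<Rightarrow> ('a \<Rightarrow> 'a \<Rightarrow> bool) \<Rightarrow> 'b set \<Rightarrow> ('b \<Rightarrow> 'b \<Rightarrow> bool) \<Rightarrow>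
   ('p \<Rightarrow> 'a) \<Rightarrow> ('p \<Rightarrow> 'b) \<Rightarrow> ('a \<Rightarrow> 'c) \<Rightarrow> ('b \<Rightarrow> 'c) \<Rightarrow> bool" where
  "poset_pullback P leP A leA B leB p q f g \<longleftrightarrow>
     poset_iso P leP {(a, b). a \<in> A \<and> b \<in> B \<and> f a = g b} (rel_prod leA leB) (\<lambda>x. (p x, q x))"


section \<open>Poset-enriched categories, functors and weights\<close>

text \<open>All operations carry their objects as arguments, so hom-sets need not be disjoint.
  \<open>Cmp C X Y Z g f\<close> is the composite of \<open>f: X \<rightarrow> Y\<close> followed by \<open>g: Y \<rightarrow> Z\<close>.
  Only the values on objects and on members of the hom-sets are meaningful.\<close>
record ('o, 'm) pcat =
  Obj :: "'o set"
  Hom :: "'o \<Rightarrow> 'o \<Rightarrow> 'm set"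
  Le :: "'o \<Rightarrow> 'o \<Rightarrow> 'm \<Rightarrow> 'm \<Rightarrow> bool"
  Cmp :: "'o \<Rightarrow> 'o \<Rightarrow> 'o \<Rightarrow> 'm \<Rightarrow> 'm \<Rightarrow> 'm"
  Idt :: "'o \<Rightarrow> 'm"

locale pos_category =
  fixes C :: "('o, 'm) pcat"
  assumes hom_poset: "\<lbrakk>X \<in> Obj C; Y \<in> Obj C\<rbrakk> \<Longrightarrow> poset_on (Hom C X Y) (Le C X Y)"
    and id_hom: "X \<in> Obj C \<Longrightarrow> Idt C X \<in> Hom C X X"
    and comp_hom: "\<lbrakk>X \<in> Obj C; Y \<in> Obj C; Z \<in> Obj C; f \<in> Hom C X Y; g \<in> Hom C Y Z\<rbrakk>
      \<Longrightarrow> Cmp C X Y Z g f \<in> Hom C X Z"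
    and comp_id_right: "\<lbrakk>X \<in> Obj C; Y \<in> Obj C; f \<in> Hom C X Y\<rbrakk> \<Longrightarrow> Cmp C X X Y f (Idt C X) = f"
    and comp_id_left: "\<lbrakk>X \<in> Obj C; Y \<in> Obj C; f \<in> Hom C X Y\<rbrakk> \<Longrightarrow> Cmp C X Y Y (Idt C Y) f = f"
    and comp_assoc: "\<lbrakk>X \<in> Obj C; Y \<in> Obj C; Z \<in> Obj C; V \<in> Obj C;
        f \<in> Hom C X Y; g \<in> Hom C Y Z; h \<in> Hom C Z V\<rbrakk>
      \<Longrightarrow> Cmp C X Z V h (Cmp C X Y Z g f) = Cmp C X Y V (Cmp C Y Z V h g) f"
    and comp_mono: "\<lbrakk>X \<in> Obj C; Y \<in> Obj C; Z \<in> Obj C;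
        f \<in> Hom C X Y; f' \<in> Hom C X Y; g \<in> Hom C Y Z; g' \<in> Hom C Y Z;
        Le C X Y f f'; Le C Y Z g g'\<rbrakk>
      \<Longrightarrow> Le C X Z (Cmp C X Y Z g f) (Cmp C X Y Z g' f')"

definition isomorphic :: "('o, 'm) pcat \<Rightarrow> 'o \<Rightarrow> 'o \<Rightarrow> bool" where
  "isomorphic C X Y \<longleftrightarrow> (\<exists>f\<in>Hom C X Y. \<exists>g\<in>Hom C Y X.
     Cmp C X Y X g f = Idt C X \<and> Cmp C Y X Y f g = Idt C Y)"

record ('d, 'e, 'o, 'm) pfunctor =
  FObj :: "'d \<Rightarrow> 'o"
  FMap :: "'d \<Rightarrow> 'd \<Rightarrow> 'e \<Rightarrow> 'm"

locale pos_functor =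
  dom: pos_category D + cod: pos_category C
  for D :: "('d, 'e) pcat" and C :: "('o, 'm) pcat" +
  fixes F :: "('d, 'e, 'o, 'm) pfunctor"
  assumes fobj: "a \<in> Obj D \<Longrightarrow> FObj F a \<in> Obj C"
    and fmap_hom: "\<lbrakk>a \<in> Obj D; b \<in> Obj D; e \<in> Hom D a b\<rbrakk>
      \<Longrightarrow> FMap F a b e \<in> Hom C (FObj F a) (FObj F b)"
    and fmap_id: "a \<in> Obj D \<Longrightarrow> FMap F a a (Idt D a) = Idt C (FObj F a)"
    and fmap_comp: "\<lbrakk>a \<in> Obj D; b \<in> Obj D; c \<in> Obj D; e \<in> Hom D a b; e' \<in> Hom D b c\<rbrakk>
      \<Longrightarrow> FMap F a c (Cmp D a b c e' e)
        = Cmp C (FObj F a) (FObj F b) (FObj F c) (FMap F b c e') (FMap F a b e)"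
    and fmap_mono: "\<lbrakk>a \<in> Obj D; b \<in> Obj D; e \<in> Hom D a b; e' \<in> Hom D a b; Le D a b e e'\<rbrakk>
      \<Longrightarrow> Le C (FObj F a) (FObj F b) (FMap F a b e) (FMap F a b e')"

text \<open>Functors from a category to the category of posets; the posets \<open>(PSet W d, PLe W d)\<close> are
  carved out of a common type.\<close>
record ('d, 'e, 'w) to_pos =
  PSet :: "'d \<Rightarrow> 'w set"
  PLe :: "'d \<Rightarrow> 'w \<Rightarrow> 'w \<Rightarrow> bool"
  PMap :: "'d \<Rightarrow> 'd \<Rightarrow> 'e \<Rightarrow> 'w \<Rightarrow> 'w"

locale pos_valued_functor =
  pos_category D for D :: "('d, 'e) pcat" +
  fixes W :: "('d, 'e, 'w) to_pos"
  assumes val_poset: "a \<in> Obj D \<Longrightarrow> poset_on (PSet W a) (PLe W a)"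
    and val_map: "\<lbrakk>a \<in> Obj D; b \<in> Obj D; e \<in> Hom D a b; w \<in> PSet W a\<rbrakk>
      \<Longrightarrow> PMap W a b e w \<in> PSet W b"
    and val_map_mono: "\<lbrakk>a \<in> Obj D; b \<in> Obj D; e \<in> Hom D a b; w \<in> PSet W a; w' \<in> PSet W a;
        PLe W a w w'\<rbrakk> \<Longrightarrow> PLe W b (PMap W a b e w) (PMap W a b e w')"
    and val_id: "\<lbrakk>a \<in> Obj D; w \<in> PSet W a\<rbrakk> \<Longrightarrow> PMap W a a (Idt D a) w = w"
    and val_comp: "\<lbrakk>a \<in> Obj D; b \<in> Obj D; c \<in> Obj D; e \<in> Hom D a b; e' \<in> Hom D b c;
        w \<in> PSet W a\<rbrakk> \<Longrightarrow> PMap W a c (Cmp D a b c e' e) w = PMap W b c e' (PMap W a b e w)"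
    and val_mono: "\<lbrakk>a \<in> Obj D; b \<in> Obj D; e \<in> Hom D a b; e' \<in> Hom D a b; Le D a b e e';
        w \<in> PSet W a\<rbrakk> \<Longrightarrow> PLe W b (PMap W a b e w) (PMap W a b e' w)"

text \<open>The hom-poset \<open>[D, Pos](V, W)\<close>. Transformations are \<open>undefined\<close> off their domain, so that
  equality of functions is equality of transformations.\<close>
definition nat_trans ::
  "('d, 'e) pcat \<Rightarrow> ('d, 'e, 'v) to_pos \<Rightarrow> ('d, 'e, 'w) to_pos \<Rightarrow> ('d \<Rightarrow> 'v \<Rightarrow> 'w) set" where
  "nat_trans D V W = {\<alpha>.
     (\<forall>d x. \<not> (d \<in> Obj D \<and> x \<in> PSet V d) \<longrightarrow> \<alpha> d x = undefined) \<and>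
     (\<forall>d\<in>Obj D. \<forall>x\<in>PSet V d. \<alpha> d x \<in> PSet W d) \<and>
     (\<forall>d\<in>Obj D. \<forall>x\<in>PSet V d. \<forall>y\<in>PSet V d. PLe V d x y \<longrightarrow> PLe W d (\<alpha> d x) (\<alpha> d y)) \<and>
     (\<forall>a\<in>Obj D. \<forall>b\<in>Obj D. \<forall>e\<in>Hom D a b. \<forall>x\<in>PSet V a.
        \<alpha> b (PMap V a b e x) = PMap W a b e (\<alpha> a x))}"

definition nat_trans_le ::
  "('d, 'e) pcat \<Rightarrow> ('d, 'e, 'v) to_pos \<Rightarrow> ('d, 'e, 'w) to_pos \<Rightarrow>
   ('d \<Rightarrow> 'v \<Rightarrow> 'w) \<Rightarrow> ('d \<Rightarrow> 'v \<Rightarrow> 'w) \<Rightarrow> bool" where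
  "nat_trans_le D V W \<alpha> \<beta> \<longleftrightarrow> (\<forall>d\<in>Obj D. \<forall>x\<in>PSet V d. PLe W d (\<alpha> d x) (\<beta> d x))"

text \<open>\<open>hom_functor C X F\<close> is \<open>C(X, F-)\<close>.\<close>
definition hom_functor ::
  "('o, 'm) pcat \<Rightarrow> 'o \<Rightarrow> ('d, 'e, 'o, 'm) pfunctor \<Rightarrow> ('d, 'e, 'm) to_pos" where
  "hom_functor C X F =
     \<lparr> PSet = (\<lambda>d. Hom C X (FObj F d)),
       PLe = (\<lambda>d. Le C X (FObj F d)),
       PMap = (\<lambda>a b e. Cmp C X (FObj F a) (FObj F b) (FMap F a b e)) \<rparr>"

text \<open>The action of \<open>u: X \<rightarrow> Y\<close> on \<open>\<alpha>: W \<rightarrow> C(Y, F-)\<close>, giving \<open>W \<rightarrow> C(X, F-)\<close>.\<close>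
definition cylinder_comp ::
  "('d, 'e) pcat \<Rightarrow> ('d, 'e, 'w) to_pos \<Rightarrow> ('o, 'm) pcat \<Rightarrow> ('d, 'e, 'o, 'm) pfunctor \<Rightarrow>
   'o \<Rightarrow> 'o \<Rightarrow> ('d \<Rightarrow> 'w \<Rightarrow> 'm) \<Rightarrow> 'm \<Rightarrow> ('d \<Rightarrow> 'w \<Rightarrow> 'm)" where
  "cylinder_comp D W C F X Y \<alpha> u = (\<lambda>d w.
     if d \<in> Obj D \<and> w \<in> PSet W d then Cmp C X Y (FObj F d) (\<alpha> d w) u else undefined)"


section \<open>Weighted limits\<close>

definition is_limit ::
  "('d, 'e) pcat \<Rightarrow> ('d, 'e, 'w) to_pos \<Rightarrow> ('o, 'm) pcat \<Rightarrow> ('d, 'e, 'o, 'm) pfunctor \<Rightarrow>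
   'o \<Rightarrow> ('o \<Rightarrow> 'm \<Rightarrow> 'd \<Rightarrow> 'w \<Rightarrow> 'm) \<Rightarrow> bool" where
  "is_limit D W C F L \<phi> \<longleftrightarrow> L \<in> Obj C \<and>
     (\<forall>X\<in>Obj C. poset_iso (Hom C X L) (Le C X L)
        (nat_trans D W (hom_functor C X F)) (nat_trans_le D W (hom_functor C X F)) (\<phi> X)) \<and>
     (\<forall>X\<in>Obj C. \<forall>Y\<in>Obj C. \<forall>u\<in>Hom C X Y. \<forall>v\<in>Hom C Y L.
        \<phi> X (Cmp C X Y L v u) = cylinder_comp D W C F X Y (\<phi> Y v) u)"

definition is_weak_limit ::
  "('d, 'e) pcat \<Rightarrow> ('d, 'e, 'w) to_pos \<Rightarrow> ('o, 'm) pcat \<Rightarrow> ('d, 'e, 'o, 'm) pfunctor \<Rightarrow>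
   'o \<Rightarrow> ('d \<Rightarrow> 'w \<Rightarrow> 'm) \<Rightarrow> bool" where
  "is_weak_limit D W C F L \<kappa> \<longleftrightarrow> L \<in> Obj C \<and> \<kappa> \<in> nat_trans D W (hom_functor C L F) \<and>
     (\<forall>X\<in>Obj C. cylinder_comp D W C F X L \<kappa> ` Hom C X L = nat_trans D W (hom_functor C X F))"

definition finite_weight :: "('d, 'e) pcat \<Rightarrow> ('d, 'e, 'w) to_pos \<Rightarrow> bool" where
  "finite_weight D W \<longleftrightarrow>
     finite (Obj D // {(a, b). a \<in> Obj D \<and> b \<in> Obj D \<and> isomorphic D a b}) \<and>
     (\<forall>a\<in>Obj D. \<forall>b\<in>Obj D. finite (Hom D a b)) \<and>
     (\<forall>a\<in>Obj D. finite (PSet W a))"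

text \<open>A definition cannot quantify over the types that carry the objects and arrows of \<open>D\<close> and the
  elements of \<open>W\<close>, so these types are parameters. At \<open>nat\<close> all finite weights are covered, since
  every finite weight is, up to an equivalence of its index category \<open>D\<close>, one with finite \<open>Obj D\<close>
  and all elements taken from \<open>nat\<close>.\<close>
definition has_finite_limits :: "'d itself \<Rightarrow> 'e itself \<Rightarrow> 'w itself \<Rightarrow> ('o, 'm) pcat \<Rightarrow> bool" where
  "has_finite_limits TD TE TW C \<longleftrightarrow>
     (\<forall>(D :: ('d, 'e) pcat) (W :: ('d, 'e, 'w) to_pos) F.
        pos_functor D C F \<and> pos_valued_functor D W \<and> finite_weight D W \<longrightarrow>
        (\<exists>L \<phi>. is_limit D W C F L \<phi>))"

definition weakly_lex :: "'d itself \<Rightarrow> 'e itself \<Rightarrow> 'w itself \<Rightarrow> ('o, 'm) pcat \<Rightarrow> bool" where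
  "weakly_lex TD TE TW C \<longleftrightarrow> pos_category C \<and>
     (\<forall>(D :: ('d, 'e) pcat) (W :: ('d, 'e, 'w) to_pos) F.
        pos_functor D C F \<and> pos_valued_functor D W \<and> finite_weight D W \<longrightarrow>
        (\<exists>L \<kappa>. is_weak_limit D W C F L \<kappa>))"


section \<open>Pullbacks, products and comma objects\<close>

text \<open>The universal properties below are the defining isomorphisms of the respective weighted
  limits, with the cylinders written as pairs. Taking \<open>Z = P\<close> and the identity of \<open>P\<close> shows that
  the pair \<open>p, q\<close> itself is compatible.\<close>

definition is_pullback ::
  "('o, 'm) pcat \<Rightarrow> 'o \<Rightarrow> 'o \<Rightarrow> 'o \<Rightarrow> 'o \<Rightarrow> 'm \<Rightarrow> 'm \<Rightarrow> 'm \<Rightarrow> 'm \<Rightarrow> bool" where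
  "is_pullback C P X Y B p q f g \<longleftrightarrow>
     P \<in> Obj C \<and> X \<in> Obj C \<and> Y \<in> Obj C \<and> B \<in> Obj C \<and>
     p \<in> Hom C P X \<and> q \<in> Hom C P Y \<and> f \<in> Hom C X B \<and> g \<in> Hom C Y B \<and>
     (\<forall>Z\<in>Obj C. poset_pullback (Hom C Z P) (Le C Z P)
        (Hom C Z X) (Le C Z X) (Hom C Z Y) (Le C Z Y)
        (Cmp C Z P X p) (Cmp C Z P Y q) (Cmp C Z X B f) (Cmp C Z Y B g))"

definition is_weak_pullback ::
  "('o, 'm) pcat \<Rightarrow> 'o \<Rightarrow> 'o \<Rightarrow> 'o \<Rightarrow> 'o \<Rightarrow> 'm \<Rightarrow> 'm \<Rightarrow> 'm \<Rightarrow> 'm \<Rightarrow> bool" where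
  "is_weak_pullback C P X Y B p q f g \<longleftrightarrow>
     P \<in> Obj C \<and> X \<in> Obj C \<and> Y \<in> Obj C \<and> B \<in> Obj C \<and>
     p \<in> Hom C P X \<and> q \<in> Hom C P Y \<and> f \<in> Hom C X B \<and> g \<in> Hom C Y B \<and>
     (\<forall>Z\<in>Obj C. (\<lambda>h. (Cmp C Z P X p h, Cmp C Z P Y q h)) ` Hom C Z P =
        {(a, b). a \<in> Hom C Z X \<and> b \<in> Hom C Z Y \<and> Cmp C Z X B f a = Cmp C Z Y B g b})"

definition is_product :: "('o, 'm) pcat \<Rightarrow> 'o \<Rightarrow> 'o \<Rightarrow> 'o \<Rightarrow> 'm \<Rightarrow> 'm \<Rightarrow> bool" where
  "is_product C P X Y p q \<longleftrightarrow>
     P \<in> Obj C \<and> X \<in> Obj C \<and> Y \<in> Obj C \<and> p \<in> Hom C P X \<and> q \<in> Hom C P Y \<and>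
     (\<forall>Z\<in>Obj C. poset_iso (Hom C Z P) (Le C Z P)
        (Hom C Z X \<times> Hom C Z Y) (rel_prod (Le C Z X) (Le C Z Y))
        (\<lambda>h. (Cmp C Z P X p h, Cmp C Z P Y q h)))"

definition is_comma ::
  "('o, 'm) pcat \<Rightarrow> 'o \<Rightarrow> 'o \<Rightarrow> 'o \<Rightarrow> 'o \<Rightarrow> 'm \<Rightarrow> 'm \<Rightarrow> 'm \<Rightarrow> 'm \<Rightarrow> bool" where
  "is_comma C P X Y B p q f g \<longleftrightarrow>
     P \<in> Obj C \<and> X \<in> Obj C \<and> Y \<in> Obj C \<and> B \<in> Obj C \<and>
     p \<in> Hom C P X \<and> q \<in> Hom C P Y \<and> f \<in> Hom C X B \<and> g \<in> Hom C Y B \<and>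
     (\<forall>Z\<in>Obj C. poset_iso (Hom C Z P) (Le C Z P)
        {(a, b). a \<in> Hom C Z X \<and> b \<in> Hom C Z Y \<and> Le C Z B (Cmp C Z X B f a) (Cmp C Z Y B g b)}
        (rel_prod (Le C Z X) (Le C Z Y))
        (\<lambda>h. (Cmp C Z P X p h, Cmp C Z P Y q h)))"


section \<open>Regularity and exactness\<close>

definition order_mono :: "('o, 'm) pcat \<Rightarrow> 'o \<Rightarrow> 'o \<Rightarrow> 'm \<Rightarrow> bool" where
  "order_mono C X Y m \<longleftrightarrow> m \<in> Hom C X Y \<and>
     (\<forall>Z\<in>Obj C. \<forall>u\<in>Hom C Z X. \<forall>v\<in>Hom C Z X.
        Le C Z Y (Cmp C Z X Y m u) (Cmp C Z X Y m v) \<longrightarrow> Le C Z X u v)"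

definition so_morphism :: "('o, 'm) pcat \<Rightarrow> 'o \<Rightarrow> 'o \<Rightarrow> 'm \<Rightarrow> bool" where
  "so_morphism C A B e \<longleftrightarrow> e \<in> Hom C A B \<and>
     (\<forall>X\<in>Obj C. \<forall>Y\<in>Obj C. \<forall>m. order_mono C X Y m \<longrightarrow>
        poset_pullback (Hom C B X) (Le C B X)
          (Hom C A X) (Le C A X) (Hom C B Y) (Le C B Y)
          (\<lambda>d. Cmp C A B X d e) (Cmp C B X Y m) (Cmp C A X Y m) (\<lambda>b. Cmp C A B Y b e))"

definition regular :: "'d itself \<Rightarrow> 'e itself \<Rightarrow> 'w itself \<Rightarrow> ('o, 'm) pcat \<Rightarrow> bool" where
  "regular TD TE TW C \<longleftrightarrow> pos_category C \<and> has_finite_limits TD TE TW C \<and>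
     (\<forall>X\<in>Obj C. \<forall>Y\<in>Obj C. \<forall>f\<in>Hom C X Y. \<exists>I\<in>Obj C. \<exists>e m.
        so_morphism C X I e \<and> order_mono C I Y m \<and> f = Cmp C X I Y m e) \<and>
     (\<forall>P X Y B p q f g. is_pullback C P X Y B p q f g \<and> so_morphism C Y B g \<longrightarrow>
        so_morphism C P X p)"

definition factors_through :: "('o, 'm) pcat \<Rightarrow> 'o \<Rightarrow> 'o \<Rightarrow> 'o \<Rightarrow> 'm \<Rightarrow> 'm \<Rightarrow> bool" where
  "factors_through C A E P m k \<longleftrightarrow> (\<exists>h\<in>Hom C A E. k = Cmp C A E P m h)"

text \<open>The order-monomorphism \<open>m: E \<rightarrow> P\<close> into the product \<open>(P, p, q)\<close> of \<open>X\<close> with itself is a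
  congruence. Pairs \<open>(x, y): A \<rightarrow> X \<times> X\<close> are written as morphisms \<open>k: A \<rightarrow> P\<close>, with
  \<open>x = p k\<close> and \<open>y = q k\<close>.\<close>
definition congruence ::
  "('o, 'm) pcat \<Rightarrow> 'o \<Rightarrow> 'o \<Rightarrow> 'm \<Rightarrow> 'm \<Rightarrow> 'o \<Rightarrow> 'm \<Rightarrow> bool" where
  "congruence C X P p q E m \<longleftrightarrow>
     is_product C P X X p q \<and> E \<in> Obj C \<and> order_mono C E P m \<and>
     (\<forall>A\<in>Obj C. \<forall>k\<in>Hom C A P. Cmp C A P X p k = Cmp C A P X q k \<longrightarrow>
        factors_through C A E P m k) \<and>
     (\<forall>A\<in>Obj C. \<forall>k\<in>Hom C A P. \<forall>k'\<in>Hom C A P. \<forall>l\<in>Hom C A P.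
        factors_through C A E P m k \<and> factors_through C A E P m k' \<and>
        Cmp C A P X q k = Cmp C A P X p k' \<and>
        Cmp C A P X p l = Cmp C A P X p k \<and> Cmp C A P X q l = Cmp C A P X q k' \<longrightarrow>
        factors_through C A E P m l) \<and>
     (\<forall>A\<in>Obj C. \<forall>k\<in>Hom C A P. \<forall>k'\<in>Hom C A P.
        factors_through C A E P m k \<and>
        Le C A X (Cmp C A P X p k') (Cmp C A P X p k) \<and>
        Le C A X (Cmp C A P X q k) (Cmp C A P X q k') \<longrightarrow>
        factors_through C A E P m k')"

definition effective ::
  "('o, 'm) pcat \<Rightarrow> 'o \<Rightarrow> 'o \<Rightarrow> 'm \<Rightarrow> 'm \<Rightarrow> 'o \<Rightarrow> 'm \<Rightarrow> bool" where
  "effective C X P p q E m \<longleftrightarrow> (\<exists>Y\<in>Obj C. \<exists>f\<in>Hom C X Y.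
     is_comma C E X X Y (Cmp C E P X p m) (Cmp C E P X q m) f f)"

definition exact :: "'d itself \<Rightarrow> 'e itself \<Rightarrow> 'w itself \<Rightarrow> ('o, 'm) pcat \<Rightarrow> bool" where
  "exact TD TE TW C \<longleftrightarrow> regular TD TE TW C \<and>
     (\<forall>X P p q E m. congruence C X P p q E m \<longrightarrow> effective C X P p q E m)"


section \<open>The exact completion\<close>

text \<open>A parallel pair \<open>r\<^sub>0, r\<^sub>1: R \<rightarrow> X\<close>.\<close>
record ('o, 'm) parallel_pair =
  Base :: 'o
  Rel :: 'o
  R0 :: 'm
  R1 :: 'm

definition pseudocongruence :: "('o, 'm) pcat \<Rightarrow> ('o, 'm) parallel_pair \<Rightarrow> bool" where
  "pseudocongruence C S \<longleftrightarrow>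
     Base S \<in> Obj C \<and> Rel S \<in> Obj C \<and>
     R0 S \<in> Hom C (Rel S) (Base S) \<and> R1 S \<in> Hom C (Rel S) (Base S) \<and>
     (\<forall>A\<in>Obj C. \<forall>a0\<in>Hom C A (Base S). \<forall>a1\<in>Hom C A (Base S). Le C A (Base S) a0 a1 \<longrightarrow>
        (\<exists>u\<in>Hom C A (Rel S). Cmp C A (Rel S) (Base S) (R0 S) u = a0 \<and>
           Cmp C A (Rel S) (Base S) (R1 S) u = a1)) \<and>
     (\<exists>Q d0 d1. is_weak_pullback C Q (Rel S) (Rel S) (Base S) d0 d1 (R1 S) (R0 S) \<and>
        (\<exists>\<tau>\<in>Hom C Q (Rel S).
           Cmp C Q (Rel S) (Base S) (R0 S) \<tau> = Cmp C Q (Rel S) (Base S) (R0 S) d0 \<and>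
           Cmp C Q (Rel S) (Base S) (R1 S) \<tau> = Cmp C Q (Rel S) (Base S) (R1 S) d1))"

definition pc_premorphisms ::
  "('o, 'm) pcat \<Rightarrow> ('o, 'm) parallel_pair \<Rightarrow> ('o, 'm) parallel_pair \<Rightarrow> 'm set" where
  "pc_premorphisms C S T = {f \<in> Hom C (Base S) (Base T). \<exists>f'\<in>Hom C (Rel S) (Rel T).
     Cmp C (Rel S) (Rel T) (Base T) (R0 T) f' = Cmp C (Rel S) (Base S) (Base T) f (R0 S) \<and>
     Cmp C (Rel S) (Rel T) (Base T) (R1 T) f' = Cmp C (Rel S) (Base S) (Base T) f (R1 S)}"

definition pc_preceq ::
  "('o, 'm) pcat \<Rightarrow> ('o, 'm) parallel_pair \<Rightarrow> ('o, 'm) parallel_pair \<Rightarrow> 'm \<Rightarrow> 'm \<Rightarrow> bool" where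
  "pc_preceq C S T f g \<longleftrightarrow> (\<exists>s\<in>Hom C (Base S) (Rel T).
     Cmp C (Base S) (Rel T) (Base T) (R0 T) s = f \<and>
     Cmp C (Base S) (Rel T) (Base T) (R1 T) s = g)"

definition pc_equiv ::
  "('o, 'm) pcat \<Rightarrow> ('o, 'm) parallel_pair \<Rightarrow> ('o, 'm) parallel_pair \<Rightarrow> 'm rel" where
  "pc_equiv C S T = {(f, g). f \<in> pc_premorphisms C S T \<and> g \<in> pc_premorphisms C S T \<and>
     pc_preceq C S T f g \<and> pc_preceq C S T g f}"

text \<open>In \<open>Le\<close> and \<open>Cmp\<close> the choice of representatives is immaterial; the union in \<open>Cmp\<close> is over
  one and the same class.\<close>
definition ex_completion :: "('o, 'm) pcat \<Rightarrow> (('o, 'm) parallel_pair, 'm set) pcat" where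
  "ex_completion C =
     \<lparr> Obj = {S. pseudocongruence C S},
       Hom = (\<lambda>S T. pc_premorphisms C S T // pc_equiv C S T),
       Le = (\<lambda>S T F G. \<exists>f\<in>F. \<exists>g\<in>G. pc_preceq C S T f g),
       Cmp = (\<lambda>S T U G F. \<Union>g\<in>G. \<Union>f\<in>F.
         pc_equiv C S U `` {Cmp C (Base S) (Base T) (Base U) g f}),
       Idt = (\<lambda>S. pc_equiv C S S `` {Idt C (Base S)}) \<rparr>"

end

theory Submission
  imports Defs
begin

text \<open>
  A parallel pair \<open>R \<rightarrow> X\<close> is a pseudocongruence iff for every \<open>A\<close> the pairs in \<open>C(A, X)\<close> that
  factor through \<open>R\<close> form a preorder containing the order of \<open>C(A, X)\<close>, and the morphisms of the
  completion are those preserving these preorders. Weak finite limits suffice to present every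
  preorder that is defined from given ones by conjunctions and existential quantifiers.
  This yields limits of finite systems of inequalities, hence all finite limits; images, by pulling
  the preorder of the codomain back along \<open>f\<close>; and the quotient of \<open>X\<close> by a congruence, which has
  the same base \<open>X\<close> and a coarser preorder. As every object of \<open>C\<close> carries a discrete pseudocongruence,
  order-monomorphisms are the morphisms reflecting the preorders, and the so-morphisms are
  those with a section in \<open>C\<close> up to equivalence; the latter property is stable under pullback.
\<close>

text \<open>Weak limits supply mediating morphisms without uniqueness, so a universal property in
  \<open>C\<close> never proves two morphisms equal. Two facts compensate. Forgetting a component of
  a weakly universal family amounts to quantifying it existentially, which is why existential
  quantifiers cost nothing. And the preorder put on a weak limit object may be the one that compares
  components; it identifies all mediating morphisms with the same components, so weak limits of
  \<open>C\<close> become limits in the completion. The recurring obstacle is that a morphism of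
  \<open>C\<close> obtained in this way, such as the section belonging to an so-morphism, need not
  preserve the preorders. It is then used out of a discrete object, where preservation is automatic,
  or shown to preserve them because its composite with an order-monomorphism is equivalent to a
  morphism that does. Weak limits of a single shape are ever formed, indexed by natural numbers;
  hence weak limits over \<open>nat\<close> yield limits over index data of any types.\<close>

lemma poset_isoI:
  assumes "poset_on A leA" "\<And>x. x \<in> A \<Longrightarrow> f x \<in> B" "\<And>y. y \<in> B \<Longrightarrow> \<exists>x\<in>A. f x = y"
    and le: "\<And>x y. \<lbrakk>x \<in> A; y \<in> A\<rbrakk> \<Longrightarrow> leA x y \<longleftrightarrow> leB (f x) (f y)"
  shows "poset_iso A leA B leB f"
proof -
  \<comment> \<open>Reflection of the order makes \<open>f\<close> injective, so bijectivity is left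
    with surjectivity alone.\<close>
  have "x = y" if "x \<in> A" "y \<in> A" "f x = f y" for x y
  proof -
    have "leA x x" "leA y y" using assms(1) that by (auto simp: poset_on_def reflp_on_def)
    then have "leA x y" "leA y x" using le that by metis+
    then show ?thesis using assms(1) that by (auto simp: poset_on_def antisymp_on_def)
  qed
  then show ?thesis
    unfolding poset_iso_def bij_betw_def inj_on_def using assms by (auto simp: image_iff) metis
qed

section \<open>Hom-posets and weak representability\<close>

context pos_category
begin

lemma Le_refl: "\<lbrakk>X \<in> Obj C; Y \<in> Obj C; f \<in> Hom C X Y\<rbrakk> \<Longrightarrow> Le C X Y f f"
  using hom_poset[of X Y] by (auto simp: poset_on_def reflp_on_def)

lemma Le_trans:
  "\<lbrakk>Le C X Y f g; Le C X Y g h; X \<in> Obj C; Y \<in> Obj C; f \<in> Hom C X Y; g \<in> Hom C X Y; h \<in> Hom C X Y\<rbrakk>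
    \<Longrightarrow> Le C X Y f h"
  using hom_poset[of X Y] unfolding poset_on_def transp_on_def by blast

lemma Le_antisym:
  "\<lbrakk>Le C X Y f g; Le C X Y g f; X \<in> Obj C; Y \<in> Obj C; f \<in> Hom C X Y; g \<in> Hom C X Y\<rbrakk> \<Longrightarrow> f = g"
  using hom_poset[of X Y] unfolding poset_on_def antisymp_on_def by blast

lemma comp_mono_right:
  "\<lbrakk>Le C X Y f f'; X \<in> Obj C; Y \<in> Obj C; Z \<in> Obj C; f \<in> Hom C X Y; f' \<in> Hom C X Y; g \<in> Hom C Y Z\<rbrakk>
    \<Longrightarrow> Le C X Z (Cmp C X Y Z g f) (Cmp C X Y Z g f')"
  by (rule comp_mono) (auto intro: Le_refl)

lemma comp_mono_left:
  "\<lbrakk>Le C Y Z g g'; X \<in> Obj C; Y \<in> Obj C; Z \<in> Obj C; f \<in> Hom C X Y; g \<in> Hom C Y Z; g' \<in> Hom C Y Z\<rbrakk>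
    \<Longrightarrow> Le C X Z (Cmp C X Y Z g f) (Cmp C X Y Z g' f)"
  by (rule comp_mono) (auto intro: Le_refl)

lemma order_mono_inj:
  assumes "order_mono C X Y m" "X \<in> Obj C" "Y \<in> Obj C" "Z \<in> Obj C" "u \<in> Hom C Z X" "v \<in> Hom C Z X"
    "Cmp C Z X Y m u = Cmp C Z X Y m v"
  shows "u = v"
proof -
  have "Le C Z Y (Cmp C Z X Y m u) (Cmp C Z X Y m v)" "Le C Z Y (Cmp C Z X Y m v) (Cmp C Z X Y m u)"
    using assms by (auto simp: order_mono_def intro!: Le_refl comp_hom)
  then show ?thesis using assms by (intro Le_antisym[of Z X]) (auto simp: order_mono_def)
qed

text \<open>\<open>p\<close> is a generic solution of \<phi>: every solution arises from it along
  some \<open>h\<close>. Uniqueness of \<open>h\<close> is not asked, so shrinking \<open>I\<close>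
  represents the predicate in which the omitted unknowns are existentially quantified.\<close>

definition weakly_represents ::
  "'i set \<Rightarrow> ('i \<Rightarrow> 'o) \<Rightarrow> 'o \<Rightarrow> ('i \<Rightarrow> 'm) \<Rightarrow> ('o \<Rightarrow> ('i \<Rightarrow> 'm) \<Rightarrow> bool) \<Rightarrow> bool" where
  "weakly_represents I V L p \<phi> \<longleftrightarrow> L \<in> Obj C \<and> (\<forall>i\<in>I. p i \<in> Hom C L (V i)) \<and>
    (\<forall>A\<in>Obj C. \<forall>x. (\<forall>i\<in>I. x i \<in> Hom C A (V i)) \<longrightarrow>
      \<phi> A x = (\<exists>h\<in>Hom C A L. \<forall>i\<in>I. x i = Cmp C A L (V i) (p i) h))"

lemma weakly_representsD:
  assumes "weakly_represents I V L p \<phi>"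
  shows "L \<in> Obj C" "i \<in> I \<Longrightarrow> p i \<in> Hom C L (V i)"
    "\<lbrakk>A \<in> Obj C; \<And>i. i \<in> I \<Longrightarrow> x i \<in> Hom C A (V i)\<rbrakk>
      \<Longrightarrow> \<phi> A x = (\<exists>h\<in>Hom C A L. \<forall>i\<in>I. x i = Cmp C A L (V i) (p i) h)"
  using assms by (auto simp: weakly_represents_def)

end

section \<open>Weak solutions of finite systems of inequalities\<close>

text \<open>The objects \<open>i < n\<close> stand for the unknowns \<open>x\<^sub>i\<close> and the objects \<open>n + k\<close> for the inequalities
  \<open>f\<^sub>k x\<^bsub>s k\<^esub> \<le> g\<^sub>k x\<^bsub>t k\<^esub>\<close>. The arrow \<open>0\<close> is the identity, \<open>1\<close> and \<open>2\<close> carry \<open>f\<^sub>k\<close> and \<open>g\<^sub>k\<close>. As no two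
  non-identity arrows compose, addition is a composition. The weight at \<open>n + k\<close> is the chain
  \<open>0 < 1\<close>, whose two elements are the sides of the inequality.\<close>
definition system_index :: "nat \<Rightarrow> nat \<Rightarrow> (nat \<Rightarrow> nat) \<Rightarrow> (nat \<Rightarrow> nat) \<Rightarrow> (nat, nat) pcat" where
  "system_index n m s t =
     \<lparr> Obj = {..<n + m},
       Hom = (\<lambda>a b. {e. a = b \<and> e = 0 \<or>
         a < n \<and> n \<le> b \<and> (e = 1 \<and> a = s (b - n) \<or> e = 2 \<and> a = t (b - n))}),
       Le = (\<lambda>a b. (=)), Cmp = (\<lambda>a b c g f. g + f), Idt = (\<lambda>a. 0) \<rparr>"

text \<open>A non-identity arrow starts at a one-point set; arrow 1 picks the lower side 0 and arrow
  2 the upper side 1, which is \<open>e - 1\<close>. Two labels keep the sides apart when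
  \<open>s k = t k\<close>.\<close>

definition system_weight :: "nat \<Rightarrow> (nat, nat, nat) to_pos" where
  "system_weight n =
     \<lparr> PSet = (\<lambda>d. if d < n then {0} else {0, 1}), PLe = (\<lambda>d. (\<le>)),
       PMap = (\<lambda>a b e w. if e = 0 then w else e - 1) \<rparr>"

lemma system_index_category: "pos_category (system_index n m s t)"
  by unfold_locales (auto simp: system_index_def poset_on_def reflp_on_def transp_on_def antisymp_on_def)

lemma system_weight_functor: "pos_valued_functor (system_index n m s t) (system_weight n)"
proof -
  interpret pos_category "system_index n m s t" by (rule system_index_category)
  show ?thesis
    by unfold_locales
      (auto simp: system_index_def system_weight_def poset_on_def reflp_on_def transp_on_def
        antisymp_on_def split: if_splits)
qed

lemma finite_system_weight: "finite_weight (system_index n m s t) (system_weight n)"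
proof -
  have "finite {e. a = b \<and> e = (0::nat) \<or>
         a < n \<and> n \<le> b \<and> (e = 1 \<and> a = s (b - n) \<or> e = 2 \<and> a = t (b - n))}" for a b
    by (rule finite_subset[of _ "{0, 1, 2}"]) auto
  then show ?thesis
    by (auto simp: finite_weight_def system_index_def system_weight_def quotient_def)
qed

locale weakly_lex_category = pos_category C for C :: "('o, 'm) pcat" +
  assumes weak_limits:
    "\<And>(D :: (nat, nat) pcat) (W :: (nat, nat, nat) to_pos) F.
      \<lbrakk>pos_functor D C F; pos_valued_functor D W; finite_weight D W\<rbrakk>
      \<Longrightarrow> \<exists>L \<kappa>. is_weak_limit D W C F L \<kappa>"

context weakly_lex_category
begin

text \<open>A cylinder over this weight is determined by its values at the objects below
  \<open>n\<close>: naturality along the arrows 1 and 2 forces its values at \<open>n + k\<close> to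
  be the two sides of the inequality \<open>k\<close>, and monotonicity on the chain says that this
  inequality holds. Cylinders are thus the same as solutions.\<close>

lemma weak_solution_nat:
  fixes n m :: nat
  assumes V: "\<And>i. i < n \<Longrightarrow> V i \<in> Obj C"
    and K: "\<And>k. k < m \<Longrightarrow> s k < n \<and> t k < n \<and> Z k \<in> Obj C \<and>
      f k \<in> Hom C (V (s k)) (Z k) \<and> g k \<in> Hom C (V (t k)) (Z k)"
  shows "\<exists>L\<in>Obj C. \<exists>p. (\<forall>i<n. p i \<in> Hom C L (V i)) \<and>
    (\<forall>A\<in>Obj C. \<forall>x. (\<forall>i<n. x i \<in> Hom C A (V i)) \<longrightarrow>
      (\<forall>k<m. Le C A (Z k) (Cmp C A (V (s k)) (Z k) (f k) (x (s k)))
                         (Cmp C A (V (t k)) (Z k) (g k) (x (t k)))) =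
      (\<exists>h\<in>Hom C A L. \<forall>i<n. x i = Cmp C A L (V i) (p i) h))"
proof -
  let ?D = "system_index n m s t" and ?W = "system_weight n"
  define F :: "(nat, nat, 'o, 'm) pfunctor" where
    "F = \<lparr> FObj = (\<lambda>d. if d < n then V d else Z (d - n)),
       FMap = (\<lambda>a b e. if e = 0 then Idt C (if a < n then V a else Z (a - n))
                else if e = 1 then f (b - n) else g (b - n)) \<rparr>"
  have FO: "FObj F a \<in> Obj C" if "a \<in> Obj ?D" for a
    using that V K[of "a - n"] by (auto simp: F_def system_index_def)
  interpret D: pos_category ?D by (rule system_index_category)
  have "pos_functor ?D C F"
  proof
    fix a b e assume a: "a \<in> Obj ?D" and b: "b \<in> Obj ?D" and e: "e \<in> Hom ?D a b"
    show "FMap F a b e \<in> Hom C (FObj F a) (FObj F b)"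
      using a b e V K[of "a - n"] K[of "b - n"]
      by (auto simp: F_def system_index_def intro!: id_hom)
  next
    fix a b c e e' assume "a \<in> Obj ?D" "b \<in> Obj ?D" "c \<in> Obj ?D" "e \<in> Hom ?D a b" "e' \<in> Hom ?D b c"
    then show "FMap F a c (Cmp ?D a b c e' e)
      = Cmp C (FObj F a) (FObj F b) (FObj F c) (FMap F b c e') (FMap F a b e)"
      using V K[of "a - n"] K[of "b - n"] K[of "c - n"]
      by (auto simp: F_def system_index_def comp_id_left comp_id_right id_hom)
  next
    fix a b e e' assume "a \<in> Obj ?D" "b \<in> Obj ?D" "e \<in> Hom ?D a b" "e' \<in> Hom ?D a b" "Le ?D a b e e'"
    then show "Le C (FObj F a) (FObj F b) (FMap F a b e) (FMap F a b e')"
      using FO[of a] FO[of b] V K[of "a - n"] K[of "b - n"]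
      by (auto simp: F_def system_index_def id_hom intro!: Le_refl)
  qed (auto simp: FO, auto simp: F_def system_index_def)
  then obtain L \<kappa> where L: "is_weak_limit ?D ?W C F L \<kappa>"
    using weak_limits system_weight_functor finite_system_weight by blast
  define p where "p i = \<kappa> i 0" for i
  have LO: "L \<in> Obj C" and \<kappa>: "\<kappa> \<in> nat_trans ?D ?W (hom_functor C L F)"
    and surj: "\<And>X. X \<in> Obj C \<Longrightarrow>
      nat_trans ?D ?W (hom_functor C X F) = cylinder_comp ?D ?W C F X L \<kappa> ` Hom C X L"
    using L by (auto simp: is_weak_limit_def)
  have p: "p i \<in> Hom C L (V i)" if "i < n" for i
  proof -
    have "\<forall>d\<in>Obj ?D. \<forall>w\<in>PSet ?W d. \<kappa> d w \<in> PSet (hom_functor C L F) d"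
      using \<kappa> by (simp add: nat_trans_def)
    from this[rule_format, of i 0] show ?thesis using that
      by (auto simp: p_def hom_functor_def F_def system_index_def system_weight_def)
  qed
  have pK: "Le C L (Z k) (Cmp C L (V (s k)) (Z k) (f k) (p (s k))) (Cmp C L (V (t k)) (Z k) (g k) (p (t k)))"
    if k: "k < m" for k
  proof -
    have nat: "\<And>a b e w. a \<in> Obj ?D \<Longrightarrow> b \<in> Obj ?D \<Longrightarrow> e \<in> Hom ?D a b \<Longrightarrow> w \<in> PSet ?W a \<Longrightarrow>
        \<kappa> b (PMap ?W a b e w) = Cmp C L (FObj F a) (FObj F b) (FMap F a b e) (\<kappa> a w)"
      using \<kappa> by (auto simp: nat_trans_def hom_functor_def)
    have "\<kappa> (n + k) 0 = Cmp C L (V (s k)) (Z k) (f k) (p (s k))"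
      using nat[of "s k" "n + k" 1 0] K[OF k] k
      by (auto simp: system_index_def system_weight_def F_def p_def)
    moreover have "\<kappa> (n + k) 1 = Cmp C L (V (t k)) (Z k) (g k) (p (t k))"
      using nat[of "t k" "n + k" 2 0] K[OF k] k
      by (auto simp: system_index_def system_weight_def F_def p_def)
    moreover have "PLe (hom_functor C L F) (n + k) (\<kappa> (n + k) 0) (\<kappa> (n + k) 1)"
    proof -
      have "\<forall>d\<in>Obj ?D. \<forall>x\<in>PSet ?W d. \<forall>y\<in>PSet ?W d. PLe ?W d x y \<longrightarrow>
          PLe (hom_functor C L F) d (\<kappa> d x) (\<kappa> d y)"
        using \<kappa> by (simp add: nat_trans_def)
      from this[rule_format, of "n + k" 0 1] show ?thesis using k
        by (auto simp: system_index_def system_weight_def)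
    qed
    ultimately show ?thesis by (simp add: hom_functor_def F_def)
  qed
  have "(\<forall>k<m. Le C A (Z k) (Cmp C A (V (s k)) (Z k) (f k) (x (s k)))
                         (Cmp C A (V (t k)) (Z k) (g k) (x (t k)))) =
      (\<exists>h\<in>Hom C A L. \<forall>i<n. x i = Cmp C A L (V i) (p i) h)"
    if A: "A \<in> Obj C" and x: "\<forall>i<n. x i \<in> Hom C A (V i)" for A x
  proof
    assume le: "\<forall>k<m. Le C A (Z k) (Cmp C A (V (s k)) (Z k) (f k) (x (s k)))
                         (Cmp C A (V (t k)) (Z k) (g k) (x (t k)))"
    \<comment> \<open>The cylinder of the solution \<open>x\<close>. The last case must be
      \<open>undefined\<close>, the value that \<open>nat_trans\<close> prescribes off the domain;
      otherwise surjectivity of the weak limit would not apply.\<close>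
    define \<alpha> where "\<alpha> d w = (if d < n \<and> w = (0::nat) then x d
      else if n \<le> d \<and> d < n + m \<and> w = 0 then Cmp C A (V (s (d - n))) (Z (d - n)) (f (d - n)) (x (s (d - n)))
      else if n \<le> d \<and> d < n + m \<and> w = 1 then Cmp C A (V (t (d - n))) (Z (d - n)) (g (d - n)) (x (t (d - n)))
      else undefined)" for d w
    have c: "\<And>k. k < m \<Longrightarrow> Cmp C A (V (s k)) (Z k) (f k) (x (s k)) \<in> Hom C A (Z k) \<and>
        Cmp C A (V (t k)) (Z k) (g k) (x (t k)) \<in> Hom C A (Z k)"
      using K x A V by (auto intro!: comp_hom)
    have "\<alpha> \<in> nat_trans ?D ?W (hom_functor C A F)"
      unfolding nat_trans_def
    proof (intro CollectI conjI ballI allI impI)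
      fix d w assume "\<not> (d \<in> Obj ?D \<and> w \<in> PSet ?W d)"
      then show "\<alpha> d w = undefined"
        by (auto simp: \<alpha>_def system_index_def system_weight_def split: if_splits)
    next
      fix d w assume "d \<in> Obj ?D" "w \<in> PSet ?W d"
      then show "\<alpha> d w \<in> PSet (hom_functor C A F) d"
        using c[of "d - n"] x
        by (auto simp: \<alpha>_def system_index_def system_weight_def hom_functor_def F_def split: if_splits)
    next
      fix d w w' assume "d \<in> Obj ?D" "w \<in> PSet ?W d" "w' \<in> PSet ?W d" "PLe ?W d w w'"
      then show "PLe (hom_functor C A F) d (\<alpha> d w) (\<alpha> d w')"
        using c[of "d - n"] x le[rule_format, of "d - n"] K[of "d - n"] A V
        by (auto simp: \<alpha>_def system_index_def system_weight_def hom_functor_def F_def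
            intro!: Le_refl split: if_splits)
    next
      fix a b e w assume "a \<in> Obj ?D" "b \<in> Obj ?D" "e \<in> Hom ?D a b" "w \<in> PSet ?W a"
      then show "\<alpha> b (PMap ?W a b e w) = PMap (hom_functor C A F) a b e (\<alpha> a w)"
        using c[of "a - n"] x K[of "a - n"] A V
        by (auto simp: \<alpha>_def system_index_def system_weight_def hom_functor_def F_def comp_id_left
            split: if_splits)
    qed
    then obtain h where h: "h \<in> Hom C A L" and "\<alpha> = cylinder_comp ?D ?W C F A L \<kappa> h"
      using surj[OF A] by auto
    then have eq: "\<alpha> i 0 = cylinder_comp ?D ?W C F A L \<kappa> h i 0" for i by simp
    have "x i = Cmp C A L (V i) (p i) h" if "i < n" for i
      using eq[of i] that by (simp add: \<alpha>_def cylinder_comp_def system_index_def system_weight_def F_def p_def)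
    then show "\<exists>h\<in>Hom C A L. \<forall>i<n. x i = Cmp C A L (V i) (p i) h" using h by auto
  next
    assume "\<exists>h\<in>Hom C A L. \<forall>i<n. x i = Cmp C A L (V i) (p i) h"
    then obtain h where h: "h \<in> Hom C A L" "\<forall>i<n. x i = Cmp C A L (V i) (p i) h" by blast
    show "\<forall>k<m. Le C A (Z k) (Cmp C A (V (s k)) (Z k) (f k) (x (s k)))
                         (Cmp C A (V (t k)) (Z k) (g k) (x (t k)))"
    proof (intro allI impI)
      fix k assume k: "k < m"
      have "Le C A (Z k) (Cmp C A L (Z k) (Cmp C L (V (s k)) (Z k) (f k) (p (s k))) h)
          (Cmp C A L (Z k) (Cmp C L (V (t k)) (Z k) (g k) (p (t k))) h)"
        by (rule comp_mono_left[OF pK[OF k]]) (use K[OF k] A LO h p V in \<open>auto intro!: comp_hom\<close>)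
      then show "Le C A (Z k) (Cmp C A (V (s k)) (Z k) (f k) (x (s k)))
                         (Cmp C A (V (t k)) (Z k) (g k) (x (t k)))"
        using K[OF k] h A LO p V by (simp add: comp_assoc)
    qed
  qed
  then show ?thesis using LO p by blast
qed

text \<open>The systems below are indexed by booleans, sums and tuples over arbitrary types, whereas
  weak limits are assumed over \<open>nat\<close> only. Enumerating unknowns and inequalities
  bridges the two.\<close>

lemma weak_solution:
  assumes I: "finite I" and K: "finite K" and V: "\<And>i. i \<in> I \<Longrightarrow> V i \<in> Obj C"
    and kK: "\<And>k. k \<in> K \<Longrightarrow> s k \<in> I \<and> t k \<in> I \<and> Z k \<in> Obj C \<and>
      f k \<in> Hom C (V (s k)) (Z k) \<and> g k \<in> Hom C (V (t k)) (Z k)"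
  shows "\<exists>L p. weakly_represents I V L p (\<lambda>A x.
    \<forall>k\<in>K. Le C A (Z k) (Cmp C A (V (s k)) (Z k) (f k) (x (s k)))
                       (Cmp C A (V (t k)) (Z k) (g k) (x (t k))))"
proof -
  obtain b where b: "bij_betw b {..<card I} I"
    using ex_bij_betw_nat_finite[OF I] by (auto simp: atLeast0LessThan)
  obtain c where c: "bij_betw c {..<card K} K"
    using ex_bij_betw_nat_finite[OF K] by (auto simp: atLeast0LessThan)
  define j where "j = the_inv_into {..<card I} b"
  have bI: "b ` {..<card I} = I" and cK: "c ` {..<card K} = K"
    using b c by (auto simp: bij_betw_def)
  have bj: "b (j i) = i" and jI: "j i < card I" if "i \<in> I" for i
    using that b bij_betw_def f_the_inv_into_f_bij_betw[OF b] the_inv_into_into[of b "{..<card I}" i "{..<card I}"]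
    by (auto simp: j_def bij_betw_def)
  have jb: "j (b i) = i" if "i < card I" for i
    using that b by (auto simp: j_def bij_betw_def the_inv_into_f_f)
  have cin: "c k \<in> K" if "k < card K" for k using that cK by auto
  have bin: "b i \<in> I" if "i < card I" for i using that bI by auto
  obtain L p where L: "L \<in> Obj C" and p: "\<forall>i<card I. p i \<in> Hom C L (V (b i))"
    and u: "\<And>A x. A \<in> Obj C \<Longrightarrow> (\<forall>i<card I. x i \<in> Hom C A (V (b i))) \<Longrightarrow>
      (\<forall>k<card K. Le C A (Z (c k)) (Cmp C A (V (b (j (s (c k))))) (Z (c k)) (f (c k)) (x (j (s (c k)))))
                         (Cmp C A (V (b (j (t (c k))))) (Z (c k)) (g (c k)) (x (j (t (c k)))))) =
      (\<exists>h\<in>Hom C A L. \<forall>i<card I. x i = Cmp C A L (V (b i)) (p i) h)"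
    using weak_solution_nat[of "card I" "\<lambda>i. V (b i)" "card K" "\<lambda>k. j (s (c k))" "\<lambda>k. j (t (c k))"
        "\<lambda>k. Z (c k)" "\<lambda>k. f (c k)" "\<lambda>k. g (c k)"] V kK cin bin jI
    by (auto simp: bj)
  show ?thesis
    unfolding weakly_represents_def
  proof (intro exI[of _ L] exI[of _ "\<lambda>i. p (j i)"] conjI ballI allI impI L)
    fix i assume "i \<in> I" then show "p (j i) \<in> Hom C L (V i)" using p jI[of i] bj[of i] by metis
  next
    fix A x assume A: "A \<in> Obj C" and x: "\<forall>i\<in>I. x i \<in> Hom C A (V i)"
    have "(\<forall>k\<in>K. Le C A (Z k) (Cmp C A (V (s k)) (Z k) (f k) (x (s k)))
                         (Cmp C A (V (t k)) (Z k) (g k) (x (t k)))) \<longleftrightarrow>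
      (\<forall>k<card K. Le C A (Z (c k)) (Cmp C A (V (b (j (s (c k))))) (Z (c k)) (f (c k)) (x (b (j (s (c k))))))
                         (Cmp C A (V (b (j (t (c k))))) (Z (c k)) (g (c k)) (x (b (j (t (c k)))))))"
      using kK cin by (subst cK[symmetric]) (auto simp: bj)
    also have "\<dots> \<longleftrightarrow> (\<exists>h\<in>Hom C A L. \<forall>i<card I. x (b i) = Cmp C A L (V (b i)) (p i) h)"
      by (rule u) (use A x bin in auto)
    also have "\<dots> \<longleftrightarrow> (\<exists>h\<in>Hom C A L. \<forall>i\<in>I. x i = Cmp C A L (V i) (p (j i)) h)"
      by (subst bI[symmetric]) (auto simp: jb)
    finally show "(\<forall>k\<in>K. Le C A (Z k) (Cmp C A (V (s k)) (Z k) (f k) (x (s k)))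
                         (Cmp C A (V (t k)) (Z k) (g k) (x (t k)))) =
      (\<exists>h\<in>Hom C A L. \<forall>i\<in>I. x i = Cmp C A L (V i) (p (j i)) h)" .
  qed
qed

end

section \<open>Pseudocongruences as families of preorders\<close>

text \<open>\<open>rel_at C S A\<close> is the relation on \<open>C(A, X)\<close> presented by \<open>S = (X, R)\<close>: the pairs that factor
  through \<open>R\<close>. Everything about \<open>S\<close> in the completion depends only on these relations.\<close>
definition rel_at ::
  "('o, 'm) pcat \<Rightarrow> ('o, 'm) parallel_pair \<Rightarrow> 'o \<Rightarrow> 'm \<Rightarrow> 'm \<Rightarrow> bool" where
  "rel_at C S A x y \<longleftrightarrow> (\<exists>h\<in>Hom C A (Rel S).
     Cmp C A (Rel S) (Base S) (R0 S) h = x \<and> Cmp C A (Rel S) (Base S) (R1 S) h = y)"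

lemma pc_preceq_iff: "pc_preceq C S T f g \<longleftrightarrow> rel_at C T (Base S) f g"
  by (simp add: pc_preceq_def rel_at_def)

definition parallel :: "('o, 'm) pcat \<Rightarrow> ('o, 'm) parallel_pair \<Rightarrow> bool" where
  "parallel C S \<longleftrightarrow> Base S \<in> Obj C \<and> Rel S \<in> Obj C \<and>
     R0 S \<in> Hom C (Rel S) (Base S) \<and> R1 S \<in> Hom C (Rel S) (Base S)"

lemma pseudocongruence_parallel: "pseudocongruence C S \<Longrightarrow> parallel C S"
  by (simp add: pseudocongruence_def parallel_def)

lemma pseudocongruence_Base: "pseudocongruence C S \<Longrightarrow> Base S \<in> Obj C"
  by (simp add: pseudocongruence_def)

context pos_category
begin

lemma rel_at_hom:
  assumes "parallel C S" "A \<in> Obj C" "rel_at C S A x y"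
  shows "x \<in> Hom C A (Base S)" "y \<in> Hom C A (Base S)"
  using assms by (auto simp: parallel_def rel_at_def intro!: comp_hom)

lemma rel_at_precomp:
  assumes S: "parallel C S" and A: "A \<in> Obj C" "B \<in> Obj C" and u: "u \<in> Hom C B A"
    and r: "rel_at C S A x y"
  shows "rel_at C S B (Cmp C B A (Base S) x u) (Cmp C B A (Base S) y u)"
proof -
  from r obtain h where h: "h \<in> Hom C A (Rel S)"
    "x = Cmp C A (Rel S) (Base S) (R0 S) h" "y = Cmp C A (Rel S) (Base S) (R1 S) h"
    by (auto simp: rel_at_def)
  show ?thesis unfolding rel_at_def
    by (rule bexI[of _ "Cmp C B A (Rel S) h u"])
      (use S A u h in \<open>auto simp: parallel_def comp_assoc intro!: comp_hom\<close>)
qed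

lemma rel_at_R: "parallel C S \<Longrightarrow> rel_at C S (Rel S) (R0 S) (R1 S)"
  unfolding rel_at_def parallel_def
  by (rule bexI[of _ "Idt C (Rel S)"]) (auto simp: comp_id_right intro: id_hom)

lemma rel_at_Le:
  assumes "pseudocongruence C S" "A \<in> Obj C" "x \<in> Hom C A (Base S)" "y \<in> Hom C A (Base S)"
    "Le C A (Base S) x y"
  shows "rel_at C S A x y"
  using assms unfolding pseudocongruence_def rel_at_def by blast

lemma rel_at_refl:
  assumes "pseudocongruence C S" "A \<in> Obj C" "x \<in> Hom C A (Base S)"
  shows "rel_at C S A x x"
  using assms by (auto intro!: rel_at_Le Le_refl simp: pseudocongruence_Base)

text \<open>The weak pullback carries the generic composable pair of related pairs: any
  \<open>h\<close>, \<open>k\<close> that match in the middle are \<open>d0 w\<close>,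
  \<open>d1 w\<close> for some \<open>w\<close>, and then \<open>\<tau> w\<close> witnesses the
  composite.\<close>

lemma rel_at_trans:
  assumes S: "pseudocongruence C S" and A: "A \<in> Obj C"
    and xy: "rel_at C S A x y" and yz: "rel_at C S A y z"
  shows "rel_at C S A x z"
proof -
  have P: "Base S \<in> Obj C" "Rel S \<in> Obj C" "R0 S \<in> Hom C (Rel S) (Base S)"
    "R1 S \<in> Hom C (Rel S) (Base S)"
    using S by (auto simp: pseudocongruence_def)
  obtain Q d0 d1 \<tau> where pb: "is_weak_pullback C Q (Rel S) (Rel S) (Base S) d0 d1 (R1 S) (R0 S)"
    and \<tau>: "\<tau> \<in> Hom C Q (Rel S)"
      "Cmp C Q (Rel S) (Base S) (R0 S) \<tau> = Cmp C Q (Rel S) (Base S) (R0 S) d0"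
      "Cmp C Q (Rel S) (Base S) (R1 S) \<tau> = Cmp C Q (Rel S) (Base S) (R1 S) d1"
    using S unfolding pseudocongruence_def by blast
  have Q: "Q \<in> Obj C" "d0 \<in> Hom C Q (Rel S)" "d1 \<in> Hom C Q (Rel S)"
    using pb by (auto simp: is_weak_pullback_def)
  obtain h k where h: "h \<in> Hom C A (Rel S)"
    "x = Cmp C A (Rel S) (Base S) (R0 S) h" "y = Cmp C A (Rel S) (Base S) (R1 S) h"
    and k: "k \<in> Hom C A (Rel S)"
    "y = Cmp C A (Rel S) (Base S) (R0 S) k" "z = Cmp C A (Rel S) (Base S) (R1 S) k"
    using xy yz by (auto simp: rel_at_def)
  have "(h, k) \<in> (\<lambda>h. (Cmp C A Q (Rel S) d0 h, Cmp C A Q (Rel S) d1 h)) ` Hom C A Q"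
    using pb A h k by (auto simp: is_weak_pullback_def)
  then obtain w where w: "w \<in> Hom C A Q" "h = Cmp C A Q (Rel S) d0 w" "k = Cmp C A Q (Rel S) d1 w"
    by auto
  have c: "Cmp C A (Rel S) (Base S) r (Cmp C A Q (Rel S) d w) =
      Cmp C A Q (Base S) (Cmp C Q (Rel S) (Base S) r d) w"
    if "r \<in> Hom C (Rel S) (Base S)" "d \<in> Hom C Q (Rel S)" for r d
    using that P Q A w by (simp add: comp_assoc)
  show ?thesis unfolding rel_at_def
    by (rule bexI[of _ "Cmp C A Q (Rel S) \<tau> w"])
      (use P Q A w h k \<tau> in \<open>simp_all add: c comp_hom\<close>)
qed

text \<open>A Yoneda argument. The witness \<open>f'\<close> says that \<open>f\<close> preserves
  the generic related pair \<open>R0 S\<close>, \<open>R1 S\<close>, and every related pair is a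
  precomposite of that one.\<close>

lemma pc_premorphisms_iff:
  assumes S: "parallel C S" and T: "parallel C T"
  shows "f \<in> pc_premorphisms C S T \<longleftrightarrow> f \<in> Hom C (Base S) (Base T) \<and>
    (\<forall>A\<in>Obj C. \<forall>x y. rel_at C S A x y \<longrightarrow>
      rel_at C T A (Cmp C A (Base S) (Base T) f x) (Cmp C A (Base S) (Base T) f y))"
    (is "?l \<longleftrightarrow> ?r")
proof
  assume ?l
  then have f: "f \<in> Hom C (Base S) (Base T)"
    and r: "rel_at C T (Rel S) (Cmp C (Rel S) (Base S) (Base T) f (R0 S))
      (Cmp C (Rel S) (Base S) (Base T) f (R1 S))"
    by (auto simp: pc_premorphisms_def rel_at_def)
  show ?r
  proof (intro conjI ballI allI impI f)
    fix A x y assume A: "A \<in> Obj C" and "rel_at C S A x y"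
    then obtain h where h: "h \<in> Hom C A (Rel S)"
      "x = Cmp C A (Rel S) (Base S) (R0 S) h" "y = Cmp C A (Rel S) (Base S) (R1 S) h"
      by (auto simp: rel_at_def)
    show "rel_at C T A (Cmp C A (Base S) (Base T) f x) (Cmp C A (Base S) (Base T) f y)"
      using rel_at_precomp[OF T _ A h(1) r] S T f A h by (simp add: parallel_def comp_assoc)
  qed
next
  assume ?r
  then have "rel_at C T (Rel S) (Cmp C (Rel S) (Base S) (Base T) f (R0 S))
      (Cmp C (Rel S) (Base S) (Base T) f (R1 S))"
    using rel_at_R[OF S] S by (simp add: parallel_def)
  then show ?l using \<open>?r\<close>
    by (auto simp: pc_premorphisms_def rel_at_def)
qed

lemma premorphism_hom: "f \<in> pc_premorphisms C S T \<Longrightarrow> f \<in> Hom C (Base S) (Base T)"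
  by (simp add: pc_premorphisms_def)

lemma premorphism_rel:
  "\<lbrakk>f \<in> pc_premorphisms C S T; pseudocongruence C S; pseudocongruence C T; A \<in> Obj C; rel_at C S A x y\<rbrakk>
    \<Longrightarrow> rel_at C T A (Cmp C A (Base S) (Base T) f x) (Cmp C A (Base S) (Base T) f y)"
  by (simp add: pc_premorphisms_iff pseudocongruence_parallel)

lemma premorphismI:
  assumes "pseudocongruence C S" "pseudocongruence C T" "f \<in> Hom C (Base S) (Base T)"
    "\<And>A x y. \<lbrakk>A \<in> Obj C; x \<in> Hom C A (Base S); y \<in> Hom C A (Base S); rel_at C S A x y\<rbrakk> \<Longrightarrow>
      rel_at C T A (Cmp C A (Base S) (Base T) f x) (Cmp C A (Base S) (Base T) f y)"
  shows "f \<in> pc_premorphisms C S T"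
  using assms rel_at_hom[of S] by (auto simp: pc_premorphisms_iff pseudocongruence_parallel)

end

section \<open>Building pseudocongruences from weakly represented preorders\<close>

context weakly_lex_category
begin

text \<open>The equation \<open>f x = g y\<close> is a pair of opposite inequalities. Booleans index
  both the two unknowns and the two directions, and negation exchanges the sides.\<close>

lemma weak_pullback_exists:
  assumes "X \<in> Obj C" "Y \<in> Obj C" "B \<in> Obj C" "f \<in> Hom C X B" "g \<in> Hom C Y B"
  shows "\<exists>P p q. is_weak_pullback C P X Y B p q f g"
proof -
  let ?V = "\<lambda>i. if i then X else Y" and ?f = "\<lambda>i. if i then f else g"
  obtain L p where Lp: "weakly_represents UNIV ?V L p (\<lambda>A x. \<forall>k\<in>UNIV.
      Le C A B (Cmp C A (?V k) B (?f k) (x k)) (Cmp C A (?V (\<not> k)) B (?f (\<not> k)) (x (\<not> k))))"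
    using weak_solution[of "UNIV :: bool set" "UNIV :: bool set" ?V "\<lambda>k. k" "\<lambda>k. \<not> k" "\<lambda>_. B" ?f
        "\<lambda>k. ?f (\<not> k)"] assms by fastforce
  note L = weakly_representsD(1)[OF Lp] and p = weakly_representsD(2)[OF Lp UNIV_I]
    and u = weakly_representsD(3)[OF Lp]
  have "(\<lambda>h. (Cmp C Z L X (p True) h, Cmp C Z L Y (p False) h)) ` Hom C Z L =
        {(a, b). a \<in> Hom C Z X \<and> b \<in> Hom C Z Y \<and> Cmp C Z X B f a = Cmp C Z Y B g b}"
    if Z: "Z \<in> Obj C" for Z
  proof -
    have *: "Cmp C Z X B f a = Cmp C Z Y B g b \<longleftrightarrow>
        (\<exists>h\<in>Hom C Z L. a = Cmp C Z L X (p True) h \<and> b = Cmp C Z L Y (p False) h)"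
      if a: "a \<in> Hom C Z X" and b: "b \<in> Hom C Z Y" for a b
    proof -
      have "Cmp C Z X B f a \<in> Hom C Z B" "Cmp C Z Y B g b \<in> Hom C Z B"
        using a b assms Z by (auto intro!: comp_hom)
      then have "Cmp C Z X B f a = Cmp C Z Y B g b \<longleftrightarrow>
          Le C Z B (Cmp C Z X B f a) (Cmp C Z Y B g b) \<and> Le C Z B (Cmp C Z Y B g b) (Cmp C Z X B f a)"
        using assms Z Le_antisym Le_refl by metis
      then show ?thesis
        using u[OF Z, of "\<lambda>i. if i then a else b"] a b by (simp add: all_bool_eq conj_commute)
    qed
    have "p True \<in> Hom C L X" "p False \<in> Hom C L Y" using p[of True] p[of False] by auto
    then show ?thesis using assms L Z by (auto simp: * comp_hom image_iff)
  qed
  then have "is_weak_pullback C L X Y B (p True) (p False) f g"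
    using assms L p[of True] p[of False] by (auto simp: is_weak_pullback_def)
  then show ?thesis by blast
qed

text \<open>Converse to \<open>rel_at_trans\<close>: transitivity at \<open>Q\<close>, applied to
  the generic composable pair \<open>d0\<close>, \<open>d1\<close> of a weak pullback, produces the
  required \<tau>.\<close>

lemma pseudocongruenceI:
  assumes P: "parallel C S"
    and le: "\<And>A x y. \<lbrakk>A \<in> Obj C; x \<in> Hom C A (Base S); y \<in> Hom C A (Base S); Le C A (Base S) x y\<rbrakk>
      \<Longrightarrow> rel_at C S A x y"
    and tr: "\<And>A x y z. \<lbrakk>A \<in> Obj C; rel_at C S A x y; rel_at C S A y z\<rbrakk> \<Longrightarrow> rel_at C S A x z"
  shows "pseudocongruence C S"
proof -
  have P': "Base S \<in> Obj C" "Rel S \<in> Obj C" "R0 S \<in> Hom C (Rel S) (Base S)"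
    "R1 S \<in> Hom C (Rel S) (Base S)"
    using P by (auto simp: parallel_def)
  obtain Q d0 d1 where pb: "is_weak_pullback C Q (Rel S) (Rel S) (Base S) d0 d1 (R1 S) (R0 S)"
    using weak_pullback_exists[of "Rel S" "Rel S" "Base S" "R1 S" "R0 S"] P' by blast
  have Q: "Q \<in> Obj C" "d0 \<in> Hom C Q (Rel S)" "d1 \<in> Hom C Q (Rel S)"
    using pb by (auto simp: is_weak_pullback_def)
  have "(Cmp C Q Q (Rel S) d0 (Idt C Q), Cmp C Q Q (Rel S) d1 (Idt C Q)) \<in>
      (\<lambda>h. (Cmp C Q Q (Rel S) d0 h, Cmp C Q Q (Rel S) d1 h)) ` Hom C Q Q"
    using id_hom Q by blast
  then have "Cmp C Q (Rel S) (Base S) (R1 S) d0 = Cmp C Q (Rel S) (Base S) (R0 S) d1"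
    using pb Q P' by (simp add: is_weak_pullback_def comp_id_right)
  then have "rel_at C S Q (Cmp C Q (Rel S) (Base S) (R0 S) d0) (Cmp C Q (Rel S) (Base S) (R1 S) d1)"
    using Q tr[of Q _ "Cmp C Q (Rel S) (Base S) (R1 S) d0"] by (metis rel_at_def)
  then show ?thesis
    unfolding pseudocongruence_def using P' pb le by (auto simp: rel_at_def)
qed

text \<open>The source of every object built below: discrete objects, images, limits and quotients.
  The pair \<open>p0\<close>, \<open>p1\<close> may fail to be jointly monic, so a weak
  representation of \<rho> is enough.\<close>

lemma pseudocongruence_exists:
  assumes X: "X \<in> Obj C" and L: "L \<in> Obj C" and p: "p0 \<in> Hom C L X" "p1 \<in> Hom C L X"
    and \<rho>: "\<And>A x y. \<lbrakk>A \<in> Obj C; x \<in> Hom C A X; y \<in> Hom C A X\<rbrakk> \<Longrightarrow>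
      \<rho> A x y \<longleftrightarrow> (\<exists>h\<in>Hom C A L. x = Cmp C A L X p0 h \<and> y = Cmp C A L X p1 h)"
    and le: "\<And>A x y. \<lbrakk>A \<in> Obj C; x \<in> Hom C A X; y \<in> Hom C A X; Le C A X x y\<rbrakk> \<Longrightarrow> \<rho> A x y"
    and tr: "\<And>A x y z. \<lbrakk>A \<in> Obj C; x \<in> Hom C A X; y \<in> Hom C A X; z \<in> Hom C A X; \<rho> A x y; \<rho> A y z\<rbrakk>
      \<Longrightarrow> \<rho> A x z"
  shows "\<exists>S. pseudocongruence C S \<and> Base S = X \<and>
    (\<forall>A\<in>Obj C. \<forall>x\<in>Hom C A X. \<forall>y\<in>Hom C A X. rel_at C S A x y \<longleftrightarrow> \<rho> A x y)"
proof -
  define S where "S = \<lparr>Base = X, Rel = L, R0 = p0, R1 = p1\<rparr>"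
  have P: "parallel C S" using X L p by (simp add: S_def parallel_def)
  have r: "rel_at C S A x y \<longleftrightarrow> \<rho> A x y" if "A \<in> Obj C" "x \<in> Hom C A X" "y \<in> Hom C A X" for A x y
    using \<rho>[OF that] by (auto simp: S_def rel_at_def)
  have "pseudocongruence C S"
  proof (rule pseudocongruenceI[OF P])
    fix A x y z assume A: "A \<in> Obj C" and xy: "rel_at C S A x y" "rel_at C S A y z"
    then show "rel_at C S A x z"
      using rel_at_hom[OF P A xy(1)] rel_at_hom[OF P A xy(2)] tr[OF A, of x y z] r[OF A]
      by (auto simp: S_def)
  qed (use r le in \<open>auto simp: S_def\<close>)
  then show ?thesis using r by (intro exI[of _ S]) (auto simp: S_def)
qed

lemma discrete_exists:
  assumes X: "X \<in> Obj C"
  shows "\<exists>S. pseudocongruence C S \<and> Base S = X \<and>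
    (\<forall>A\<in>Obj C. \<forall>x\<in>Hom C A X. \<forall>y\<in>Hom C A X. rel_at C S A x y \<longleftrightarrow> Le C A X x y)"
proof -
  obtain L p where Lp: "weakly_represents UNIV (\<lambda>_. X) L p (\<lambda>A x. \<forall>k\<in>(UNIV :: unit set).
      Le C A X (Cmp C A X X (Idt C X) (x False)) (Cmp C A X X (Idt C X) (x True)))"
    using weak_solution[of "UNIV :: bool set" "UNIV :: unit set" "\<lambda>_. X" "\<lambda>k. False" "\<lambda>k. True" "\<lambda>_. X"
        "\<lambda>_. Idt C X" "\<lambda>_. Idt C X"] X id_hom[OF X] by fastforce
  note L = weakly_representsD(1)[OF Lp] and p = weakly_representsD(2)[OF Lp UNIV_I]
    and u = weakly_representsD(3)[OF Lp]
  show ?thesis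
  proof (rule pseudocongruence_exists[OF X L p[of False] p[of True]])
    fix A x y assume A: "A \<in> Obj C" and x: "x \<in> Hom C A X" and y: "y \<in> Hom C A X"
    show "Le C A X x y \<longleftrightarrow>
        (\<exists>h\<in>Hom C A L. x = Cmp C A L X (p False) h \<and> y = Cmp C A L X (p True) h)"
      using u[OF A, of "\<lambda>i. if i then y else x"] X A x y
      by (simp add: all_bool_eq comp_id_left conj_commute)
  qed (use Le_trans X in blast)+
qed

text \<open>Its relation object is a weak comma object of the identity of \<open>X\<close> with
  itself. A choice is made since weak limits are not canonical; only the relation it presents
  matters.\<close>

definition disc :: "'o \<Rightarrow> ('o, 'm) parallel_pair" where
  "disc X = (SOME S. pseudocongruence C S \<and> Base S = X \<and>
    (\<forall>A\<in>Obj C. \<forall>x\<in>Hom C A X. \<forall>y\<in>Hom C A X. rel_at C S A x y \<longleftrightarrow> Le C A X x y))"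

lemma disc:
  assumes "X \<in> Obj C"
  shows pseudocongruence_disc: "pseudocongruence C (disc X)"
    and Base_disc: "Base (disc X) = X"
    and rel_at_disc: "\<lbrakk>A \<in> Obj C; x \<in> Hom C A X; y \<in> Hom C A X\<rbrakk>
      \<Longrightarrow> rel_at C (disc X) A x y \<longleftrightarrow> Le C A X x y"
  using someI_ex[OF discrete_exists[OF assms]] by (auto simp: disc_def)

text \<open>Preserving the discrete preorder is monotonicity of composition, because the preorder of
  \<open>T\<close> contains the order. So any morphism of \<open>C\<close> becomes a morphism of the
  completion once its domain is made discrete.\<close>

lemma premorphism_disc:
  assumes "X \<in> Obj C" "pseudocongruence C T" "f \<in> Hom C X (Base T)"
  shows "f \<in> pc_premorphisms C (disc X) T"
  using assms
  by (intro premorphismI)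
    (auto simp: disc pseudocongruence_Base intro!: rel_at_Le comp_hom comp_mono_right)

text \<open>Each relation is turned into equations by a further unknown \<open>r k\<close> into
  \<open>Rel (S k)\<close>, whose two projections are to equal the two related morphisms. Solving
  the enlarged system and forgetting the new unknowns gives the claim.\<close>

lemma weak_solution_rel:
  fixes I :: "'i set" and K :: "'k set"
  assumes I: "finite I" and K: "finite K" and V: "\<And>i. i \<in> I \<Longrightarrow> V i \<in> Obj C"
    and kK: "\<And>k. k \<in> K \<Longrightarrow> s k \<in> I \<and> t k \<in> I \<and> parallel C (S k) \<and>
      f k \<in> Hom C (V (s k)) (Base (S k)) \<and> g k \<in> Hom C (V (t k)) (Base (S k))"
  shows "\<exists>L p. weakly_represents I V L p (\<lambda>A x.
    \<forall>k\<in>K. rel_at C (S k) A (Cmp C A (V (s k)) (Base (S k)) (f k) (x (s k)))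
                            (Cmp C A (V (t k)) (Base (S k)) (g k) (x (t k))))"
proof -
  let ?J = "Inl ` I \<union> Inr ` K"
  define W where "W = case_sum V (\<lambda>k. Rel (S k))"
  let ?c = "\<lambda>b k. if b then s k else t k" and ?d = "\<lambda>b k. if b then f k else g k"
    and ?r = "\<lambda>b k. if b then R0 (S k) else R1 (S k)"
  \<comment> \<open>In an index \<open>(k, b, c)\<close>, \<open>b\<close> selects the equation for
    \<open>R0\<close> or for \<open>R1\<close>, and \<open>c\<close> selects one of the two
    inequalities that make up that equation. \<open>Inl\<close> marks the given unknowns,
    \<open>Inr\<close> the added ones.\<close>
  define s' where "s' = (\<lambda>(k, b, c). if c then Inr k else Inl (?c b k) :: 'i + 'k)"
  define t' where "t' = (\<lambda>(k, b, c). if c then Inl (?c b k) else Inr k :: 'i + 'k)"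
  define f' where "f' = (\<lambda>(k, b, c). if c then ?r b k else ?d b k)"
  define g' where "g' = (\<lambda>(k, b, c). if c then ?d b k else ?r b k)"
  have PK: "\<And>k. k \<in> K \<Longrightarrow> s k \<in> I \<and> t k \<in> I \<and> Base (S k) \<in> Obj C \<and> Rel (S k) \<in> Obj C \<and>
     R0 (S k) \<in> Hom C (Rel (S k)) (Base (S k)) \<and> R1 (S k) \<in> Hom C (Rel (S k)) (Base (S k)) \<and>
      f k \<in> Hom C (V (s k)) (Base (S k)) \<and> g k \<in> Hom C (V (t k)) (Base (S k))"
    using kK by (simp add: parallel_def)
  have "\<exists>L p. weakly_represents ?J W L p (\<lambda>A x.
      \<forall>k\<in>K \<times> (UNIV :: (bool \<times> bool) set). Le C A (Base (S (fst k)))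
            (Cmp C A (W (s' k)) (Base (S (fst k))) (f' k) (x (s' k)))
            (Cmp C A (W (t' k)) (Base (S (fst k))) (g' k) (x (t' k))))"
    by (rule weak_solution[of ?J "K \<times> UNIV" W s' t' "\<lambda>k. Base (S (fst k))" f' g'])
      (use I K V PK in \<open>auto simp: W_def s'_def t'_def f'_def g'_def split: if_splits\<close>)
  then obtain L p where Lp: "weakly_represents ?J W L p (\<lambda>A x.
      \<forall>k\<in>K \<times> (UNIV :: (bool \<times> bool) set). Le C A (Base (S (fst k)))
            (Cmp C A (W (s' k)) (Base (S (fst k))) (f' k) (x (s' k)))
            (Cmp C A (W (t' k)) (Base (S (fst k))) (g' k) (x (t' k))))"
    by (elim exE)
  note L = weakly_representsD(1)[OF Lp] and p = weakly_representsD(2)[OF Lp]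
    and u = weakly_representsD(3)[OF Lp]
  have p1: "p (Inl i) \<in> Hom C L (V i)" if "i \<in> I" for i using p[of "Inl i"] that by (simp add: W_def)
  have p2: "p (Inr k) \<in> Hom C L (Rel (S k))" if "k \<in> K" for k using p[of "Inr k"] that by (simp add: W_def)
  have eq: "(\<forall>k\<in>K. Cmp C A (Rel (S k)) (Base (S k)) (R0 (S k)) (r k) =
          Cmp C A (V (s k)) (Base (S k)) (f k) (x (s k)) \<and>
        Cmp C A (Rel (S k)) (Base (S k)) (R1 (S k)) (r k) =
          Cmp C A (V (t k)) (Base (S k)) (g k) (x (t k))) \<longleftrightarrow>
      (\<exists>h\<in>Hom C A L. (\<forall>i\<in>I. x i = Cmp C A L (V i) (p (Inl i)) h) \<and>
        (\<forall>k\<in>K. r k = Cmp C A L (Rel (S k)) (p (Inr k)) h))"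
    if A: "A \<in> Obj C" and x: "\<forall>i\<in>I. x i \<in> Hom C A (V i)" and r: "\<forall>k\<in>K. r k \<in> Hom C A (Rel (S k))"
    for A x r
  proof -
    have e: "u = v \<longleftrightarrow> Le C A (Base (S k)) u v \<and> Le C A (Base (S k)) v u"
      if "k \<in> K" "u \<in> Hom C A (Base (S k))" "v \<in> Hom C A (Base (S k))" for k u v
      using that A PK Le_antisym Le_refl by metis
    have c: "k \<in> K \<Longrightarrow> Cmp C A (V (s k)) (Base (S k)) (f k) (x (s k)) \<in> Hom C A (Base (S k))"
      "k \<in> K \<Longrightarrow> Cmp C A (V (t k)) (Base (S k)) (g k) (x (t k)) \<in> Hom C A (Base (S k))"
      "k \<in> K \<Longrightarrow> Cmp C A (Rel (S k)) (Base (S k)) (R0 (S k)) (r k) \<in> Hom C A (Base (S k))"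
      "k \<in> K \<Longrightarrow> Cmp C A (Rel (S k)) (Base (S k)) (R1 (S k)) (r k) \<in> Hom C A (Base (S k))" for k
      using PK[of k] V x r A by (auto intro!: comp_hom)
    have "(\<exists>h\<in>Hom C A L. (\<forall>i\<in>I. x i = Cmp C A L (V i) (p (Inl i)) h) \<and>
        (\<forall>k\<in>K. r k = Cmp C A L (Rel (S k)) (p (Inr k)) h)) \<longleftrightarrow>
      (\<exists>h\<in>Hom C A L. \<forall>i\<in>?J. case_sum x r i = Cmp C A L (W i) (p i) h)"
      by (simp add: ball_Un W_def)
    also have "\<dots> \<longleftrightarrow> (\<forall>k\<in>K \<times> (UNIV :: (bool \<times> bool) set). Le C A (Base (S (fst k)))
            (Cmp C A (W (s' k)) (Base (S (fst k))) (f' k) (case_sum x r (s' k)))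
            (Cmp C A (W (t' k)) (Base (S (fst k))) (g' k) (case_sum x r (t' k))))"
      by (rule u[symmetric]) (use A x r in \<open>auto simp: W_def\<close>)
    also have "\<dots> \<longleftrightarrow> (\<forall>k\<in>K. Cmp C A (Rel (S k)) (Base (S k)) (R0 (S k)) (r k) =
          Cmp C A (V (s k)) (Base (S k)) (f k) (x (s k)) \<and>
        Cmp C A (Rel (S k)) (Base (S k)) (R1 (S k)) (r k) =
          Cmp C A (V (t k)) (Base (S k)) (g k) (x (t k)))"
      by (auto simp: e[OF _ c(3) c(1)] e[OF _ c(4) c(2)] W_def s'_def t'_def f'_def g'_def split: if_splits)
    finally show ?thesis ..
  qed
  show ?thesis
    unfolding weakly_represents_def
  proof (intro exI[of _ L] exI[of _ "\<lambda>i. p (Inl i)"] conjI ballI allI impI L)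
    fix A x assume A: "A \<in> Obj C" and x: "\<forall>i\<in>I. x i \<in> Hom C A (V i)"
    \<comment> \<open>The witnesses of the separate relations are collected by choice into one
      family \<open>r\<close>.\<close>
    have "(\<forall>k\<in>K. rel_at C (S k) A (Cmp C A (V (s k)) (Base (S k)) (f k) (x (s k)))
                         (Cmp C A (V (t k)) (Base (S k)) (g k) (x (t k)))) \<longleftrightarrow>
      (\<exists>r. (\<forall>k\<in>K. r k \<in> Hom C A (Rel (S k))) \<and>
        (\<forall>k\<in>K. Cmp C A (Rel (S k)) (Base (S k)) (R0 (S k)) (r k) =
          Cmp C A (V (s k)) (Base (S k)) (f k) (x (s k)) \<and>
        Cmp C A (Rel (S k)) (Base (S k)) (R1 (S k)) (r k) =
          Cmp C A (V (t k)) (Base (S k)) (g k) (x (t k))))"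
      unfolding rel_at_def Bex_def bchoice_iff by (simp add: ball_conj_distrib)
    also have "\<dots> \<longleftrightarrow> (\<exists>r. (\<forall>k\<in>K. r k \<in> Hom C A (Rel (S k))) \<and>
      (\<exists>h\<in>Hom C A L. (\<forall>i\<in>I. x i = Cmp C A L (V i) (p (Inl i)) h) \<and>
        (\<forall>k\<in>K. r k = Cmp C A L (Rel (S k)) (p (Inr k)) h)))"
      using eq[OF A x] by (intro ex_cong1) blast
    \<comment> \<open>Given \<open>h\<close>, the family \<open>r\<close> can be read off from the
      components at \<open>Inr k\<close>, so these conditions disappear.\<close>
    also have "\<dots> \<longleftrightarrow> (\<exists>h\<in>Hom C A L. \<forall>i\<in>I. x i = Cmp C A L (V i) (p (Inl i)) h)" (is "?a \<longleftrightarrow> ?b")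
    proof
      assume ?b
      then obtain h where h: "h \<in> Hom C A L" "\<forall>i\<in>I. x i = Cmp C A L (V i) (p (Inl i)) h" by blast
      have "Cmp C A L (Rel (S k)) (p (Inr k)) h \<in> Hom C A (Rel (S k))" if "k \<in> K" for k
        using that p2 h A L PK by (auto intro: comp_hom)
      then show ?a using h by (intro exI[of _ "\<lambda>k. Cmp C A L (Rel (S k)) (p (Inr k)) h"]) blast
    qed blast
    finally show "(\<forall>k\<in>K. rel_at C (S k) A (Cmp C A (V (s k)) (Base (S k)) (f k) (x (s k)))
                         (Cmp C A (V (t k)) (Base (S k)) (g k) (x (t k)))) =
      (\<exists>h\<in>Hom C A L. \<forall>i\<in>I. x i = Cmp C A L (V i) (p (Inl i)) h)" .
  qed (use p1 in blast)
qed

end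

section \<open>The exact completion as a category\<close>

definition pc_class ::
  "('o, 'm) pcat \<Rightarrow> ('o, 'm) parallel_pair \<Rightarrow> ('o, 'm) parallel_pair \<Rightarrow> 'm \<Rightarrow> 'm set" where
  "pc_class C S T f = pc_equiv C S T `` {f}"

context pos_category
begin

lemma premorphism_comp:
  assumes S: "pseudocongruence C S" and T: "pseudocongruence C T" and U: "pseudocongruence C U"
    and f: "f \<in> pc_premorphisms C S T" and g: "g \<in> pc_premorphisms C T U"
  shows "Cmp C (Base S) (Base T) (Base U) g f \<in> pc_premorphisms C S U"
proof (rule premorphismI[OF S U])
  note [simp] = pseudocongruence_Base[OF S] pseudocongruence_Base[OF T] pseudocongruence_Base[OF U]
    premorphism_hom[OF f] premorphism_hom[OF g]
  show "Cmp C (Base S) (Base T) (Base U) g f \<in> Hom C (Base S) (Base U)"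
    by (rule comp_hom) auto
  fix A x y assume A: "A \<in> Obj C" "x \<in> Hom C A (Base S)" "y \<in> Hom C A (Base S)" and xy: "rel_at C S A x y"
  then show "rel_at C U A (Cmp C A (Base S) (Base U) (Cmp C (Base S) (Base T) (Base U) g f) x)
      (Cmp C A (Base S) (Base U) (Cmp C (Base S) (Base T) (Base U) g f) y)"
    using premorphism_rel[OF g T U A(1) premorphism_rel[OF f S T A(1) xy]] by (simp add: comp_assoc)
qed

lemma premorphism_id:
  assumes S: "pseudocongruence C S"
  shows "Idt C (Base S) \<in> pc_premorphisms C S S"
  using pseudocongruence_Base[OF S]
  by (intro premorphismI[OF S S]) (auto simp: comp_id_left id_hom)

text \<open>Move from \<open>g f\<close> to \<open>g f'\<close> because \<open>g\<close> preserves
  relations, then to \<open>g' f'\<close> by precomposing with \<open>f'\<close>. Both the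
  independence of representatives and the monotonicity of composition rest on this.\<close>

lemma rel_at_comp:
  assumes S: "pseudocongruence C S" and T: "pseudocongruence C T" and U: "pseudocongruence C U"
    and f: "rel_at C T (Base S) f f'" and g: "g \<in> pc_premorphisms C T U" "rel_at C U (Base T) g g'"
  shows "rel_at C U (Base S) (Cmp C (Base S) (Base T) (Base U) g f) (Cmp C (Base S) (Base T) (Base U) g' f')"
proof (rule rel_at_trans[OF U])
  have B: "Base S \<in> Obj C" "Base T \<in> Obj C" using S T by (auto intro: pseudocongruence_Base)
  show "Base S \<in> Obj C" by (rule B)
  show "rel_at C U (Base S) (Cmp C (Base S) (Base T) (Base U) g f) (Cmp C (Base S) (Base T) (Base U) g f')"
    by (rule premorphism_rel[OF g(1) T U B(1) f])
  show "rel_at C U (Base S) (Cmp C (Base S) (Base T) (Base U) g f') (Cmp C (Base S) (Base T) (Base U) g' f')"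
    using rel_at_hom[OF pseudocongruence_parallel[OF T] B(1) f]
    by (intro rel_at_precomp[OF pseudocongruence_parallel[OF U] B(2) B(1) _ g(2)])
qed

lemma equiv_pc_equiv:
  assumes S: "pseudocongruence C S" and T: "pseudocongruence C T"
  shows "equiv (pc_premorphisms C S T) (pc_equiv C S T)"
proof -
  have B: "Base S \<in> Obj C" using S by (rule pseudocongruence_Base)
  show ?thesis
  proof (rule equivI)
    show "trans (pc_equiv C S T)"
      by (rule transI) (auto simp: pc_equiv_def pc_preceq_iff intro: rel_at_trans[OF T B])
  qed (auto simp: pc_equiv_def pc_preceq_iff refl_on_def sym_def
        intro!: rel_at_refl[OF T B] premorphism_hom)
qed

lemma pc_class_eq_iff:
  assumes "pseudocongruence C S" "pseudocongruence C T"
    "f \<in> pc_premorphisms C S T" "g \<in> pc_premorphisms C S T"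
  shows "pc_class C S T f = pc_class C S T g \<longleftrightarrow>
    rel_at C T (Base S) f g \<and> rel_at C T (Base S) g f"
  using eq_equiv_class_iff[OF equiv_pc_equiv[OF assms(1,2)] assms(3,4)] assms(3,4)
  by (simp add: pc_class_def pc_equiv_def pc_preceq_iff)

lemma pc_class_mem:
  assumes "pseudocongruence C S" "pseudocongruence C T" "f \<in> pc_premorphisms C S T"
  shows "h \<in> pc_class C S T f \<longleftrightarrow> h \<in> pc_premorphisms C S T \<and>
    rel_at C T (Base S) f h \<and> rel_at C T (Base S) h f"
  using assms by (auto simp: pc_class_def pc_equiv_def pc_preceq_iff)

lemma Obj_ex: "S \<in> Obj (ex_completion C) \<longleftrightarrow> pseudocongruence C S"
  by (simp add: ex_completion_def)

lemma Hom_exE: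
  assumes "F \<in> Hom (ex_completion C) S T"
  obtains f where "f \<in> pc_premorphisms C S T" "F = pc_class C S T f"
  using assms by (auto simp: ex_completion_def pc_class_def quotient_def)

lemma pc_class_Hom:
  "f \<in> pc_premorphisms C S T \<Longrightarrow> pc_class C S T f \<in> Hom (ex_completion C) S T"
  by (auto simp: ex_completion_def pc_class_def quotient_def)

lemma Le_ex:
  assumes S: "pseudocongruence C S" and T: "pseudocongruence C T"
    and f: "f \<in> pc_premorphisms C S T" and g: "g \<in> pc_premorphisms C S T"
  shows "Le (ex_completion C) S T (pc_class C S T f) (pc_class C S T g) \<longleftrightarrow> rel_at C T (Base S) f g"
proof -
  have B: "Base S \<in> Obj C" using S by (rule pseudocongruence_Base)
  have "f \<in> pc_class C S T f" "g \<in> pc_class C S T g"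
    using f g rel_at_refl[OF T B] by (auto simp: pc_class_mem[OF S T] premorphism_hom)
  moreover have "rel_at C T (Base S) f g"
    if "f' \<in> pc_class C S T f" "g' \<in> pc_class C S T g" "rel_at C T (Base S) f' g'" for f' g'
    using that rel_at_trans[OF T B] pc_class_mem[OF S T] f g by metis
  ultimately show ?thesis by (auto simp: ex_completion_def pc_preceq_iff)
qed

lemma Idt_ex: "Idt (ex_completion C) S = pc_class C S S (Idt C (Base S))"
  by (simp add: ex_completion_def pc_class_def)

lemma Cmp_ex:
  assumes S: "pseudocongruence C S" and T: "pseudocongruence C T" and U: "pseudocongruence C U"
    and f: "f \<in> pc_premorphisms C S T" and g: "g \<in> pc_premorphisms C T U"
  shows "Cmp (ex_completion C) S T U (pc_class C T U g) (pc_class C S T f) =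
    pc_class C S U (Cmp C (Base S) (Base T) (Base U) g f)"
proof -
  have B: "Base S \<in> Obj C" "Base T \<in> Obj C" using S T by (auto intro: pseudocongruence_Base)
  have fg: "f \<in> pc_class C S T f" "g \<in> pc_class C T U g"
    using f g rel_at_refl[OF T B(1)] rel_at_refl[OF U B(2)]
    by (auto simp: pc_class_mem[OF S T] pc_class_mem[OF T U] premorphism_hom)
  have eq: "pc_class C S U (Cmp C (Base S) (Base T) (Base U) g' f') =
      pc_class C S U (Cmp C (Base S) (Base T) (Base U) g f)"
    if "f' \<in> pc_class C S T f" "g' \<in> pc_class C T U g" for f' g'
    using that f g
    by (auto simp: pc_class_mem[OF S T] pc_class_mem[OF T U] pc_class_eq_iff[OF S U]
        premorphism_comp[OF S T U] intro!: rel_at_comp[OF S T U])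
  have "Cmp (ex_completion C) S T U (pc_class C T U g) (pc_class C S T f) =
    (\<Union>g'\<in>pc_class C T U g. \<Union>f'\<in>pc_class C S T f. pc_class C S U (Cmp C (Base S) (Base T) (Base U) g' f'))"
    by (simp add: ex_completion_def pc_class_def)
  also have "\<dots> = pc_class C S U (Cmp C (Base S) (Base T) (Base U) g f)"
    using fg eq by blast
  finally show ?thesis .
qed

lemma ex_category: "pos_category (ex_completion C)"
proof
  fix S T :: "('o, 'm) parallel_pair"
  assume "S \<in> Obj (ex_completion C)" "T \<in> Obj (ex_completion C)"
  then have S: "pseudocongruence C S" and T: "pseudocongruence C T" by (auto simp: Obj_ex)
  note B = pseudocongruence_Base[OF S]
  show "poset_on (Hom (ex_completion C) S T) (Le (ex_completion C) S T)"
    unfolding poset_on_def reflp_on_def transp_on_def antisymp_on_def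
  proof (intro conjI ballI impI)
    fix F assume "F \<in> Hom (ex_completion C) S T"
    then show "Le (ex_completion C) S T F F"
      by (elim Hom_exE) (simp add: Le_ex[OF S T] rel_at_refl[OF T B] premorphism_hom)
  next
    fix F G H assume "F \<in> Hom (ex_completion C) S T" "G \<in> Hom (ex_completion C) S T"
      "H \<in> Hom (ex_completion C) S T" "Le (ex_completion C) S T F G" "Le (ex_completion C) S T G H"
    then show "Le (ex_completion C) S T F H"
      by (elim Hom_exE) (use rel_at_trans[OF T B] in \<open>auto simp: Le_ex[OF S T]\<close>)
  next
    fix F G assume "F \<in> Hom (ex_completion C) S T" "G \<in> Hom (ex_completion C) S T"
      "Le (ex_completion C) S T F G" "Le (ex_completion C) S T G F"
    then show "F = G"
      by (elim Hom_exE) (simp add: Le_ex[OF S T] pc_class_eq_iff[OF S T])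
  qed
next
  fix S :: "('o, 'm) parallel_pair"
  assume "S \<in> Obj (ex_completion C)"
  then show "Idt (ex_completion C) S \<in> Hom (ex_completion C) S S"
    by (auto simp: Obj_ex Idt_ex intro!: pc_class_Hom premorphism_id)
next
  fix S T U :: "('o, 'm) parallel_pair" and F G
  assume "S \<in> Obj (ex_completion C)" "T \<in> Obj (ex_completion C)" "U \<in> Obj (ex_completion C)"
    "F \<in> Hom (ex_completion C) S T" "G \<in> Hom (ex_completion C) T U"
  then show "Cmp (ex_completion C) S T U G F \<in> Hom (ex_completion C) S U"
    by (auto simp: Obj_ex Cmp_ex elim!: Hom_exE intro!: pc_class_Hom premorphism_comp)
next
  fix S T :: "('o, 'm) parallel_pair" and F
  assume "S \<in> Obj (ex_completion C)" "T \<in> Obj (ex_completion C)" "F \<in> Hom (ex_completion C) S T"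
  then show "Cmp (ex_completion C) S S T F (Idt (ex_completion C) S) = F"
    and "Cmp (ex_completion C) S T T (Idt (ex_completion C) T) F = F"
    by (auto simp: Obj_ex Idt_ex Cmp_ex premorphism_id premorphism_hom comp_id_left comp_id_right
        pseudocongruence_Base elim!: Hom_exE)
next
  fix S T U V :: "('o, 'm) parallel_pair" and F G H
  assume "S \<in> Obj (ex_completion C)" "T \<in> Obj (ex_completion C)" "U \<in> Obj (ex_completion C)"
    "V \<in> Obj (ex_completion C)" "F \<in> Hom (ex_completion C) S T" "G \<in> Hom (ex_completion C) T U"
    "H \<in> Hom (ex_completion C) U V"
  then show "Cmp (ex_completion C) S U V H (Cmp (ex_completion C) S T U G F) =
      Cmp (ex_completion C) S T V (Cmp (ex_completion C) T U V H G) F"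
    by (auto simp: Obj_ex Cmp_ex premorphism_comp premorphism_hom comp_assoc
        pseudocongruence_Base elim!: Hom_exE)
next
  fix S T U :: "('o, 'm) parallel_pair" and F F' G G'
  assume "S \<in> Obj (ex_completion C)" "T \<in> Obj (ex_completion C)" "U \<in> Obj (ex_completion C)"
    "F \<in> Hom (ex_completion C) S T" "F' \<in> Hom (ex_completion C) S T"
    "G \<in> Hom (ex_completion C) T U" "G' \<in> Hom (ex_completion C) T U"
    "Le (ex_completion C) S T F F'" "Le (ex_completion C) T U G G'"
  then show "Le (ex_completion C) S U (Cmp (ex_completion C) S T U G F) (Cmp (ex_completion C) S T U G' F')"
    by (auto simp: Obj_ex Cmp_ex Le_ex premorphism_comp rel_at_comp elim!: Hom_exE)
qed

text \<open>If \<open>x\<close> and \<open>y\<close> are related, so are \<open>b x\<close> and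
  \<open>b y\<close>, hence \<open>m d x\<close> and \<open>m d y\<close>, and \<open>m\<close>
  reflects this. It is the means by which a morphism \<open>d\<close> found in \<open>C\<close>
  alone is recognized as a morphism of the completion.\<close>

lemma premorphism_lift:
  assumes X: "pseudocongruence C X" and Y: "pseudocongruence C Y" and T: "pseudocongruence C T"
    and m: "m \<in> Hom C (Base X) (Base Y)"
    and refl: "\<And>A u v. \<lbrakk>A \<in> Obj C; u \<in> Hom C A (Base X); v \<in> Hom C A (Base X);
      rel_at C Y A (Cmp C A (Base X) (Base Y) m u) (Cmp C A (Base X) (Base Y) m v)\<rbrakk> \<Longrightarrow> rel_at C X A u v"
    and b: "b \<in> pc_premorphisms C T Y" and d: "d \<in> Hom C (Base T) (Base X)"
    and le: "rel_at C Y (Base T) (Cmp C (Base T) (Base X) (Base Y) m d) b"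
    and ge: "rel_at C Y (Base T) b (Cmp C (Base T) (Base X) (Base Y) m d)"
  shows "d \<in> pc_premorphisms C T X"
proof (rule premorphismI[OF T X d])
  note [simp] = pseudocongruence_Base[OF X] pseudocongruence_Base[OF Y] pseudocongruence_Base[OF T]
    premorphism_hom[OF b] m d comp_hom
  fix A x y assume A[simp]: "A \<in> Obj C" "x \<in> Hom C A (Base T)" "y \<in> Hom C A (Base T)" and xy: "rel_at C T A x y"
  note pre = rel_at_precomp[OF pseudocongruence_parallel[OF Y] pseudocongruence_Base[OF T] A(1)]
  have "rel_at C Y A (Cmp C A (Base T) (Base Y) (Cmp C (Base T) (Base X) (Base Y) m d) x)
      (Cmp C A (Base T) (Base Y) (Cmp C (Base T) (Base X) (Base Y) m d) y)"
    by (rule rel_at_trans[OF Y A(1) pre[OF A(2) le] rel_at_trans[OF Y A(1) _ pre[OF A(3) ge]]])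
      (rule premorphism_rel[OF b T Y A(1) xy])
  then show "rel_at C X A (Cmp C A (Base T) (Base X) d x) (Cmp C A (Base T) (Base X) d y)"
    by (intro refl) (simp_all add: comp_assoc)
qed

lemma order_mono_exI:
  assumes S: "pseudocongruence C S" and T: "pseudocongruence C T" and m: "m \<in> pc_premorphisms C S T"
    and refl: "\<And>A u v. \<lbrakk>A \<in> Obj C; u \<in> Hom C A (Base S); v \<in> Hom C A (Base S);
      rel_at C T A (Cmp C A (Base S) (Base T) m u) (Cmp C A (Base S) (Base T) m v)\<rbrakk> \<Longrightarrow> rel_at C S A u v"
  shows "order_mono (ex_completion C) S T (pc_class C S T m)"
  unfolding order_mono_def using S T m
  by (auto simp: Obj_ex Cmp_ex Le_ex premorphism_comp intro!: pc_class_Hom refl pseudocongruence_Base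
      premorphism_hom elim!: Hom_exE)

end

context weakly_lex_category
begin

sublocale ex: pos_category "ex_completion C"
  by (rule ex_category)

section \<open>Order-monomorphisms and so-morphisms in the completion\<close>

text \<open>Morphisms of \<open>C\<close> into the base of \<open>S\<close> are the morphisms into \<open>S\<close> from discrete objects, so
  order-monomorphisms in the completion are tested on them.\<close>
lemma order_mono_ex_reflects:
  assumes S: "pseudocongruence C S" and T: "pseudocongruence C T" and m: "m \<in> pc_premorphisms C S T"
    and mono: "order_mono (ex_completion C) S T (pc_class C S T m)"
    and A: "A \<in> Obj C" and u: "u \<in> Hom C A (Base S)" and v: "v \<in> Hom C A (Base S)"
    and le: "rel_at C T A (Cmp C A (Base S) (Base T) m u) (Cmp C A (Base S) (Base T) m v)"
  shows "rel_at C S A u v"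
proof -
  note D = pseudocongruence_disc[OF A]
  have pu: "u \<in> pc_premorphisms C (disc A) S" and pv: "v \<in> pc_premorphisms C (disc A) S"
    using premorphism_disc A S u v by auto
  have "Le (ex_completion C) (disc A) S (pc_class C (disc A) S u) (pc_class C (disc A) S v)"
  proof -
    have "Le (ex_completion C) (disc A) T
        (Cmp (ex_completion C) (disc A) S T (pc_class C S T m) (pc_class C (disc A) S u))
        (Cmp (ex_completion C) (disc A) S T (pc_class C S T m) (pc_class C (disc A) S v))"
      using premorphism_comp[OF D S T pu m] premorphism_comp[OF D S T pv m] le
      by (simp add: Cmp_ex D S T pu pv m Le_ex Base_disc[OF A])
    then show ?thesis
      using mono D pc_class_Hom[OF pu] pc_class_Hom[OF pv] by (simp add: order_mono_def Obj_ex)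
  qed
  then show ?thesis using pu pv D S by (simp add: Le_ex Base_disc[OF A])
qed

section \<open>Images, so-morphisms and their stability under pullback\<close>

lemma inverse_image_exists:
  assumes S: "X \<in> Obj C" and T: "pseudocongruence C T" and f: "f \<in> Hom C X (Base T)"
  shows "\<exists>I. pseudocongruence C I \<and> Base I = X \<and>
    (\<forall>A\<in>Obj C. \<forall>x\<in>Hom C A X. \<forall>y\<in>Hom C A X.
      rel_at C I A x y \<longleftrightarrow> rel_at C T A (Cmp C A X (Base T) f x) (Cmp C A X (Base T) f y))"
proof -
  note TB = pseudocongruence_Base[OF T]
  obtain L p where Lp: "weakly_represents UNIV (\<lambda>_. X) L p (\<lambda>A x. \<forall>k\<in>(UNIV :: unit set).
      rel_at C T A (Cmp C A X (Base T) f (x False)) (Cmp C A X (Base T) f (x True)))"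
    using weak_solution_rel[of "UNIV :: bool set" "UNIV :: unit set" "\<lambda>_. X" "\<lambda>_. False" "\<lambda>_. True" "\<lambda>_. T" "\<lambda>_. f" "\<lambda>_. f"]
      S f pseudocongruence_parallel[OF T] by fastforce
  note L = weakly_representsD(1)[OF Lp] and p = weakly_representsD(2)[OF Lp UNIV_I]
    and u = weakly_representsD(3)[OF Lp]
  show ?thesis
  proof (rule pseudocongruence_exists[OF S L p[of False] p[of True]])
    fix A x y assume A: "A \<in> Obj C" and x: "x \<in> Hom C A X" and y: "y \<in> Hom C A X"
    show "rel_at C T A (Cmp C A X (Base T) f x) (Cmp C A X (Base T) f y) \<longleftrightarrow>
        (\<exists>h\<in>Hom C A L. x = Cmp C A L X (p False) h \<and> y = Cmp C A L X (p True) h)"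
      using u[OF A, of "\<lambda>i. if i then y else x"] x y
      by (simp add: all_bool_eq conj_commute)
  next
    fix A x y assume "A \<in> Obj C" "x \<in> Hom C A X" "y \<in> Hom C A X" "Le C A X x y"
    then show "rel_at C T A (Cmp C A X (Base T) f x) (Cmp C A X (Base T) f y)"
      using S f TB by (intro rel_at_Le[OF T] comp_mono_right comp_hom)
  qed (rule rel_at_trans[OF T])
qed

text \<open>The section \<open>h\<close> need not preserve the preorders, so \<open>g\<close> need
  not split in the completion. Yet in a square against an order-monomorphism \<open>m\<close> the
  candidate \<open>a0 h\<close> does preserve them, since \<open>m\<close> reflects relations and
  \<open>m a0 h\<close> is equivalent to \<open>b0\<close>.\<close>

lemma so_morphism_exI:
  assumes S: "pseudocongruence C S" and T: "pseudocongruence C T" and g: "g \<in> pc_premorphisms C S T"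
    and h: "h \<in> Hom C (Base T) (Base S)"
    and le: "rel_at C T (Base T) (Cmp C (Base T) (Base S) (Base T) g h) (Idt C (Base T))"
    and ge: "rel_at C T (Base T) (Idt C (Base T)) (Cmp C (Base T) (Base S) (Base T) g h)"
  shows "so_morphism (ex_completion C) S T (pc_class C S T g)"
proof -
  let ?E = "ex_completion C" and ?g = "pc_class C S T g"
  have gE: "?g \<in> Hom ?E S T" by (rule pc_class_Hom[OF g])
  have SE: "S \<in> Obj ?E" and TE: "T \<in> Obj ?E" using S T by (auto simp: Obj_ex)
  have "poset_pullback (Hom ?E T X) (Le ?E T X) (Hom ?E S X) (Le ?E S X) (Hom ?E T Y) (Le ?E T Y)
          (\<lambda>d. Cmp ?E S T X d ?g) (Cmp ?E T X Y m) (Cmp ?E S X Y m) (\<lambda>b. Cmp ?E S T Y b ?g)"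
    if XE: "X \<in> Obj ?E" and YE: "Y \<in> Obj ?E" and m: "order_mono ?E X Y m" for X Y m
    unfolding poset_pullback_def
  proof (rule poset_isoI)
    have mE: "m \<in> Hom ?E X Y" using m by (simp add: order_mono_def)
    show "poset_on (Hom ?E T X) (Le ?E T X)" using TE XE by (rule ex.hom_poset)
    show "(Cmp ?E S T X F ?g, Cmp ?E T X Y m F) \<in>
        {(a, b). a \<in> Hom ?E S X \<and> b \<in> Hom ?E T Y \<and> Cmp ?E S X Y m a = Cmp ?E S T Y b ?g}"
      if "F \<in> Hom ?E T X" for F
      using that gE SE TE XE YE mE by (auto simp: ex.comp_assoc intro!: ex.comp_hom)
    show "Le ?E T X F F' \<longleftrightarrow> rel_prod (Le ?E S X) (Le ?E T Y)
        (Cmp ?E S T X F ?g, Cmp ?E T X Y m F) (Cmp ?E S T X F' ?g, Cmp ?E T X Y m F')"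
      if F: "F \<in> Hom ?E T X" "F' \<in> Hom ?E T X" for F F'
    proof
      assume "Le ?E T X F F'"
      then show "rel_prod (Le ?E S X) (Le ?E T Y)
        (Cmp ?E S T X F ?g, Cmp ?E T X Y m F) (Cmp ?E S T X F' ?g, Cmp ?E T X Y m F')"
        using F gE SE TE XE YE mE by (auto intro!: ex.comp_mono_left ex.comp_mono_right)
    qed (use m F TE in \<open>auto simp: order_mono_def\<close>)
    fix ab assume "ab \<in> {(a, b). a \<in> Hom ?E S X \<and> b \<in> Hom ?E T Y \<and> Cmp ?E S X Y m a = Cmp ?E S T Y b ?g}"
    then obtain a b where ab: "ab = (a, b)" and a: "a \<in> Hom ?E S X" and b: "b \<in> Hom ?E T Y"
      and eq: "Cmp ?E S X Y m a = Cmp ?E S T Y b ?g" by auto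
    have X: "pseudocongruence C X" and Y: "pseudocongruence C Y" using XE YE by (auto simp: Obj_ex)
    obtain a0 where a0: "a0 \<in> pc_premorphisms C S X" "a = pc_class C S X a0" using a by (rule Hom_exE)
    obtain b0 where b0: "b0 \<in> pc_premorphisms C T Y" "b = pc_class C T Y b0" using b by (rule Hom_exE)
    obtain m0 where m0: "m0 \<in> pc_premorphisms C X Y" "m = pc_class C X Y m0" using mE by (rule Hom_exE)
    note [simp] = pseudocongruence_Base[OF S] pseudocongruence_Base[OF T]
      pseudocongruence_Base[OF X] pseudocongruence_Base[OF Y]
      premorphism_hom[OF a0(1)] premorphism_hom[OF b0(1)] premorphism_hom[OF m0(1)] premorphism_hom[OF g] h
    \<comment> \<open>From \<open>m0 a0 ~ b0 g\<close> and \<open>g h ~ id\<close> it follows that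
      \<open>m0 a0 h ~ b0 g h ~ b0\<close>, which is one triangle.\<close>
    let ?d = "Cmp C (Base T) (Base S) (Base X) a0 h"
    have d: "?d \<in> Hom C (Base T) (Base X)" by (intro comp_hom) auto
    have e: "rel_at C Y (Base S) (Cmp C (Base S) (Base X) (Base Y) m0 a0) (Cmp C (Base S) (Base T) (Base Y) b0 g)"
      "rel_at C Y (Base S) (Cmp C (Base S) (Base T) (Base Y) b0 g) (Cmp C (Base S) (Base X) (Base Y) m0 a0)"
      using eq S T X Y a0 b0 m0 g by (simp_all add: Cmp_ex pc_class_eq_iff premorphism_comp)
    note pre = rel_at_precomp[OF pseudocongruence_parallel[OF Y] pseudocongruence_Base[OF S]
        pseudocongruence_Base[OF T] h]
    have le': "rel_at C Y (Base T) (Cmp C (Base T) (Base X) (Base Y) m0 ?d) b0"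
      using rel_at_trans[OF Y _ pre[OF e(1)], of b0]
        premorphism_rel[OF b0(1) T Y _ le] by (simp add: comp_assoc comp_id_right)
    have ge': "rel_at C Y (Base T) b0 (Cmp C (Base T) (Base X) (Base Y) m0 ?d)"
      using rel_at_trans[OF Y _ _ pre[OF e(2)], of b0]
        premorphism_rel[OF b0(1) T Y _ ge] by (simp add: comp_assoc comp_id_right)
    have pd: "?d \<in> pc_premorphisms C T X"
      by (rule premorphism_lift[OF X Y T _ _ b0(1) d le' ge'])
        (use order_mono_ex_reflects[OF X Y m0(1)] m m0(2) in auto)
    let ?D = "pc_class C T X ?d"
    have D: "?D \<in> Hom ?E T X" by (rule pc_class_Hom[OF pd])
    have mD: "Cmp ?E T X Y m ?D = b"
      using T X Y m0 b0 pd le' ge' by (simp add: Cmp_ex pc_class_eq_iff premorphism_comp)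
    \<comment> \<open>The other triangle holds after composing with \<open>m\<close>, and
      \<open>m\<close> can be cancelled.\<close>
    moreover have "Cmp ?E S T X ?D ?g = a"
    proof (rule ex.order_mono_inj[OF m XE YE SE])
      show "Cmp ?E S X Y m (Cmp ?E S T X ?D ?g) = Cmp ?E S X Y m a"
        using D gE mE SE TE XE YE mD eq by (simp add: ex.comp_assoc)
    qed (use a D gE SE TE XE in \<open>auto intro!: ex.comp_hom\<close>)
    ultimately show "\<exists>F\<in>Hom ?E T X. (Cmp ?E S T X F ?g, Cmp ?E T X Y m F) = ab"
      using D ab by blast
  qed
  then show ?thesis using gE by (simp add: so_morphism_def)
qed

text \<open>The image keeps the base of \<open>S\<close> and only coarsens its preorder. The first
  factor is therefore represented by the identity of \<open>Base S\<close>, which is its own section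
  in \<open>C\<close>.\<close>

lemma ex_factorization:
  assumes S: "pseudocongruence C S" and T: "pseudocongruence C T" and g: "g \<in> pc_premorphisms C S T"
  obtains I where "pseudocongruence C I" "Base I = Base S"
    "so_morphism (ex_completion C) S I (pc_class C S I (Idt C (Base S)))"
    "order_mono (ex_completion C) I T (pc_class C I T g)"
    "g \<in> pc_premorphisms C I T" "Idt C (Base S) \<in> pc_premorphisms C S I"
proof -
  note [simp] = pseudocongruence_Base[OF S] pseudocongruence_Base[OF T] premorphism_hom[OF g]
  obtain I where I: "pseudocongruence C I" and BI: "Base I = Base S"
    and r: "\<And>A x y. A \<in> Obj C \<Longrightarrow> x \<in> Hom C A (Base S) \<Longrightarrow> y \<in> Hom C A (Base S) \<Longrightarrow>
      rel_at C I A x y \<longleftrightarrow>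
      rel_at C T A (Cmp C A (Base S) (Base T) g x) (Cmp C A (Base S) (Base T) g y)"
    using inverse_image_exists[of "Base S" T g] T by auto
  have gI: "g \<in> pc_premorphisms C I T"
    by (rule premorphismI[OF I T]) (auto simp: BI r)
  have i: "Idt C (Base S) \<in> pc_premorphisms C S I"
    by (rule premorphismI[OF S I])
      (auto simp: BI r id_hom comp_id_left intro: premorphism_rel[OF g S T])
  have "so_morphism (ex_completion C) S I (pc_class C S I (Idt C (Base S)))"
    by (rule so_morphism_exI[OF S I i, of "Idt C (Base S)"])
      (auto simp: BI id_hom comp_id_left intro!: rel_at_refl[OF I])
  moreover have "order_mono (ex_completion C) I T (pc_class C I T g)"
    by (rule order_mono_exI[OF I T gI]) (simp add: BI r)
  ultimately show thesis using that I BI gI i by blast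
qed

text \<open>Fill the square formed by \<open>g\<close>, its image \<open>I\<close> and the identity
  of \<open>T\<close>. The diagonal goes from \<open>T\<close> to \<open>I\<close>, and since
  \<open>I\<close> has the base of \<open>S\<close>, a representative of it is a section of
  \<open>g\<close> in \<open>C\<close>, though not necessarily a morphism from \<open>T\<close> to
  \<open>S\<close>.\<close>

lemma so_morphism_exD:
  assumes S: "pseudocongruence C S" and T: "pseudocongruence C T" and g: "g \<in> pc_premorphisms C S T"
    and so: "so_morphism (ex_completion C) S T (pc_class C S T g)"
  obtains h where "h \<in> Hom C (Base T) (Base S)"
    "rel_at C T (Base T) (Cmp C (Base T) (Base S) (Base T) g h) (Idt C (Base T))"
    "rel_at C T (Base T) (Idt C (Base T)) (Cmp C (Base T) (Base S) (Base T) g h)"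
proof -
  let ?E = "ex_completion C" and ?g = "pc_class C S T g"
  obtain I where I: "pseudocongruence C I" and BI: "Base I = Base S"
    and m: "order_mono ?E I T (pc_class C I T g)"
    and gI: "g \<in> pc_premorphisms C I T" and i: "Idt C (Base S) \<in> pc_premorphisms C S I"
    using ex_factorization[OF S T g] by blast
  note B = pseudocongruence_Base[OF S] pseudocongruence_Base[OF T] premorphism_hom[OF g]
  note iT = premorphism_id[OF T]
  let ?a = "pc_class C S I (Idt C (Base S))" and ?b = "Idt ?E T"
  have "bij_betw (\<lambda>d. (Cmp ?E S T I d ?g, Cmp ?E T I T (pc_class C I T g) d)) (Hom ?E T I)
      {(a, b). a \<in> Hom ?E S I \<and> b \<in> Hom ?E T T \<and> Cmp ?E S I T (pc_class C I T g) a = Cmp ?E S T T b ?g}"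
    using so m I T by (simp add: so_morphism_def poset_pullback_def poset_iso_def Obj_ex)
  moreover have "(?a, ?b) \<in> {(a, b). a \<in> Hom ?E S I \<and> b \<in> Hom ?E T T \<and>
      Cmp ?E S I T (pc_class C I T g) a = Cmp ?E S T T b ?g}"
    using S T I i gI g iT B
    by (simp add: Idt_ex Cmp_ex pc_class_Hom BI comp_id_left comp_id_right)
  ultimately obtain D where D: "D \<in> Hom ?E T I" and eq: "Cmp ?E T I T (pc_class C I T g) D = ?b"
    unfolding bij_betw_def by (smt (verit) Pair_inject image_iff)
  obtain d where d: "d \<in> pc_premorphisms C T I" "D = pc_class C T I d" using D by (rule Hom_exE)
  have "rel_at C T (Base T) (Cmp C (Base T) (Base S) (Base T) g d) (Idt C (Base T)) \<and>
    rel_at C T (Base T) (Idt C (Base T)) (Cmp C (Base T) (Base S) (Base T) g d)"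
    using eq d T I gI iT premorphism_comp[OF T I T d(1) gI]
    by (simp add: Idt_ex Cmp_ex pc_class_eq_iff BI)
  then show thesis using that premorphism_hom[OF d(1)] BI by auto
qed

text \<open>With a section \<open>k\<close> of \<open>g0\<close>, the pair of \<open>id\<close> and
  \<open>k f0\<close> is compatible up to equivalence, since \<open>g0 k f0 ~ f0\<close>. The
  morphism it induces into \<open>P\<close> is a section of \<open>p0\<close>.\<close>

lemma so_morphism_pullback_ex:
  assumes pb: "is_pullback (ex_completion C) P X Y B p q f g"
    and so: "so_morphism (ex_completion C) Y B g"
  shows "so_morphism (ex_completion C) P X p"
proof -
  let ?E = "ex_completion C"
  have O: "pseudocongruence C P" "pseudocongruence C X" "pseudocongruence C Y" "pseudocongruence C B"
    using pb by (auto simp: is_pullback_def Obj_ex)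
  have h: "p \<in> Hom ?E P X" "q \<in> Hom ?E P Y" "f \<in> Hom ?E X B" "g \<in> Hom ?E Y B"
    using pb by (auto simp: is_pullback_def)
  obtain p0 where p0: "p0 \<in> pc_premorphisms C P X" "p = pc_class C P X p0" using h(1) by (rule Hom_exE)
  obtain f0 where f0: "f0 \<in> pc_premorphisms C X B" "f = pc_class C X B f0" using h(3) by (rule Hom_exE)
  obtain g0 where g0: "g0 \<in> pc_premorphisms C Y B" "g = pc_class C Y B g0" using h(4) by (rule Hom_exE)
  obtain k where k: "k \<in> Hom C (Base B) (Base Y)"
    "rel_at C B (Base B) (Cmp C (Base B) (Base Y) (Base B) g0 k) (Idt C (Base B))"
    "rel_at C B (Base B) (Idt C (Base B)) (Cmp C (Base B) (Base Y) (Base B) g0 k)"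
    using so_morphism_exD[OF O(3,4) g0(1)] so g0(2) by auto
  note [simp] = pseudocongruence_Base[OF O(1)] pseudocongruence_Base[OF O(2)]
    pseudocongruence_Base[OF O(3)] pseudocongruence_Base[OF O(4)]
    premorphism_hom[OF p0(1)] premorphism_hom[OF f0(1)] premorphism_hom[OF g0(1)] k(1)
  \<comment> \<open>The test object has to be discrete: \<open>k\<close>, and with it
    \<open>k f0\<close>, may fail to preserve the preorder of \<open>X\<close>. No return to
    \<open>X\<close> is needed, as the section is only wanted in \<open>C\<close>.\<close>
  let ?Z = "disc (Base X)"
  have Z: "pseudocongruence C ?Z" and BZ[simp]: "Base ?Z = Base X"
    by (simp_all add: pseudocongruence_disc Base_disc)
  have i: "Idt C (Base X) \<in> pc_premorphisms C ?Z X"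
    by (rule premorphism_disc) (simp_all add: O id_hom)
  have kf: "Cmp C (Base X) (Base B) (Base Y) k f0 \<in> pc_premorphisms C ?Z Y"
    by (rule premorphism_disc) (simp_all add: O comp_hom)
  let ?a = "pc_class C ?Z X (Idt C (Base X))" and ?b = "pc_class C ?Z Y (Cmp C (Base X) (Base B) (Base Y) k f0)"
  have "rel_at C B (Base X) (Cmp C (Base X) (Base Y) (Base B) g0 (Cmp C (Base X) (Base B) (Base Y) k f0)) f0"
    "rel_at C B (Base X) f0 (Cmp C (Base X) (Base Y) (Base B) g0 (Cmp C (Base X) (Base B) (Base Y) k f0))"
    using rel_at_precomp[OF pseudocongruence_parallel[OF O(4)] _ _ premorphism_hom[OF f0(1)] k(2)]
      rel_at_precomp[OF pseudocongruence_parallel[OF O(4)] _ _ premorphism_hom[OF f0(1)] k(3)]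
    by (simp_all add: comp_assoc comp_id_left)
  then have "Cmp ?E ?Z X B f ?a = Cmp ?E ?Z Y B g ?b"
    using premorphism_comp[OF Z O(3,4) kf g0(1)] premorphism_comp[OF Z O(2,4) i f0(1)]
    by (simp add: Cmp_ex f0 g0 i kf Z O pc_class_eq_iff comp_id_right)
  moreover have "bij_betw (\<lambda>x. (Cmp ?E ?Z P X p x, Cmp ?E ?Z P Y q x)) (Hom ?E ?Z P)
      {(a, b). a \<in> Hom ?E ?Z X \<and> b \<in> Hom ?E ?Z Y \<and> Cmp ?E ?Z X B f a = Cmp ?E ?Z Y B g b}"
    using pb Z by (simp add: is_pullback_def poset_pullback_def poset_iso_def Obj_ex)
  ultimately obtain w where w: "w \<in> Hom ?E ?Z P" "Cmp ?E ?Z P X p w = ?a"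
    using pc_class_Hom[OF i] pc_class_Hom[OF kf] unfolding bij_betw_def
    by (smt (verit) Pair_inject image_iff mem_Collect_eq case_prodI)
  obtain w0 where w0: "w0 \<in> pc_premorphisms C ?Z P" "w = pc_class C ?Z P w0" using w(1) by (rule Hom_exE)
  have "rel_at C X (Base X) (Cmp C (Base X) (Base P) (Base X) p0 w0) (Idt C (Base X)) \<and>
    rel_at C X (Base X) (Idt C (Base X)) (Cmp C (Base X) (Base P) (Base X) p0 w0)"
    using w(2) premorphism_comp[OF Z O(1,2) w0(1) p0(1)]
    by (simp add: w0 p0 Cmp_ex Z O pc_class_eq_iff i)
  then show ?thesis
    using so_morphism_exI[OF O(1,2) p0(1), of w0] premorphism_hom[OF w0(1)] p0(2) by auto
qed

end

section \<open>Weighted limits as solutions of systems\<close>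

context pos_category
begin

lemma weakly_represents_cong:
  assumes "weakly_represents I V L p \<phi>"
    "\<And>A x. \<lbrakk>A \<in> Obj C; \<And>i. i \<in> I \<Longrightarrow> x i \<in> Hom C A (V i)\<rbrakk> \<Longrightarrow> \<phi> A x \<longleftrightarrow> \<psi> A x"
  shows "weakly_represents I V L p \<psi>"
  using assms by (simp add: weakly_represents_def)

text \<open>Writing naturality as two inequalities, and monotonicity as the case \<open>e = id\<close>, makes the
  cylinders on \<open>D0\<close> the solutions of a system of inequalities.\<close>
definition cylinder_on ::
  "('d, 'e) pcat \<Rightarrow> ('d, 'e, 'w) to_pos \<Rightarrow> ('d, 'e, 'o, 'm) pfunctor \<Rightarrow> 'd set \<Rightarrow> 'o \<Rightarrow>
   ('d \<times> 'w \<Rightarrow> 'm) \<Rightarrow> bool" where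
  "cylinder_on D W F D0 A x \<longleftrightarrow>
    (\<forall>a\<in>D0. \<forall>b\<in>D0. \<forall>e\<in>Hom D a b. \<forall>w\<in>PSet W a. \<forall>w'\<in>PSet W b.
      (PLe W b (PMap W a b e w) w' \<longrightarrow>
        Le C A (FObj F b) (Cmp C A (FObj F a) (FObj F b) (FMap F a b e) (x (a, w))) (x (b, w'))) \<and>
      (PLe W b w' (PMap W a b e w) \<longrightarrow>
        Le C A (FObj F b) (x (b, w')) (Cmp C A (FObj F a) (FObj F b) (FMap F a b e) (x (a, w)))))"

lemma cylinder_on_iff:
  assumes F: "pos_functor D C F" and W: "pos_valued_functor D W" and D0: "D0 \<subseteq> Obj D"
    and A: "A \<in> Obj C" and x: "\<And>a w. \<lbrakk>a \<in> D0; w \<in> PSet W a\<rbrakk> \<Longrightarrow> x (a, w) \<in> Hom C A (FObj F a)"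
  shows "cylinder_on D W F D0 A x \<longleftrightarrow>
    (\<forall>a\<in>D0. \<forall>w\<in>PSet W a. \<forall>w'\<in>PSet W a. PLe W a w w' \<longrightarrow> Le C A (FObj F a) (x (a, w)) (x (a, w'))) \<and>
    (\<forall>a\<in>D0. \<forall>b\<in>D0. \<forall>e\<in>Hom D a b. \<forall>w\<in>PSet W a.
      x (b, PMap W a b e w) = Cmp C A (FObj F a) (FObj F b) (FMap F a b e) (x (a, w)))"
    (is "?l \<longleftrightarrow> ?m \<and> ?n")
proof -
  interpret F: pos_functor D C F by (rule F)
  interpret W: pos_valued_functor D W by (rule W)
  have refl: "PLe W a w w" if "a \<in> Obj D" "w \<in> PSet W a" for a w
    using W.val_poset[OF that(1)] that(2) by (auto simp: poset_on_def reflp_on_def)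
  show ?thesis
  proof
    assume l: ?l
    have ?n
    proof (intro ballI)
      fix a b e w assume h: "a \<in> D0" "b \<in> D0" "e \<in> Hom D a b" "w \<in> PSet W a"
      then have o: "a \<in> Obj D" "b \<in> Obj D" using D0 by auto
      have w': "PMap W a b e w \<in> PSet W b" using o h by (intro W.val_map)
      show "x (b, PMap W a b e w) = Cmp C A (FObj F a) (FObj F b) (FMap F a b e) (x (a, w))"
        using l h w' refl[OF o(2) w'] unfolding cylinder_on_def
        by (intro Le_antisym[of A "FObj F b"] comp_hom F.fmap_hom F.fobj x A o) auto
    qed
    moreover have ?m
    proof (intro ballI impI)
      fix a w w' assume h: "a \<in> D0" "w \<in> PSet W a" "w' \<in> PSet W a" "PLe W a w w'"
      then have o: "a \<in> Obj D" using D0 by auto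
      have "Le C A (FObj F a) (Cmp C A (FObj F a) (FObj F a) (FMap F a a (Idt D a)) (x (a, w))) (x (a, w'))"
        using l h o F.dom.id_hom[OF o] unfolding cylinder_on_def by (auto simp: W.val_id)
      then show "Le C A (FObj F a) (x (a, w)) (x (a, w'))"
        using o h x A by (simp add: F.fmap_id comp_id_left F.fobj)
    qed
    ultimately show "?m \<and> ?n" by blast
  next
    assume r: "?m \<and> ?n"
    show ?l unfolding cylinder_on_def
    proof (intro ballI)
      fix a b e w w' assume h: "a \<in> D0" "b \<in> D0" "e \<in> Hom D a b" "w \<in> PSet W a" "w' \<in> PSet W b"
      then have "PMap W a b e w \<in> PSet W b" using D0 by (intro W.val_map) auto
      moreover have eq: "Cmp C A (FObj F a) (FObj F b) (FMap F a b e) (x (a, w)) = x (b, PMap W a b e w)"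
        using r h by simp
      ultimately show "(PLe W b (PMap W a b e w) w' \<longrightarrow>
        Le C A (FObj F b) (Cmp C A (FObj F a) (FObj F b) (FMap F a b e) (x (a, w))) (x (b, w'))) \<and>
      (PLe W b w' (PMap W a b e w) \<longrightarrow>
        Le C A (FObj F b) (x (b, w')) (Cmp C A (FObj F a) (FObj F b) (FMap F a b e) (x (a, w))))"
        unfolding eq using r h by blast
    qed
  qed
qed

text \<open>A finite weight may have infinitely many objects, so the system is written on
  representatives \<open>D0\<close> only. Cylinders on \<open>D0\<close> extend uniquely along
  chosen isomorphisms \<open>u d\<close> from \<open>d\<close> to \<open>r d\<close> with inverse
  \<open>v d\<close>. The hypothesis \<open>mono\<close> turns the weak representation into a limit:
  it makes the comparison reflect the order.\<close>

lemma limit_from_skeleton: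
  assumes F: "pos_functor D C F" and W: "pos_valued_functor D W" and D0: "D0 \<subseteq> Obj D"
    and iso: "\<And>d. d \<in> Obj D \<Longrightarrow> \<exists>d'\<in>D0. isomorphic D d d'"
    and rep: "weakly_represents (SIGMA d:D0. PSet W d) (\<lambda>(d, w). FObj F d) L p (cylinder_on D W F D0)"
    and mono: "\<And>A h h'. \<lbrakk>A \<in> Obj C; h \<in> Hom C A L; h' \<in> Hom C A L;
      \<And>d w. \<lbrakk>d \<in> D0; w \<in> PSet W d\<rbrakk> \<Longrightarrow>
        Le C A (FObj F d) (Cmp C A L (FObj F d) (p (d, w)) h) (Cmp C A L (FObj F d) (p (d, w)) h')\<rbrakk>
      \<Longrightarrow> Le C A L h h'"
  shows "\<exists>\<phi>. is_limit D W C F L \<phi>"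
proof -
  interpret F: pos_functor D C F by (rule F)
  interpret W: pos_valued_functor D W by (rule W)
  have "\<forall>d\<in>Obj D. \<exists>t. fst t \<in> D0 \<and> fst (snd t) \<in> Hom D d (fst t) \<and> snd (snd t) \<in> Hom D (fst t) d \<and>
      Cmp D d (fst t) d (snd (snd t)) (fst (snd t)) = Idt D d \<and>
      Cmp D (fst t) d (fst t) (fst (snd t)) (snd (snd t)) = Idt D (fst t)"
    using iso unfolding isomorphic_def by fastforce
  from bchoice[OF this] obtain t where t: "\<And>d. d \<in> Obj D \<Longrightarrow> fst (t d) \<in> D0 \<and>
      fst (snd (t d)) \<in> Hom D d (fst (t d)) \<and> snd (snd (t d)) \<in> Hom D (fst (t d)) d \<and>
      Cmp D d (fst (t d)) d (snd (snd (t d))) (fst (snd (t d))) = Idt D d"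
    by blast
  define r where "r d = fst (t d)" for d
  define u where "u d = fst (snd (t d))" for d
  define v where "v d = snd (snd (t d))" for d
  have r0: "r d \<in> D0" and r: "r d \<in> Obj D" and u: "u d \<in> Hom D d (r d)" and v: "v d \<in> Hom D (r d) d"
    and vu: "Cmp D d (r d) d (v d) (u d) = Idt D d" if "d \<in> Obj D" for d
    using t[OF that] D0 by (auto simp: r_def u_def v_def)
  have L: "L \<in> Obj C" by (rule weakly_representsD(1)[OF rep])
  have p: "p (d, w) \<in> Hom C L (FObj F d)" if "d \<in> D0" "w \<in> PSet W d" for d w
    using weakly_representsD(2)[OF rep, of "(d, w)"] that by simp
  have sol: "cylinder_on D W F D0 A x \<longleftrightarrow>
      (\<exists>h\<in>Hom C A L. \<forall>d\<in>D0. \<forall>w\<in>PSet W d. x (d, w) = Cmp C A L (FObj F d) (p (d, w)) h)"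
    if "A \<in> Obj C" "\<And>d w. \<lbrakk>d \<in> D0; w \<in> PSet W d\<rbrakk> \<Longrightarrow> x (d, w) \<in> Hom C A (FObj F d)" for A x
    using weakly_representsD(3)[OF rep, of A x] that by (auto simp: split_paired_all)
  have "cylinder_on D W F D0 L p"
    using sol[OF L p] id_hom[OF L] comp_id_right[OF L _ p] F.fobj D0 by (metis subsetD)
  then have pmn: "(\<forall>a\<in>D0. \<forall>w\<in>PSet W a. \<forall>w'\<in>PSet W a. PLe W a w w' \<longrightarrow>
        Le C L (FObj F a) (p (a, w)) (p (a, w'))) \<and>
      (\<forall>a\<in>D0. \<forall>b\<in>D0. \<forall>e\<in>Hom D a b. \<forall>w\<in>PSet W a.
        p (b, PMap W a b e w) = Cmp C L (FObj F a) (FObj F b) (FMap F a b e) (p (a, w)))"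
    using cylinder_on_iff[OF F W D0 L p] by blast
  have pm: "Le C L (FObj F d) (p (d, w)) (p (d, w'))"
    if "d \<in> D0" "w \<in> PSet W d" "w' \<in> PSet W d" "PLe W d w w'" for d w w'
    using that pmn by blast
  have pn: "p (b, PMap W a b e w) = Cmp C L (FObj F a) (FObj F b) (FMap F a b e) (p (a, w))"
    if "a \<in> D0" "b \<in> D0" "e \<in> Hom D a b" "w \<in> PSet W a" for a b e w
    using that pmn by blast
  \<comment> \<open>The value forced by naturality: carry \<open>w\<close> to the representative
    along \<open>u d\<close>, evaluate there, and come back along \<open>v d\<close>.\<close>
  define \<psi> where "\<psi> d w = Cmp C L (FObj F (r d)) (FObj F d) (FMap F (r d) d (v d)) (p (r d, PMap W d (r d) (u d) w))" for d w
  have Wu: "PMap W d (r d) (u d) w \<in> PSet W (r d)" if "d \<in> Obj D" "w \<in> PSet W d" for d w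
    using that r u by (intro W.val_map)
  have \<psi>h: "\<psi> d w \<in> Hom C L (FObj F d)" if "d \<in> Obj D" "w \<in> PSet W d" for d w
    unfolding \<psi>_def using that by (intro comp_hom F.fmap_hom F.fobj p L r r0 v Wu)
  \<comment> \<open>For \<open>d\<close> in \<open>D0\<close> the chosen \<open>r d\<close> may
    still differ from \<open>d\<close>; naturality of \<open>p\<close> along \<open>v d\<close>
    shows that the extension agrees with \<open>p\<close> all the same.\<close>
  have \<psi>p: "\<psi> d w = p (d, w)" if d: "d \<in> D0" and w: "w \<in> PSet W d" for d w
  proof -
    have o: "d \<in> Obj D" using d D0 by auto
    have "\<psi> d w = p (d, PMap W (r d) d (v d) (PMap W d (r d) (u d) w))"
      unfolding \<psi>_def by (rule pn[symmetric]) (use o d w r0 v Wu in auto)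
    also have "PMap W (r d) d (v d) (PMap W d (r d) (u d) w) = w"
      using W.val_comp[OF o r[OF o] o u[OF o] v[OF o] w] W.val_id[OF o w] vu[OF o] by simp
    finally show ?thesis .
  qed
  have \<psi>m: "Le C L (FObj F d) (\<psi> d w) (\<psi> d w')"
    if d: "d \<in> Obj D" and w: "w \<in> PSet W d" "w' \<in> PSet W d" "PLe W d w w'" for d w w'
    unfolding \<psi>_def using d w
    by (intro comp_mono_right pm W.val_map_mono F.fobj F.fmap_hom p L r r0 u v Wu)
  have \<psi>n: "\<psi> b (PMap W a b e w) = Cmp C L (FObj F a) (FObj F b) (FMap F a b e) (\<psi> a w)"
    if ab: "a \<in> Obj D" "b \<in> Obj D" and e: "e \<in> Hom D a b" and w: "w \<in> PSet W a" for a b e w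
  proof -
    note o = ab r[OF ab(1)] r[OF ab(2)]
    let ?ve = "Cmp D (r a) a b e (v a)"
    \<comment> \<open>The arrow \<open>e\<close> conjugated to one between representatives, where
      naturality of \<open>p\<close> is available.\<close>
    let ?e' = "Cmp D (r a) b (r b) (u b) ?ve"
    have ve: "?ve \<in> Hom D (r a) b" by (rule F.dom.comp_hom[OF o(3,1,2) v[OF o(1)] e])
    have e': "?e' \<in> Hom D (r a) (r b)" by (rule F.dom.comp_hom[OF o(3,2,4) ve u[OF o(2)]])
    have w1: "PMap W (r a) a (v a) (PMap W a (r a) (u a) w) = w"
      using W.val_comp[OF o(1,3,1) u[OF o(1)] v[OF o(1)] w] W.val_id[OF o(1) w] vu[OF o(1)] by simp
    have "PMap W (r a) (r b) ?e' (PMap W a (r a) (u a) w) = PMap W b (r b) (u b) (PMap W a b e w)"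
      using W.val_comp[OF o(3,2,4) ve u[OF o(2)] Wu[OF o(1) w]]
        W.val_comp[OF o(3,1,2) v[OF o(1)] e Wu[OF o(1) w]] w1 by simp
    then have 1: "p (r b, PMap W b (r b) (u b) (PMap W a b e w)) =
        Cmp C L (FObj F (r a)) (FObj F (r b)) (FMap F (r a) (r b) ?e') (p (r a, PMap W a (r a) (u a) w))"
      using pn[OF r0[OF o(1)] r0[OF o(2)] e' Wu[OF o(1) w]] by simp
    have "Cmp D (r a) (r b) b (v b) ?e' = ?ve"
      using F.dom.comp_assoc[OF o(3,2,4,2) ve u[OF o(2)] v[OF o(2)]] vu[OF o(2)]
        F.dom.comp_id_left[OF o(3,2) ve] by simp
    then have 2: "Cmp C (FObj F (r a)) (FObj F (r b)) (FObj F b) (FMap F (r b) b (v b)) (FMap F (r a) (r b) ?e') =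
        Cmp C (FObj F (r a)) (FObj F a) (FObj F b) (FMap F a b e) (FMap F (r a) a (v a))"
      using F.fmap_comp[OF o(3,4,2) e' v[OF o(2)]] F.fmap_comp[OF o(3,1,2) v[OF o(1)] e] by simp
    note h = p[OF r0[OF o(1)] Wu[OF o(1) w]]
    show ?thesis
      unfolding \<psi>_def 1
      using comp_assoc[OF L F.fobj[OF o(3)] F.fobj[OF o(4)] F.fobj[OF o(2)] h
            F.fmap_hom[OF o(3,4) e'] F.fmap_hom[OF o(4,2) v[OF o(2)]]]
          comp_assoc[OF L F.fobj[OF o(3)] F.fobj[OF o(1)] F.fobj[OF o(2)] h
            F.fmap_hom[OF o(3,1) v[OF o(1)]] F.fmap_hom[OF o(1,2) e]] 2
      by simp
  qed
  let ?\<phi> = "\<lambda>X. cylinder_comp D W C F X L \<psi>"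
  have val: "?\<phi> X h d w = Cmp C X L (FObj F d) (\<psi> d w) h" if "d \<in> Obj D" "w \<in> PSet W d" for X h d w
    using that by (simp add: cylinder_comp_def)
  have "is_limit D W C F L ?\<phi>"
    unfolding is_limit_def
  proof (intro conjI ballI)
    show "L \<in> Obj C" by (rule L)
    fix X assume X: "X \<in> Obj C"
    show "poset_iso (Hom C X L) (Le C X L)
        (nat_trans D W (hom_functor C X F)) (nat_trans_le D W (hom_functor C X F)) (?\<phi> X)"
    proof (rule poset_isoI)
      show "poset_on (Hom C X L) (Le C X L)" by (rule hom_poset[OF X L])
    next
      fix h assume h: "h \<in> Hom C X L"
      show "?\<phi> X h \<in> nat_trans D W (hom_functor C X F)"
        unfolding nat_trans_def
      proof (intro CollectI conjI ballI allI impI)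
        fix d w assume "\<not> (d \<in> Obj D \<and> w \<in> PSet W d)"
        then show "?\<phi> X h d w = undefined" by (auto simp: cylinder_comp_def)
      next
        fix d w assume "d \<in> Obj D" "w \<in> PSet W d"
        then show "?\<phi> X h d w \<in> PSet (hom_functor C X F) d"
          using X L h \<psi>h by (auto simp: val hom_functor_def intro!: comp_hom F.fobj)
      next
        fix d w w' assume "d \<in> Obj D" "w \<in> PSet W d" "w' \<in> PSet W d" "PLe W d w w'"
        then show "PLe (hom_functor C X F) d (?\<phi> X h d w) (?\<phi> X h d w')"
          using X L h \<psi>h by (auto simp: val hom_functor_def intro!: comp_mono_left \<psi>m F.fobj)
      next
        fix a b e w assume ab: "a \<in> Obj D" "b \<in> Obj D" "e \<in> Hom D a b" "w \<in> PSet W a"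
        then show "?\<phi> X h b (PMap W a b e w) = PMap (hom_functor C X F) a b e (?\<phi> X h a w)"
          using W.val_map[OF ab] X L h
          by (simp add: val hom_functor_def \<psi>n comp_assoc \<psi>h F.fobj F.fmap_hom)
      qed
    next
      fix \<alpha> assume \<alpha>: "\<alpha> \<in> nat_trans D W (hom_functor C X F)"
      have \<alpha>h: "\<alpha> d w \<in> Hom C X (FObj F d)" if "d \<in> Obj D" "w \<in> PSet W d" for d w
        using \<alpha> that by (simp add: nat_trans_def hom_functor_def)
      have \<alpha>m: "Le C X (FObj F d) (\<alpha> d w) (\<alpha> d w')"
        if "d \<in> Obj D" "w \<in> PSet W d" "w' \<in> PSet W d" "PLe W d w w'" for d w w'
        using \<alpha> that by (simp add: nat_trans_def hom_functor_def)
      have \<alpha>n: "\<alpha> b (PMap W a b e w) = Cmp C X (FObj F a) (FObj F b) (FMap F a b e) (\<alpha> a w)"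
        if "a \<in> Obj D" "b \<in> Obj D" "e \<in> Hom D a b" "w \<in> PSet W a" for a b e w
        using \<alpha> that by (simp add: nat_trans_def hom_functor_def)
      have "cylinder_on D W F D0 X (\<lambda>(d, w). \<alpha> d w)"
        by (subst cylinder_on_iff[OF F W D0 X]) (use D0 \<alpha>h \<alpha>m \<alpha>n in \<open>auto dest!: subsetD[OF D0]\<close>)
      moreover have "(\<lambda>(d, w). \<alpha> d w) (d, w) \<in> Hom C X (FObj F d)" if "d \<in> D0" "w \<in> PSet W d" for d w
        using that D0 \<alpha>h by auto
      ultimately obtain h where h: "h \<in> Hom C X L"
        and \<alpha>0: "\<And>d w. d \<in> D0 \<Longrightarrow> w \<in> PSet W d \<Longrightarrow> \<alpha> d w = Cmp C X L (FObj F d) (p (d, w)) h"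
        using sol[OF X, of "\<lambda>(d, w). \<alpha> d w"] by auto
      have "?\<phi> X h d w = \<alpha> d w" for d w
      proof (cases "d \<in> Obj D \<and> w \<in> PSet W d")
        case True
        then have o: "d \<in> Obj D" "r d \<in> Obj D" and w: "w \<in> PSet W d" using r by auto
        let ?w = "PMap W d (r d) (u d) w"
        have "\<alpha> d (PMap W (r d) d (v d) ?w) =
            Cmp C X (FObj F (r d)) (FObj F d) (FMap F (r d) d (v d)) (\<alpha> (r d) ?w)"
          by (rule \<alpha>n[OF o(2,1) v[OF o(1)] Wu[OF o(1) w]])
        moreover have "PMap W (r d) d (v d) ?w = w"
          using W.val_comp[OF o o(1) u[OF o(1)] v[OF o(1)] w] W.val_id[OF o(1) w] vu[OF o(1)] by simp
        ultimately have "\<alpha> d w = Cmp C X (FObj F (r d)) (FObj F d) (FMap F (r d) d (v d))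
            (Cmp C X L (FObj F (r d)) (p (r d, ?w)) h)"
          using \<alpha>0[OF r0[OF o(1)] Wu[OF o(1) w]] by simp
        then show ?thesis
          using comp_assoc[OF X L F.fobj[OF o(2)] F.fobj[OF o(1)] h p[OF r0[OF o(1)] Wu[OF o(1) w]]
              F.fmap_hom[OF o(2,1) v[OF o(1)]]] o w
          by (simp add: val \<psi>_def)
      next
        case False
        then show ?thesis using \<alpha> by (auto simp: cylinder_comp_def nat_trans_def)
      qed
      then show "\<exists>h\<in>Hom C X L. ?\<phi> X h = \<alpha>" using h by blast
    next
      fix h h' assume h: "h \<in> Hom C X L" "h' \<in> Hom C X L"
      show "Le C X L h h' \<longleftrightarrow> nat_trans_le D W (hom_functor C X F) (?\<phi> X h) (?\<phi> X h')"
      proof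
        assume "Le C X L h h'"
        then show "nat_trans_le D W (hom_functor C X F) (?\<phi> X h) (?\<phi> X h')"
          using X L h \<psi>h
          by (auto simp: nat_trans_le_def hom_functor_def val intro!: comp_mono_right F.fobj)
      next
        assume n: "nat_trans_le D W (hom_functor C X F) (?\<phi> X h) (?\<phi> X h')"
        show "Le C X L h h'"
        proof (rule mono[OF X h])
          fix d w assume d: "d \<in> D0" "w \<in> PSet W d"
          then have "d \<in> Obj D" using D0 by auto
          then show "Le C X (FObj F d) (Cmp C X L (FObj F d) (p (d, w)) h) (Cmp C X L (FObj F d) (p (d, w)) h')"
            using n d by (auto simp: nat_trans_le_def hom_functor_def val \<psi>p)
        qed
      qed
    qed
  next
    fix X Y h k assume X: "X \<in> Obj C" and Y: "Y \<in> Obj C" and h: "h \<in> Hom C X Y" "k \<in> Hom C Y L"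
    show "?\<phi> X (Cmp C X Y L k h) = cylinder_comp D W C F X Y (?\<phi> Y k) h"
      by (intro ext) (use X Y L h \<psi>h in \<open>auto simp: cylinder_comp_def comp_assoc F.fobj\<close>)
  qed
  then show ?thesis by blast
qed

lemma finite_skeleton:
  assumes "finite_weight D W" and D: "pos_category D"
  obtains D0 where "finite D0" "D0 \<subseteq> Obj D" "\<And>d. d \<in> Obj D \<Longrightarrow> \<exists>d'\<in>D0. isomorphic D d d'"
proof -
  let ?r = "{(a, b). a \<in> Obj D \<and> b \<in> Obj D \<and> isomorphic D a b}"
  let ?D0 = "(\<lambda>Q. SOME x. x \<in> Q) ` (Obj D // ?r)"
  have "finite ?D0" using assms by (simp add: finite_weight_def)
  have c: "(SOME x. x \<in> ?r `` {d}) \<in> ?r `` {d}" if d: "d \<in> Obj D" for d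
  proof -
    have "Idt D d \<in> Hom D d d" "Cmp D d d d (Idt D d) (Idt D d) = Idt D d"
      using D d by (auto simp: pos_category.id_hom pos_category.comp_id_left)
    then have "d \<in> ?r `` {d}" using d by (auto simp: isomorphic_def)
    then show ?thesis by (rule someI)
  qed
  show thesis
  proof (rule that[of ?D0])
    show "?D0 \<subseteq> Obj D" using c by (auto simp: quotient_def)
    fix d assume d: "d \<in> Obj D"
    have "(SOME x. x \<in> ?r `` {d}) \<in> ?D0" using d by (intro imageI quotientI)
    then show "\<exists>d'\<in>?D0. isomorphic D d d'" using c[OF d] by blast
  qed fact
qed

end

section \<open>Regularity and exactness of the completion\<close>

context weakly_lex_category
begin

section \<open>Finite limits in the completion\<close>

lemma Hom_ex_rep:
  "F \<in> Hom (ex_completion C) S T \<Longrightarrow> \<exists>f. f \<in> pc_premorphisms C S T \<and> F = pc_class C S T f"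
  by (blast elim: Hom_exE)

text \<open>The base \<open>X\<close> of \<open>L\<close> is a weak solution in \<open>C\<close> of
  the system for representatives, with the preorder that compares all components. For this preorder
  a morphism into \<open>X\<close> preserves relations as soon as its components do, and the
  components determine it up to equivalence. The second conjunct is this joint order-monicity, which
  the weak solution in \<open>C\<close> does not provide.\<close>

lemma ex_system:
  fixes I :: "'i set" and K :: "'k set"
  assumes I: "finite I" and K: "finite K" and V: "\<And>i. i \<in> I \<Longrightarrow> V i \<in> Obj (ex_completion C)"
    and kK: "\<And>k. k \<in> K \<Longrightarrow> s k \<in> I \<and> t k \<in> I \<and> Z k \<in> Obj (ex_completion C) \<and>
      f k \<in> Hom (ex_completion C) (V (s k)) (Z k) \<and> g k \<in> Hom (ex_completion C) (V (t k)) (Z k)"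
  shows "\<exists>L p. ex.weakly_represents I V L p (\<lambda>A x.
      \<forall>k\<in>K. Le (ex_completion C) A (Z k) (Cmp (ex_completion C) A (V (s k)) (Z k) (f k) (x (s k)))
                       (Cmp (ex_completion C) A (V (t k)) (Z k) (g k) (x (t k)))) \<and>
    (\<forall>A\<in>Obj (ex_completion C). \<forall>h\<in>Hom (ex_completion C) A L. \<forall>h'\<in>Hom (ex_completion C) A L.
      (\<forall>i\<in>I. Le (ex_completion C) A (V i) (Cmp (ex_completion C) A L (V i) (p i) h)
         (Cmp (ex_completion C) A L (V i) (p i) h')) \<longrightarrow> Le (ex_completion C) A L h h')"
proof -
  let ?E = "ex_completion C"
  have Vp: "pseudocongruence C (V i)" if "i \<in> I" for i using V that by (simp add: Obj_ex)
  have Zp: "pseudocongruence C (Z k)" if "k \<in> K" for k using kK that by (simp add: Obj_ex)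
  have st: "s k \<in> I" "t k \<in> I" if "k \<in> K" for k using kK that by auto
  have "\<forall>k\<in>K. \<exists>f0. f0 \<in> pc_premorphisms C (V (s k)) (Z k) \<and> f k = pc_class C (V (s k)) (Z k) f0"
    by (intro ballI Hom_ex_rep) (simp add: kK)
  from bchoice[OF this] obtain f0 where f0: "\<And>k. k \<in> K \<Longrightarrow> f0 k \<in> pc_premorphisms C (V (s k)) (Z k)"
      "\<And>k. k \<in> K \<Longrightarrow> f k = pc_class C (V (s k)) (Z k) (f0 k)"
    by blast
  have "\<forall>k\<in>K. \<exists>g0. g0 \<in> pc_premorphisms C (V (t k)) (Z k) \<and> g k = pc_class C (V (t k)) (Z k) g0"
    by (intro ballI Hom_ex_rep) (simp add: kK)
  from bchoice[OF this] obtain g0 where g0: "\<And>k. k \<in> K \<Longrightarrow> g0 k \<in> pc_premorphisms C (V (t k)) (Z k)"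
      "\<And>k. k \<in> K \<Longrightarrow> g k = pc_class C (V (t k)) (Z k) (g0 k)"
    by blast
  have "\<exists>L p. weakly_represents I (\<lambda>i. Base (V i)) L p (\<lambda>A x.
    \<forall>k\<in>K. rel_at C (Z k) A (Cmp C A (Base (V (s k))) (Base (Z k)) (f0 k) (x (s k)))
                            (Cmp C A (Base (V (t k))) (Base (Z k)) (g0 k) (x (t k))))"
    by (rule weak_solution_rel[of I K "\<lambda>i. Base (V i)" s t Z f0 g0])
      (simp_all add: I K Vp Zp st pseudocongruence_Base pseudocongruence_parallel
        f0 g0 premorphism_hom)
  then obtain X p where Xp: "weakly_represents I (\<lambda>i. Base (V i)) X p (\<lambda>A x.
    \<forall>k\<in>K. rel_at C (Z k) A (Cmp C A (Base (V (s k))) (Base (Z k)) (f0 k) (x (s k)))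
                            (Cmp C A (Base (V (t k))) (Base (Z k)) (g0 k) (x (t k))))"
    by (elim exE)
  note X = weakly_representsD(1)[OF Xp] and p = weakly_representsD(2)[OF Xp]
    and u = weakly_representsD(3)[OF Xp]
  \<comment> \<open>A second system, with two unknowns into \<open>X\<close>, represents the
    componentwise preorder; \<open>False\<close> marks its lower and \<open>True\<close> its upper
    argument.\<close>
  have "\<exists>R r. weakly_represents (UNIV :: bool set) (\<lambda>_. X) R r (\<lambda>A x.
    \<forall>i\<in>I. rel_at C (V i) A (Cmp C A X (Base (V i)) (p i) (x False))
                            (Cmp C A X (Base (V i)) (p i) (x True)))"
    by (rule weak_solution_rel[of UNIV I "\<lambda>_. X" "\<lambda>_. False" "\<lambda>_. True" V p p])
      (simp_all add: I X p Vp pseudocongruence_parallel)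
  then obtain R r where Rr: "weakly_represents (UNIV :: bool set) (\<lambda>_. X) R r (\<lambda>A x.
    \<forall>i\<in>I. rel_at C (V i) A (Cmp C A X (Base (V i)) (p i) (x False))
                            (Cmp C A X (Base (V i)) (p i) (x True)))"
    by (elim exE)
  note R = weakly_representsD(1)[OF Rr] and r = weakly_representsD(2)[OF Rr UNIV_I]
    and w = weakly_representsD(3)[OF Rr]
  have "\<exists>L. pseudocongruence C L \<and> Base L = X \<and> (\<forall>A\<in>Obj C. \<forall>x\<in>Hom C A X. \<forall>y\<in>Hom C A X.
    rel_at C L A x y \<longleftrightarrow>
      (\<forall>i\<in>I. rel_at C (V i) A (Cmp C A X (Base (V i)) (p i) x) (Cmp C A X (Base (V i)) (p i) y)))"
  proof (rule pseudocongruence_exists[OF X R r[of False] r[of True]])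
    fix A x y assume A: "A \<in> Obj C" and x: "x \<in> Hom C A X" and y: "y \<in> Hom C A X"
    show "(\<forall>i\<in>I. rel_at C (V i) A (Cmp C A X (Base (V i)) (p i) x) (Cmp C A X (Base (V i)) (p i) y)) \<longleftrightarrow>
      (\<exists>h\<in>Hom C A R. x = Cmp C A R X (r False) h \<and> y = Cmp C A R X (r True) h)"
      using w[OF A, of "\<lambda>i. if i then y else x"] x y by (simp add: all_bool_eq conj_commute)
  next
    fix A x y assume "A \<in> Obj C" "x \<in> Hom C A X" "y \<in> Hom C A X" "Le C A X x y"
    then show "\<forall>i\<in>I. rel_at C (V i) A (Cmp C A X (Base (V i)) (p i) x) (Cmp C A X (Base (V i)) (p i) y)"
      using X p by (intro ballI rel_at_Le[OF Vp] comp_mono_right comp_hom pseudocongruence_Base[OF Vp])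
  qed (blast intro: rel_at_trans[OF Vp])
  then obtain L where L: "pseudocongruence C L" and BL[simp]: "Base L = X"
    and rL: "\<And>A x y. A \<in> Obj C \<Longrightarrow> x \<in> Hom C A X \<Longrightarrow> y \<in> Hom C A X \<Longrightarrow> rel_at C L A x y \<longleftrightarrow>
      (\<forall>i\<in>I. rel_at C (V i) A (Cmp C A X (Base (V i)) (p i) x) (Cmp C A X (Base (V i)) (p i) y))"
    by auto
  have pp: "p i \<in> pc_premorphisms C L (V i)" if "i \<in> I" for i
    by (rule premorphismI[OF L Vp[OF that]]) (use that p in \<open>auto simp: rL\<close>)
  define P where "P i = pc_class C L (V i) (p i)" for i
  have P: "P i \<in> Hom ?E L (V i)" if "i \<in> I" for i using pp[OF that] by (simp add: P_def pc_class_Hom)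
  have LE: "L \<in> Obj ?E" using L by (simp add: Obj_ex)
  let ?\<phi> = "\<lambda>A x. \<forall>k\<in>K. Le ?E A (Z k) (Cmp ?E A (V (s k)) (Z k) (f k) (x (s k)))
                       (Cmp ?E A (V (t k)) (Z k) (g k) (x (t k)))"
  have PK: "?\<phi> L P"
  proof
    fix k assume k: "k \<in> K"
    have "\<forall>k\<in>K. rel_at C (Z k) X (Cmp C X (Base (V (s k))) (Base (Z k)) (f0 k) (p (s k)))
                            (Cmp C X (Base (V (t k))) (Base (Z k)) (g0 k) (p (t k)))"
      using u[OF X p] X p comp_id_right[OF X _ p] pseudocongruence_Base[OF Vp] id_hom[OF X] by metis
    then show "Le ?E L (Z k) (Cmp ?E L (V (s k)) (Z k) (f k) (P (s k)))
                       (Cmp ?E L (V (t k)) (Z k) (g k) (P (t k)))"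
      using k premorphism_comp[OF L Vp[OF st(1)[OF k]] Zp[OF k] pp[OF st(1)[OF k]] f0(1)[OF k]]
        premorphism_comp[OF L Vp[OF st(2)[OF k]] Zp[OF k] pp[OF st(2)[OF k]] g0(1)[OF k]]
      by (simp add: P_def f0 g0 Cmp_ex L Vp Zp st pp Le_ex)
  qed
  have uni: "?\<phi> A x \<longleftrightarrow> (\<exists>h\<in>Hom ?E A L. \<forall>i\<in>I. x i = Cmp ?E A L (V i) (P i) h)"
    if AE: "A \<in> Obj ?E" and x: "\<And>i. i \<in> I \<Longrightarrow> x i \<in> Hom ?E A (V i)" for A x
  proof
    assume \<phi>: "?\<phi> A x"
    have A: "pseudocongruence C A" using AE by (simp add: Obj_ex)
    note BA = pseudocongruence_Base[OF A]
    have "\<forall>i\<in>I. \<exists>x0. x0 \<in> pc_premorphisms C A (V i) \<and> x i = pc_class C A (V i) x0"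
      by (intro ballI Hom_ex_rep) (simp add: x)
    from bchoice[OF this] obtain x0 where x0: "\<And>i. i \<in> I \<Longrightarrow> x0 i \<in> pc_premorphisms C A (V i)"
      "\<And>i. i \<in> I \<Longrightarrow> x i = pc_class C A (V i) (x0 i)"
      by blast
    have "\<forall>k\<in>K. rel_at C (Z k) (Base A) (Cmp C (Base A) (Base (V (s k))) (Base (Z k)) (f0 k) (x0 (s k)))
                            (Cmp C (Base A) (Base (V (t k))) (Base (Z k)) (g0 k) (x0 (t k)))"
    proof
      fix k assume k: "k \<in> K"
      show "rel_at C (Z k) (Base A) (Cmp C (Base A) (Base (V (s k))) (Base (Z k)) (f0 k) (x0 (s k)))
                            (Cmp C (Base A) (Base (V (t k))) (Base (Z k)) (g0 k) (x0 (t k)))"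
        using bspec[OF \<phi> k] k
          premorphism_comp[OF A Vp[OF st(1)[OF k]] Zp[OF k] x0(1)[OF st(1)[OF k]] f0(1)[OF k]]
          premorphism_comp[OF A Vp[OF st(2)[OF k]] Zp[OF k] x0(1)[OF st(2)[OF k]] g0(1)[OF k]]
        by (simp add: x0 f0 g0 Cmp_ex A Vp Zp st Le_ex)
    qed
    then obtain h where h: "h \<in> Hom C (Base A) X"
      and xh: "\<And>i. i \<in> I \<Longrightarrow> x0 i = Cmp C (Base A) X (Base (V i)) (p i) h"
      using u[OF BA, of x0] x0(1) by (auto simp: premorphism_hom)
    have ph: "h \<in> pc_premorphisms C A L"
    proof (rule premorphismI[OF A L])
      fix B x y assume B: "B \<in> Obj C" "x \<in> Hom C B (Base A)" "y \<in> Hom C B (Base A)" "rel_at C A B x y"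
      have "rel_at C (V i) B (Cmp C B X (Base (V i)) (p i) (Cmp C B (Base A) X h x))
          (Cmp C B X (Base (V i)) (p i) (Cmp C B (Base A) X h y))" if i: "i \<in> I" for i
        using premorphism_rel[OF x0(1)[OF i] A Vp[OF i] B(1,4)] X BA pseudocongruence_Base[OF Vp[OF i]] B p[OF i] h
        by (simp add: xh[OF i] comp_assoc)
      then show "rel_at C L B (Cmp C B (Base A) (Base L) h x) (Cmp C B (Base A) (Base L) h y)"
        using B X BA h by (simp add: rL comp_hom)
    qed (simp add: h)
    have "x i = Cmp ?E A L (V i) (P i) (pc_class C A L h)" if "i \<in> I" for i
      using that by (simp add: x0 P_def Cmp_ex A L Vp ph pp xh)
    then show "\<exists>h\<in>Hom ?E A L. \<forall>i\<in>I. x i = Cmp ?E A L (V i) (P i) h"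
      using pc_class_Hom[OF ph] by blast
  next
    assume "\<exists>h\<in>Hom ?E A L. \<forall>i\<in>I. x i = Cmp ?E A L (V i) (P i) h"
    then obtain h where h: "h \<in> Hom ?E A L" and xh: "\<And>i. i \<in> I \<Longrightarrow> x i = Cmp ?E A L (V i) (P i) h"
      by blast
    show "?\<phi> A x"
    proof
      fix k assume k: "k \<in> K"
      have ff: "Z k \<in> Obj ?E" "f k \<in> Hom ?E (V (s k)) (Z k)" "g k \<in> Hom ?E (V (t k)) (Z k)"
        "V (s k) \<in> Obj ?E" "V (t k) \<in> Obj ?E" "P (s k) \<in> Hom ?E L (V (s k))" "P (t k) \<in> Hom ?E L (V (t k))"
        using kK[OF k] V P by auto
      have "Le ?E A (Z k) (Cmp ?E A L (Z k) (Cmp ?E L (V (s k)) (Z k) (f k) (P (s k))) h)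
                       (Cmp ?E A L (Z k) (Cmp ?E L (V (t k)) (Z k) (g k) (P (t k))) h)"
        by (rule ex.comp_mono_left[OF bspec[OF PK k]]) (use AE LE ff h in \<open>auto intro!: ex.comp_hom\<close>)
      then show "Le ?E A (Z k) (Cmp ?E A (V (s k)) (Z k) (f k) (x (s k)))
                       (Cmp ?E A (V (t k)) (Z k) (g k) (x (t k)))"
        using AE LE ff h by (simp add: xh st k ex.comp_assoc)
    qed
  qed
  have mono: "Le ?E A L h h'"
    if AE: "A \<in> Obj ?E" and h: "h \<in> Hom ?E A L" "h' \<in> Hom ?E A L"
      and le: "\<forall>i\<in>I. Le ?E A (V i) (Cmp ?E A L (V i) (P i) h) (Cmp ?E A L (V i) (P i) h')" for A h h'
  proof -
    have A: "pseudocongruence C A" using AE by (simp add: Obj_ex)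
    obtain h0 where h0: "h0 \<in> pc_premorphisms C A L" "h = pc_class C A L h0" using h(1) by (rule Hom_exE)
    obtain h1 where h1: "h1 \<in> pc_premorphisms C A L" "h' = pc_class C A L h1" using h(2) by (rule Hom_exE)
    have "rel_at C (V i) (Base A) (Cmp C (Base A) X (Base (V i)) (p i) h0)
        (Cmp C (Base A) X (Base (V i)) (p i) h1)" if i: "i \<in> I" for i
      using bspec[OF le i] premorphism_comp[OF A L Vp[OF i] h0(1) pp[OF i]]
        premorphism_comp[OF A L Vp[OF i] h1(1) pp[OF i]]
      by (simp add: P_def Cmp_ex A L Vp i pp h0 h1 Le_ex)
    then show ?thesis
      using premorphism_hom[OF h0(1)] premorphism_hom[OF h1(1)]
      by (simp add: h0 h1 Le_ex A L rL pseudocongruence_Base)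
  qed
  show ?thesis
    by (rule exI[of _ L], rule exI[of _ P]) (use LE P uni mono in \<open>auto simp: ex.weakly_represents_def\<close>)
qed

text \<open>The types of the weight are arbitrary because it enters only through the finite index
  sets of a system, and \<open>weak_solution\<close> has already reduced such sets to
  \<open>nat\<close>.\<close>

lemma ex_finite_limits:
  "has_finite_limits TYPE('d) TYPE('e) TYPE('w) (ex_completion C)"
  unfolding has_finite_limits_def
proof (intro allI impI, elim conjE)
  fix D :: "('d, 'e) pcat" and W :: "('d, 'e, 'w) to_pos"
    and F :: "('d, 'e, ('o, 'm) parallel_pair, 'm set) pfunctor"
  assume F: "pos_functor D (ex_completion C) F" and W: "pos_valued_functor D W" and fin: "finite_weight D W"
  let ?E = "ex_completion C"
  interpret F: pos_functor D ?E F by (rule F)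
  interpret W: pos_valued_functor D W by (rule W)
  obtain D0 where D0: "finite D0" "D0 \<subseteq> Obj D" and iso: "\<And>d. d \<in> Obj D \<Longrightarrow> \<exists>d'\<in>D0. isomorphic D d d'"
    using finite_skeleton[OF fin F.dom.pos_category_axioms] by blast
  let ?I = "SIGMA d:D0. PSet W d" and ?V = "\<lambda>(d, w). FObj F d"
  \<comment> \<open>An index stands for one inequality of \<open>cylinder_on\<close> whose premise
    holds. The boolean \<open>c\<close> tells which of the two implications it comes from, hence
    which side carries \<open>FMap\<close>; the other side gets an identity.\<close>
  define K where "K = {(a, b, e, w, w', c). a \<in> D0 \<and> b \<in> D0 \<and> e \<in> Hom D a b \<and> w \<in> PSet W a \<and>
    w' \<in> PSet W b \<and> (if c then PLe W b (PMap W a b e w) w' else PLe W b w' (PMap W a b e w))}"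
  define s where "s = (\<lambda>(a :: 'd, b :: 'd, e :: 'e, w :: 'w, w' :: 'w, c). if c then (a, w) else (b, w'))"
  define t where "t = (\<lambda>(a :: 'd, b :: 'd, e :: 'e, w :: 'w, w' :: 'w, c). if c then (b, w') else (a, w))"
  define Z where "Z = (\<lambda>(a :: 'd, b :: 'd, e :: 'e, w :: 'w, w' :: 'w, c :: bool). FObj F b)"
  define f where "f = (\<lambda>(a :: 'd, b :: 'd, e :: 'e, w :: 'w, w' :: 'w, c).
    if c then FMap F a b e else Idt ?E (FObj F b))"
  define g where "g = (\<lambda>(a :: 'd, b :: 'd, e :: 'e, w :: 'w, w' :: 'w, c).
    if c then Idt ?E (FObj F b) else FMap F a b e)"
  note defs = K_def s_def t_def Z_def f_def g_def
  let ?H = "\<Union>a\<in>D0. \<Union>b\<in>D0. Hom D a b" and ?U = "\<Union>a\<in>D0. PSet W a"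
  have PW: "finite (PSet W a)" and HD: "b \<in> D0 \<Longrightarrow> finite (Hom D a b)" if "a \<in> D0" for a b
    using fin that D0(2) by (auto simp: finite_weight_def)
  have "finite K"
    by (rule finite_subset[of _ "D0 \<times> D0 \<times> ?H \<times> ?U \<times> ?U \<times> UNIV"]) (use D0 PW HD in \<open>auto simp: K_def\<close>)
  moreover have "finite ?I" using D0 PW by auto
  moreover have FO: "FObj F d \<in> Obj ?E" if "d \<in> D0" for d using that D0 F.fobj by auto
  moreover have "s k \<in> ?I \<and> t k \<in> ?I \<and> Z k \<in> Obj ?E \<and>
      f k \<in> Hom ?E (?V (s k)) (Z k) \<and> g k \<in> Hom ?E (?V (t k)) (Z k)" if "k \<in> K" for k
    using that D0(2) by (auto simp: defs FO split: if_splits intro!: ex.id_hom F.fmap_hom)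
  ultimately have "\<exists>L p. ex.weakly_represents ?I ?V L p (\<lambda>A x.
      \<forall>k\<in>K. Le ?E A (Z k) (Cmp ?E A (?V (s k)) (Z k) (f k) (x (s k)))
                       (Cmp ?E A (?V (t k)) (Z k) (g k) (x (t k)))) \<and>
    (\<forall>A\<in>Obj ?E. \<forall>h\<in>Hom ?E A L. \<forall>h'\<in>Hom ?E A L.
      (\<forall>i\<in>?I. Le ?E A (?V i) (Cmp ?E A L (?V i) (p i) h) (Cmp ?E A L (?V i) (p i) h')) \<longrightarrow> Le ?E A L h h')"
    by (intro ex_system) auto
  then obtain L p where rep: "ex.weakly_represents ?I ?V L p (\<lambda>A x.
      \<forall>k\<in>K. Le ?E A (Z k) (Cmp ?E A (?V (s k)) (Z k) (f k) (x (s k)))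
                       (Cmp ?E A (?V (t k)) (Z k) (g k) (x (t k))))"
    and mono: "\<forall>A\<in>Obj ?E. \<forall>h\<in>Hom ?E A L. \<forall>h'\<in>Hom ?E A L.
      (\<forall>i\<in>?I. Le ?E A (?V i) (Cmp ?E A L (?V i) (p i) h) (Cmp ?E A L (?V i) (p i) h')) \<longrightarrow> Le ?E A L h h'"
    by (elim exE conjE)
  have "ex.weakly_represents ?I ?V L p (ex.cylinder_on D W F D0)"
  proof (rule ex.weakly_represents_cong[OF rep])
    fix A x assume A: "A \<in> Obj ?E" and "\<And>i. i \<in> ?I \<Longrightarrow> x i \<in> Hom ?E A (?V i)"
    then have x: "x (d, w) \<in> Hom ?E A (FObj F d)" if "d \<in> D0" "w \<in> PSet W d" for d w
      using that by fastforce
    have id: "Cmp ?E A (FObj F d) (FObj F d) (Idt ?E (FObj F d)) (x (d, w)) = x (d, w)"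
      if "d \<in> D0" "w \<in> PSet W d" for d w
      using A FO that x by (simp add: ex.comp_id_left)
    have "(\<forall>k\<in>K. Le ?E A (Z k) (Cmp ?E A (?V (s k)) (Z k) (f k) (x (s k)))
                       (Cmp ?E A (?V (t k)) (Z k) (g k) (x (t k)))) \<longleftrightarrow>
      (\<forall>a b e w w' c. (a, b, e, w, w', c) \<in> K \<longrightarrow>
        (if c then Le ?E A (FObj F b) (Cmp ?E A (FObj F a) (FObj F b) (FMap F a b e) (x (a, w))) (x (b, w'))
         else Le ?E A (FObj F b) (x (b, w')) (Cmp ?E A (FObj F a) (FObj F b) (FMap F a b e) (x (a, w)))))"
      by (auto simp: defs id)
    also have "\<dots> \<longleftrightarrow> ex.cylinder_on D W F D0 A x"
      by (simp add: ex.cylinder_on_def K_def all_bool_eq) blast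
    finally show "(\<forall>k\<in>K. Le ?E A (Z k) (Cmp ?E A (?V (s k)) (Z k) (f k) (x (s k)))
                       (Cmp ?E A (?V (t k)) (Z k) (g k) (x (t k)))) \<longleftrightarrow> ex.cylinder_on D W F D0 A x" .
  qed
  then have "\<exists>\<phi>. is_limit D W ?E F L \<phi>"
    using iso mono by (intro ex.limit_from_skeleton[OF F W D0(2)]) auto
  then show "\<exists>L \<phi>. is_limit D W ?E F L \<phi>" by blast
qed

section \<open>Regularity, and effectiveness of congruences\<close>

lemma ex_regular: "regular TYPE('d) TYPE('e) TYPE('w) (ex_completion C)"
  unfolding regular_def
proof (intro conjI ballI allI impI)
  fix S T F assume "S \<in> Obj (ex_completion C)" "T \<in> Obj (ex_completion C)" "F \<in> Hom (ex_completion C) S T"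
  then obtain f where S: "pseudocongruence C S" and T: "pseudocongruence C T"
    and f: "f \<in> pc_premorphisms C S T" "F = pc_class C S T f"
    by (auto simp: Obj_ex elim: Hom_exE)
  obtain I where I: "pseudocongruence C I" "Base I = Base S"
    "so_morphism (ex_completion C) S I (pc_class C S I (Idt C (Base S)))"
    "order_mono (ex_completion C) I T (pc_class C I T f)"
    and i: "f \<in> pc_premorphisms C I T" "Idt C (Base S) \<in> pc_premorphisms C S I"
    using ex_factorization[OF S T f(1)] by blast
  have "F = Cmp (ex_completion C) S I T (pc_class C I T f) (pc_class C S I (Idt C (Base S)))"
    by (simp add: Cmp_ex S I(1,2) T i f comp_id_right pseudocongruence_Base premorphism_hom[OF f(1)])
  then have "so_morphism (ex_completion C) S I (pc_class C S I (Idt C (Base S))) \<and>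
      order_mono (ex_completion C) I T (pc_class C I T f) \<and>
      F = Cmp (ex_completion C) S I T (pc_class C I T f) (pc_class C S I (Idt C (Base S)))"
    using I(3,4) by blast
  then show "\<exists>I\<in>Obj (ex_completion C). \<exists>e m. so_morphism (ex_completion C) S I e \<and>
      order_mono (ex_completion C) I T m \<and> F = Cmp (ex_completion C) S I T m e"
    using I(1) unfolding Obj_ex[symmetric] by blast
qed (use ex_category ex_finite_limits so_morphism_pullback_ex in blast)+

text \<open>A congruence \<open>(a, b): M \<rightarrow> X \<times> X\<close> is the kernel congruence of \<open>(X, R) \<rightarrow> (X, \<rho>)\<close>, where \<open>\<rho>(x, y)\<close>
  holds if \<open>R(x, a e)\<close> and \<open>R(b e, y)\<close> for some \<open>e\<close>.\<close>
lemma ex_effective: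
  assumes cong: "congruence (ex_completion C) X P p q M m"
  shows "effective (ex_completion C) X P p q M m"
proof -
  let ?E = "ex_completion C"
  have prod: "is_product ?E P X X p q" and ME: "M \<in> Obj ?E" and om: "order_mono ?E M P m"
    using cong by (auto simp: congruence_def)
  have E: "P \<in> Obj ?E" "X \<in> Obj ?E" "p \<in> Hom ?E P X" "q \<in> Hom ?E P X" "m \<in> Hom ?E M P"
    using prod om by (auto simp: is_product_def order_mono_def)
  have O: "pseudocongruence C P" "pseudocongruence C X" "pseudocongruence C M"
    using E ME by (auto simp: Obj_ex)
  obtain p0 where p0: "p0 \<in> pc_premorphisms C P X" "p = pc_class C P X p0" using E(3) by (rule Hom_exE)
  obtain q0 where q0: "q0 \<in> pc_premorphisms C P X" "q = pc_class C P X q0" using E(4) by (rule Hom_exE)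
  obtain m0 where m0: "m0 \<in> pc_premorphisms C M P" "m = pc_class C M P m0" using E(5) by (rule Hom_exE)
  note B[simp] = pseudocongruence_Base[OF O(1)] pseudocongruence_Base[OF O(2)] pseudocongruence_Base[OF O(3)]
  define a where "a = Cmp C (Base M) (Base P) (Base X) p0 m0"
  define b where "b = Cmp C (Base M) (Base P) (Base X) q0 m0"
  have pa: "a \<in> pc_premorphisms C M X" and pb: "b \<in> pc_premorphisms C M X"
    using premorphism_comp[OF O(3,1,2) m0(1)] p0 q0 by (auto simp: a_def b_def)
  have pm: "Cmp ?E M P X p m = pc_class C M X a" and qm: "Cmp ?E M P X q m = pc_class C M X b"
    by (simp_all add: p0 q0 m0 Cmp_ex O a_def b_def)
  note h[simp] = premorphism_hom[OF pa] premorphism_hom[OF pb]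
  have pair: "\<exists>k\<in>Hom ?E Z P. Cmp ?E Z P X p k = u \<and> Cmp ?E Z P X q k = v"
    if "Z \<in> Obj ?E" "u \<in> Hom ?E Z X" "v \<in> Hom ?E Z X" for Z u v
  proof -
    have "bij_betw (\<lambda>h. (Cmp ?E Z P X p h, Cmp ?E Z P X q h)) (Hom ?E Z P) (Hom ?E Z X \<times> Hom ?E Z X)"
      using prod that(1) by (auto simp: is_product_def poset_iso_def)
    then have "(u, v) \<in> (\<lambda>h. (Cmp ?E Z P X p h, Cmp ?E Z P X q h)) ` Hom ?E Z P"
      using that by (simp add: bij_betw_def)
    then show ?thesis by auto
  qed
  define \<rho> where "\<rho> A x y \<longleftrightarrow> (\<exists>e\<in>Hom C A (Base M).
    rel_at C X A x (Cmp C A (Base M) (Base X) a e) \<and> rel_at C X A (Cmp C A (Base M) (Base X) b e) y)"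
    for A x y
  \<comment> \<open>For the converse direction, \<open>(a e, b e)\<close> factors through
    \<open>M\<close>, and \<open>x\<close> lies below \<open>a e\<close> while \<open>y\<close> lies
    above \<open>b e\<close>; the order-ideal property then gives the factorization of
    \<open>(x, y)\<close>.\<close>
  have factors: "factors_through ?E (disc A) M P m k \<longleftrightarrow> \<rho> A x y"
    if A: "A \<in> Obj C" and x: "x \<in> Hom C A (Base X)" and y: "y \<in> Hom C A (Base X)"
      and k: "k \<in> Hom ?E (disc A) P"
      and pk: "Cmp ?E (disc A) P X p k = pc_class C (disc A) X x"
      and qk: "Cmp ?E (disc A) P X q k = pc_class C (disc A) X y" for A x y k
  proof -
    let ?D = "disc A"
    have D: "pseudocongruence C ?D" "Base ?D = A" using A by (simp_all add: disc)
    have DE: "?D \<in> Obj ?E" using D by (simp add: Obj_ex)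
    note px = premorphism_disc[OF A O(2) x] and py = premorphism_disc[OF A O(2) y]
    have me: "Cmp ?E ?D P X p (Cmp ?E ?D M P m (pc_class C ?D M e)) =
        pc_class C ?D X (Cmp C A (Base M) (Base X) a e)"
      "Cmp ?E ?D P X q (Cmp ?E ?D M P m (pc_class C ?D M e)) =
        pc_class C ?D X (Cmp C A (Base M) (Base X) b e)"
      "Cmp C A (Base M) (Base X) a e \<in> pc_premorphisms C ?D X"
      "Cmp C A (Base M) (Base X) b e \<in> pc_premorphisms C ?D X"
      "pc_class C ?D M e \<in> Hom ?E ?D M"
      if e: "e \<in> pc_premorphisms C ?D M" for e
      using pc_class_Hom[OF e] DE ME E premorphism_comp[OF D(1) O(3,2) e pa]
        premorphism_comp[OF D(1) O(3,2) e pb]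
      by (simp_all add: ex.comp_assoc pm qm Cmp_ex D O e pa pb)
    show ?thesis
    proof
      assume "factors_through ?E ?D M P m k"
      then obtain f where f: "f \<in> Hom ?E ?D M" "k = Cmp ?E ?D M P m f" by (auto simp: factors_through_def)
      obtain e where e: "e \<in> pc_premorphisms C ?D M" "f = pc_class C ?D M e" using f(1) by (rule Hom_exE)
      show "\<rho> A x y"
        unfolding \<rho>_def using pk qk me(1-4)[OF e(1)] px py premorphism_hom[OF e(1)]
        by (intro bexI[of _ e]) (simp_all add: f e pc_class_eq_iff D O)
    next
      assume "\<rho> A x y"
      then obtain e where e: "e \<in> Hom C A (Base M)" "rel_at C X A x (Cmp C A (Base M) (Base X) a e)"
        "rel_at C X A (Cmp C A (Base M) (Base X) b e) y" by (auto simp: \<rho>_def)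
      have pe: "e \<in> pc_premorphisms C ?D M" by (rule premorphism_disc[OF A O(3) e(1)])
      let ?k = "Cmp ?E ?D M P m (pc_class C ?D M e)"
      have kE: "?k \<in> Hom ?E ?D P" using me(5)[OF pe] DE ME E by (intro ex.comp_hom)
      have "factors_through ?E ?D M P m ?k" using me(5)[OF pe] by (auto simp: factors_through_def)
      moreover have "Le ?E ?D X (Cmp ?E ?D P X p k) (Cmp ?E ?D P X p ?k)"
        "Le ?E ?D X (Cmp ?E ?D P X q ?k) (Cmp ?E ?D P X q k)"
        using me(3,4)[OF pe] e(2,3) px py by (simp_all add: me(1,2)[OF pe] pk qk Le_ex D O)
      ultimately show "factors_through ?E ?D M P m k"
        using cong DE k kE unfolding congruence_def by blast
    qed
  qed
  have dpair: "\<exists>k\<in>Hom ?E (disc A) P. Cmp ?E (disc A) P X p k = pc_class C (disc A) X x \<and>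
      Cmp ?E (disc A) P X q k = pc_class C (disc A) X y"
    if "A \<in> Obj C" "x \<in> Hom C A (Base X)" "y \<in> Hom C A (Base X)" for A x y
    using that by (intro pair pc_class_Hom premorphism_disc O) (simp_all add: Obj_ex disc)
  \<comment> \<open>Reflexivity of the congruence gives \<open>\<rho> A x x\<close>, and the
    right-hand relation in \<rho> absorbs the step from \<open>x\<close> to
    \<open>y\<close>.\<close>
  have \<rho>_R: "\<rho> A x y" if A: "A \<in> Obj C" and xy: "rel_at C X A x y" for A x y
  proof -
    have x: "x \<in> Hom C A (Base X)" using rel_at_hom[OF pseudocongruence_parallel[OF O(2)] A xy] by simp
    obtain k where k: "k \<in> Hom ?E (disc A) P" "Cmp ?E (disc A) P X p k = pc_class C (disc A) X x"
      "Cmp ?E (disc A) P X q k = pc_class C (disc A) X x" using dpair[OF A x x] by blast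
    have "disc A \<in> Obj ?E" using A by (simp add: Obj_ex disc)
    then have "factors_through ?E (disc A) M P m k"
      using cong k unfolding congruence_def by metis
    then have "\<rho> A x x" using factors[OF A x x k] by blast
    then show ?thesis using rel_at_trans[OF O(2) A _ xy] by (auto simp: \<rho>_def)
  qed
  have \<rho>_trans: "\<rho> A x z" if A: "A \<in> Obj C"
    and h: "x \<in> Hom C A (Base X)" "y \<in> Hom C A (Base X)" "z \<in> Hom C A (Base X)"
    and xy: "\<rho> A x y" and yz: "\<rho> A y z" for A x y z
  proof -
    have D: "disc A \<in> Obj ?E" using A by (simp add: Obj_ex disc)
    obtain k where k: "k \<in> Hom ?E (disc A) P" "Cmp ?E (disc A) P X p k = pc_class C (disc A) X x"
      "Cmp ?E (disc A) P X q k = pc_class C (disc A) X y" using dpair[OF A h(1,2)] by blast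
    obtain k' where k': "k' \<in> Hom ?E (disc A) P" "Cmp ?E (disc A) P X p k' = pc_class C (disc A) X y"
      "Cmp ?E (disc A) P X q k' = pc_class C (disc A) X z" using dpair[OF A h(2,3)] by blast
    obtain l where l: "l \<in> Hom ?E (disc A) P" "Cmp ?E (disc A) P X p l = pc_class C (disc A) X x"
      "Cmp ?E (disc A) P X q l = pc_class C (disc A) X z" using dpair[OF A h(1,3)] by blast
    have "factors_through ?E (disc A) M P m k" "factors_through ?E (disc A) M P m k'"
      using factors[OF A h(1,2) k] factors[OF A h(2,3) k'] xy yz by auto
    then have "factors_through ?E (disc A) M P m l"
      using cong D k k' l unfolding congruence_def by metis
    then show ?thesis using factors[OF A h(1,3) l] by blast
  qed
  \<comment> \<open>The unknowns 0 and 1 are \<open>x\<close> and \<open>y\<close>, and 2 is the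
    witness \<open>e\<close>. Index \<open>True\<close> stands for the relation of \<open>x\<close>
    to \<open>a e\<close>, \<open>False\<close> for that of \<open>b e\<close> to
    \<open>y\<close>.\<close>
  let ?V = "\<lambda>i::nat. if i = 2 then Base M else Base X"
  have "\<exists>L r. weakly_represents {0,1,2} ?V L r (\<lambda>A x. \<forall>k\<in>UNIV.
      rel_at C X A (Cmp C A (?V (if k then 0 else 2)) (Base X) (if k then Idt C (Base X) else b) (x (if k then 0 else 2)))
        (Cmp C A (?V (if k then 2 else 1)) (Base X) (if k then a else Idt C (Base X)) (x (if k then 2 else 1))))"
    by (rule weak_solution_rel[of "{0,1,2}" "UNIV :: bool set" ?V "\<lambda>k. if k then 0 else 2" "\<lambda>k. if k then 2 else 1" "\<lambda>_. X"
        "\<lambda>k. if k then Idt C (Base X) else b" "\<lambda>k. if k then a else Idt C (Base X)"])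
      (simp_all add: pseudocongruence_parallel O id_hom)
  then obtain L r where Lr: "weakly_represents {0,1,2} ?V L r (\<lambda>A x. \<forall>k\<in>UNIV.
      rel_at C X A (Cmp C A (?V (if k then 0 else 2)) (Base X) (if k then Idt C (Base X) else b) (x (if k then 0 else 2)))
        (Cmp C A (?V (if k then 2 else 1)) (Base X) (if k then a else Idt C (Base X)) (x (if k then 2 else 1))))"
    by (elim exE)
  note L = weakly_representsD(1)[OF Lr] and r = weakly_representsD(2)[OF Lr]
    and w = weakly_representsD(3)[OF Lr]
  have r': "r 0 \<in> Hom C L (Base X)" "r 1 \<in> Hom C L (Base X)" "r 2 \<in> Hom C L (Base M)"
    using r[of 0] r[of 1] r[of 2] by simp_all
  have "\<exists>Y. pseudocongruence C Y \<and> Base Y = Base X \<and>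
    (\<forall>A\<in>Obj C. \<forall>x\<in>Hom C A (Base X). \<forall>y\<in>Hom C A (Base X). rel_at C Y A x y \<longleftrightarrow> \<rho> A x y)"
  proof (rule pseudocongruence_exists[OF B(2) L r'(1,2)])
    fix A x y assume A: "A \<in> Obj C" and x: "x \<in> Hom C A (Base X)" and y: "y \<in> Hom C A (Base X)"
    have "rel_at C X A x (Cmp C A (Base M) (Base X) a e) \<and> rel_at C X A (Cmp C A (Base M) (Base X) b e) y \<longleftrightarrow>
      (\<exists>h\<in>Hom C A L. x = Cmp C A L (Base X) (r 0) h \<and> y = Cmp C A L (Base X) (r 1) h \<and>
        e = Cmp C A L (Base M) (r 2) h)" if e: "e \<in> Hom C A (Base M)" for e
    proof -
      let ?x = "\<lambda>i. if i = 0 then x else if i = 1 then y else e"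
      have "?x i \<in> Hom C A (?V i)" if "i \<in> {0, 1, 2}" for i
        using that x y e by auto
      from w[OF A this] show ?thesis
        using A x y e by (simp add: all_bool_eq comp_id_left)
    qed
    \<comment> \<open>Forgetting the component \<open>r 2\<close> quantifies \<open>e\<close>
      existentially.\<close>
    then show "\<rho> A x y \<longleftrightarrow> (\<exists>h\<in>Hom C A L. x = Cmp C A L (Base X) (r 0) h \<and> y = Cmp C A L (Base X) (r 1) h)"
      unfolding \<rho>_def using A L r' comp_hom[OF A L B(3) _ r'(3)] by blast
  qed (use \<rho>_R rel_at_Le[OF O(2)] \<rho>_trans in blast)+
  then obtain Y where Y: "pseudocongruence C Y" and BY[simp]: "Base Y = Base X"
    and rY: "\<And>A x y. A \<in> Obj C \<Longrightarrow> x \<in> Hom C A (Base X) \<Longrightarrow> y \<in> Hom C A (Base X) \<Longrightarrow>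
      rel_at C Y A x y \<longleftrightarrow> \<rho> A x y" by auto
  have i: "Idt C (Base X) \<in> pc_premorphisms C X Y"
    by (rule premorphismI[OF O(2) Y]) (simp_all add: id_hom comp_id_left rY \<rho>_R)
  let ?f = "pc_class C X Y (Idt C (Base X))"
  have f: "Cmp ?E Z X Y ?f (pc_class C Z X u) = pc_class C Z Y u" "u \<in> pc_premorphisms C Z Y"
    if Z: "pseudocongruence C Z" and u: "u \<in> pc_premorphisms C Z X" for Z u
    using premorphism_comp[OF Z O(2) Y u i]
    by (simp_all add: Cmp_ex Z O Y u i comp_id_left pseudocongruence_Base premorphism_hom[OF u])
  have YE: "Y \<in> Obj ?E" using Y by (simp add: Obj_ex)
  have "is_comma ?E M X X Y (Cmp ?E M P X p m) (Cmp ?E M P X q m) ?f ?f"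
    unfolding is_comma_def
  proof (intro conjI ballI)
    fix Z assume ZE: "Z \<in> Obj ?E"
    then have Z: "pseudocongruence C Z" by (simp add: Obj_ex)
    note BZ[simp] = pseudocongruence_Base[OF Z]
    show "poset_iso (Hom ?E Z M) (Le ?E Z M)
        {(a, b). a \<in> Hom ?E Z X \<and> b \<in> Hom ?E Z X \<and> Le ?E Z Y (Cmp ?E Z X Y ?f a) (Cmp ?E Z X Y ?f b)}
        (rel_prod (Le ?E Z X) (Le ?E Z X))
        (\<lambda>h. (Cmp ?E Z M X (Cmp ?E M P X p m) h, Cmp ?E Z M X (Cmp ?E M P X q m) h))"
    proof (rule poset_isoI)
      show "poset_on (Hom ?E Z M) (Le ?E Z M)" by (rule ex.hom_poset[OF ZE ME])
    next
      fix u assume "u \<in> Hom ?E Z M"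
      then obtain u0 where u0: "u0 \<in> pc_premorphisms C Z M" "u = pc_class C Z M u0" by (rule Hom_exE)
      note hu[simp] = premorphism_hom[OF u0(1)]
      have ca: "Cmp C (Base Z) (Base M) (Base X) a u0 \<in> pc_premorphisms C Z X"
        and cb: "Cmp C (Base Z) (Base M) (Base X) b u0 \<in> pc_premorphisms C Z X"
        using premorphism_comp[OF Z O(3,2) u0(1)] pa pb by auto
      have "\<rho> (Base Z) (Cmp C (Base Z) (Base M) (Base X) a u0) (Cmp C (Base Z) (Base M) (Base X) b u0)"
        unfolding \<rho>_def using premorphism_hom[OF ca] premorphism_hom[OF cb]
        by (intro bexI[of _ u0] conjI rel_at_refl[OF O(2)]) auto
      then show "(Cmp ?E Z M X (Cmp ?E M P X p m) u, Cmp ?E Z M X (Cmp ?E M P X q m) u) \<in>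
        {(a, b). a \<in> Hom ?E Z X \<and> b \<in> Hom ?E Z X \<and> Le ?E Z Y (Cmp ?E Z X Y ?f a) (Cmp ?E Z X Y ?f b)}"
        using ca cb f[OF Z ca] f[OF Z cb]
        by (simp add: pm qm u0 Cmp_ex Z O pa pb pc_class_Hom Le_ex Y rY premorphism_hom)
    next
      fix u v assume u: "u \<in> Hom ?E Z M" and v: "v \<in> Hom ?E Z M"
      have mu: "Cmp ?E Z M P m u \<in> Hom ?E Z P" "Cmp ?E Z M P m v \<in> Hom ?E Z P"
        using u v ZE ME E by (auto intro!: ex.comp_hom)
      have "Le ?E Z M u v \<longleftrightarrow> Le ?E Z P (Cmp ?E Z M P m u) (Cmp ?E Z M P m v)"
        using om u v ZE ME E ex.comp_mono_right[of Z M u v P m] by (auto simp: order_mono_def)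
      also have "\<dots> \<longleftrightarrow> rel_prod (Le ?E Z X) (Le ?E Z X)
          (Cmp ?E Z P X p (Cmp ?E Z M P m u), Cmp ?E Z P X q (Cmp ?E Z M P m u))
          (Cmp ?E Z P X p (Cmp ?E Z M P m v), Cmp ?E Z P X q (Cmp ?E Z M P m v))"
        using prod ZE mu by (simp add: is_product_def poset_iso_def)
      finally show "Le ?E Z M u v \<longleftrightarrow> rel_prod (Le ?E Z X) (Le ?E Z X)
          (Cmp ?E Z M X (Cmp ?E M P X p m) u, Cmp ?E Z M X (Cmp ?E M P X q m) u)
          (Cmp ?E Z M X (Cmp ?E M P X p m) v, Cmp ?E Z M X (Cmp ?E M P X q m) v)"
        using u v ZE ME E by (simp add: ex.comp_assoc)
    next
      fix uv assume "uv \<in> {(a, b). a \<in> Hom ?E Z X \<and> b \<in> Hom ?E Z X \<and>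
        Le ?E Z Y (Cmp ?E Z X Y ?f a) (Cmp ?E Z X Y ?f b)}"
      then obtain u v where uv: "uv = (u, v)" and u: "u \<in> Hom ?E Z X" and v: "v \<in> Hom ?E Z X"
        and le: "Le ?E Z Y (Cmp ?E Z X Y ?f u) (Cmp ?E Z X Y ?f v)" by auto
      obtain u0 where u0: "u0 \<in> pc_premorphisms C Z X" "u = pc_class C Z X u0" using u by (rule Hom_exE)
      obtain v0 where v0: "v0 \<in> pc_premorphisms C Z X" "v = pc_class C Z X v0" using v by (rule Hom_exE)
      note huv[simp] = premorphism_hom[OF u0(1)] premorphism_hom[OF v0(1)]
      have \<rho>uv: "\<rho> (Base Z) u0 v0"
        using le f[OF Z u0(1)] f[OF Z v0(1)] by (simp add: u0 v0 Le_ex Z Y rY)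
      obtain k where k: "k \<in> Hom ?E Z P" "Cmp ?E Z P X p k = u" "Cmp ?E Z P X q k = v"
        using pair[OF ZE u v] by blast
      obtain k0 where k0: "k0 \<in> pc_premorphisms C Z P" "k = pc_class C Z P k0" using k(1) by (rule Hom_exE)
      \<comment> \<open>The link between \<rho> and \<open>M\<close> is known for discrete domains
        only, so \<open>k\<close> is first restricted along the morphism from \<open>?D\<close> to
        \<open>Z\<close> represented by the identity, and factored there.\<close>
      let ?D = "disc (Base Z)"
      have D: "pseudocongruence C ?D" and BD[simp]: "Base ?D = Base Z" by (simp_all add: disc)
      have DE: "?D \<in> Obj ?E" using D by (simp add: Obj_ex)
      have j: "Idt C (Base Z) \<in> pc_premorphisms C ?D Z" by (rule premorphism_disc) (simp_all add: Z id_hom)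
      have dd: "Cmp ?E ?D Z T (pc_class C Z T t) (pc_class C ?D Z (Idt C (Base Z))) = pc_class C ?D T t"
        if "pseudocongruence C T" "t \<in> pc_premorphisms C Z T" for T t
        using that by (simp add: Cmp_ex D Z j comp_id_right pseudocongruence_Base premorphism_hom)
      have kd: "k0 \<in> pc_premorphisms C ?D P"
        by (rule premorphism_disc) (simp_all add: O premorphism_hom[OF k0(1)])
      have "Cmp ?E ?D P X p (pc_class C ?D P k0) = pc_class C ?D X u0"
        "Cmp ?E ?D P X q (pc_class C ?D P k0) = pc_class C ?D X v0"
        using k(2,3) dd[OF O(2) u0(1)] dd[OF O(2) v0(1)] dd[OF O(1) k0(1)] k(1) DE ZE E pc_class_Hom[OF j]
        by (simp_all add: u0(2)[symmetric] v0(2)[symmetric] k0(2)[symmetric] ex.comp_assoc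
            flip: dd[OF O(2) u0(1)] dd[OF O(2) v0(1)] dd[OF O(1) k0(1)])
      then have "factors_through ?E ?D M P m (pc_class C ?D P k0)"
        using factors[of "Base Z" u0 v0] pc_class_Hom[OF kd] \<rho>uv by simp
      then obtain e where e: "e \<in> Hom ?E ?D M" "pc_class C ?D P k0 = Cmp ?E ?D M P m e"
        by (auto simp: factors_through_def)
      obtain e0 where e0: "e0 \<in> pc_premorphisms C ?D M" "e = pc_class C ?D M e0" using e(1) by (rule Hom_exE)
      have R: "rel_at C P (Base Z) k0 (Cmp C (Base Z) (Base M) (Base P) m0 e0)"
        "rel_at C P (Base Z) (Cmp C (Base Z) (Base M) (Base P) m0 e0) k0"
        using e(2) premorphism_comp[OF D O(3,1) e0(1) m0(1)]
        by (simp_all add: e0 m0 Cmp_ex D O pc_class_eq_iff kd)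
      \<comment> \<open>Back to \<open>Z\<close>: \<open>m0 e0\<close> is equivalent to
        \<open>k0\<close>, which preserves the preorder of \<open>Z\<close>, and \<open>m0\<close>
        reflects relations.\<close>
      have e1: "e0 \<in> pc_premorphisms C Z M"
        by (rule premorphism_lift[OF O(3,1) Z _ _ k0(1) _ R(2,1)])
          (use premorphism_hom[OF m0(1)] premorphism_hom[OF e0(1)]
            order_mono_ex_reflects[OF O(3,1) m0(1)] om m0(2) in auto)
      have "Cmp ?E Z M P m (pc_class C Z M e0) = k"
        using R premorphism_comp[OF Z O(3,1) e1 m0(1)]
        by (simp add: m0 k0 e1 Cmp_ex Z O pc_class_eq_iff)
      then have "Cmp ?E Z M X (Cmp ?E M P X p m) (pc_class C Z M e0) = u"
        "Cmp ?E Z M X (Cmp ?E M P X q m) (pc_class C Z M e0) = v"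
        using k pc_class_Hom[OF e1] ZE ME E by (simp_all flip: ex.comp_assoc)
      then show "\<exists>h\<in>Hom ?E Z M. (Cmp ?E Z M X (Cmp ?E M P X p m) h, Cmp ?E Z M X (Cmp ?E M P X q m) h) = uv"
        using pc_class_Hom[OF e1] uv by blast
    qed
  qed (use ME E YE pc_class_Hom[OF i] in \<open>auto intro!: ex.comp_hom\<close>)
  then show ?thesis unfolding effective_def using YE pc_class_Hom[OF i] by blast
qed

end

theorem theorem3p9:
  fixes C :: "('o, 'm) pcat"
  assumes "weakly_lex TYPE(nat) TYPE(nat) TYPE(nat) C"
  shows "exact TYPE('d) TYPE('e) TYPE('w) (ex_completion C)"
proof -
  interpret weakly_lex_category C
    using assms by (auto simp: weakly_lex_def weakly_lex_category_def weakly_lex_category_axioms_def)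
  show ?thesis
    unfolding exact_def using ex_regular ex_effective by blast
qed

end
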